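(* Let $R>1$, $c>-2$, and let $T\in\mathcal{B}(H)$ satisfy $\sigma(T)\subset A_R$. Then $T\in\mathbb{DLA}_R(c)$ if and only if the mapping $$S_{R,c}:\mathcal{A}(A_R)\to\mathcal{B}(H),\qquad f=\sum_{n\in\mathbb{Z}}a_nz^n\mapsto\frac{1}{2+c}\Big[\int_{\partial A_R}\mu(\sigma,T)f(\sigma)\,ds+ca_0\Big]$$ is contractive.
   Context: $H$ is a complex Hilbert space and $\mathcal{B}(H)$ the bounded operators on it; scalars are identified with multiples of the identity. $\Re X=\frac12(X+X^* )$ and $X\ge0$ means $X$ is a positive operator. $\mathbb{D}$ is the open unit disk. The annulus is $A_R=\{z\in\mathbb{C}:1/R<|z|<R\}$. $\mathcal{A}(A_R)$ is the uniform algebra of continuous functions on $\overline{A_R}$ that are holomorphic on $A_R$, with the supremum norm; $\sum_{n}a_nz^n$ denotes the Laurent expansion of $f$ on $A_R$. Class $\mathbb{DLA}_R(c)$: all bounded Hilbert space operators $T$ such that (i) $\sigma(T)\subset\overline{A_R}$, and (ii) $2\Re\big[(1-zT/R)^{-1}+(1-wT^{-1}/R)^{-1}\big]-2+c\ge0$ for all $z,w\in\mathbb{D}$. Double-layer potential kernel: $\partial A_R$ is positively oriented (outer circle counter-clockwise, inner circle clockwise), $s$ denotes arc length and $\sigma=\sigma(s)$ the arc-length parametrization. For $\sigma(s)\notin\sigma(T)$, $$\mu(\sigma(s),T)=\frac{1}{2\pi i}\Big(\sigma'(s)(\sigma(s)-T)^{-1}-\overline{\sigma'(s)}\,(\overline{\sigma(s)}-T^*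 )^{-1}\Big).$$ *)

theory Defs
  imports "HOL-Complex_Analysis.Complex_Analysis"
begin

section \<open>Complex Hilbert spaces\<close>

text \<open>
  A complex Hilbert space is a real Hilbert space (complete \<^class>\<open>real_inner\<close> space) with a
  compatible complex scalar multiplication and a sesquilinear form \<open>cinner\<close> whose real part is
  the real inner product. The form is linear in the first and conjugate linear in the second
  argument. Positive definiteness and \<open>norm x = sqrt (Re (cinner x x))\<close> follow from the axioms of
  \<^class>\<open>real_inner\<close>. The zero space is allowed.
\<close>

class complex_hilbert = real_inner + banach +
  fixes scaleC :: "complex \<Rightarrow> 'a \<Rightarrow> 'a" (infixr "*\<^sub>C" 75)
    and cinner :: "'a \<Rightarrow> 'a \<Rightarrow> complex"
  assumes scaleC_add_right: "a *\<^sub>C (x + y) = a *\<^sub>C x + a *\<^sub>C y"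
    and scaleC_add_left: "(a + b) *\<^sub>C x = a *\<^sub>C x + b *\<^sub>C x"
    and scaleC_scaleC: "a *\<^sub>C (b *\<^sub>C x) = (a * b) *\<^sub>C x"
    and scaleC_of_real: "complex_of_real r *\<^sub>C x = r *\<^sub>R x"
    and cinner_commute: "cinner x y = cnj (cinner y x)"
    and cinner_add_left: "cinner (x + y) z = cinner x z + cinner y z"
    and cinner_scaleC_left: "cinner (a *\<^sub>C x) y = a * cinner x y"
    and Re_cinner: "Re (cinner x y) = inner x y"


section \<open>The algebra of bounded operators\<close>

text \<open>
  \<open>\<B>(H)\<close> is represented as the closed subset of complex linear maps in the Banach space
  \<open>H \<Rightarrow>\<^sub>L H\<close> of bounded real linear maps; the operator norm is the one of the latter.
\<close>

definition bounded_ops :: "('a::complex_hilbert \<Rightarrow>\<^sub>L 'a) set" where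
  "bounded_ops = {T. \<forall>a x. blinfun_apply T (a *\<^sub>C x) = a *\<^sub>C blinfun_apply T x}"

text \<open>
  The operator \<open>a \<cdot> I\<close>. Multiplication of an operator \<open>T\<close> by a complex scalar \<open>a\<close> is written
  \<open>scalar_op a o\<^sub>L T\<close>.
\<close>

definition scalar_op :: "complex \<Rightarrow> ('a::complex_hilbert \<Rightarrow>\<^sub>L 'a)" where
  "scalar_op a = Blinfun (\<lambda>x. a *\<^sub>C x)"

definition is_op_inverse :: "('a::complex_hilbert \<Rightarrow>\<^sub>L 'a) \<Rightarrow> ('a \<Rightarrow>\<^sub>L 'a) \<Rightarrow> bool" where
  "is_op_inverse T S \<longleftrightarrow> S \<in> bounded_ops \<and> S o\<^sub>L T = id_blinfun \<and> T o\<^sub>L S = id_blinfun"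

definition op_inverse :: "('a::complex_hilbert \<Rightarrow>\<^sub>L 'a) \<Rightarrow> ('a \<Rightarrow>\<^sub>L 'a)" where
  "op_inverse T = (THE S. is_op_inverse T S)"

definition op_spectrum :: "('a::complex_hilbert \<Rightarrow>\<^sub>L 'a) \<Rightarrow> complex set" where
  "op_spectrum T = {z. \<not> (\<exists>S. is_op_inverse (scalar_op z - T) S)}"

definition op_adjoint :: "('a::complex_hilbert \<Rightarrow>\<^sub>L 'a) \<Rightarrow> ('a \<Rightarrow>\<^sub>L 'a)" where
  "op_adjoint T = (THE S. S \<in> bounded_ops \<and>
     (\<forall>x y. cinner (blinfun_apply T x) y = cinner x (blinfun_apply S y)))"

definition op_Re :: "('a::complex_hilbert \<Rightarrow>\<^sub>L 'a) \<Rightarrow> ('a \<Rightarrow>\<^sub>L 'a)" where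
  "op_Re X = (1 / 2) *\<^sub>R (X + op_adjoint X)"

definition positive_op :: "('a::complex_hilbert \<Rightarrow>\<^sub>L 'a) \<Rightarrow> bool" where
  "positive_op X \<longleftrightarrow> X \<in> bounded_ops \<and>
     (\<forall>x. cinner (blinfun_apply X x) x \<in> \<real> \<and> 0 \<le> Re (cinner (blinfun_apply X x) x))"


section \<open>The annulus and its function algebra\<close>

definition annulus :: "real \<Rightarrow> complex set" where
  "annulus R = {z. 1 / R < cmod z \<and> cmod z < R}"

text \<open>
  Elements of the function algebra are represented by total functions on the complex plane;
  their values outside the closed annulus are irrelevant to everything below.
\<close>

definition annulus_algebra :: "real \<Rightarrow> (complex \<Rightarrow> complex) set" where
  "annulus_algebra R = {f. continuous_on (closure (annulus R)) f \<and> f holomorphic_on annulus R}"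

definition annulus_norm :: "real \<Rightarrow> (complex \<Rightarrow> complex) \<Rightarrow> real" where
  "annulus_norm R f = (SUP z\<in>closure (annulus R). cmod (f z))"

text \<open>The coefficients of the (unique) Laurent expansion of \<open>f\<close> on the annulus.\<close>

definition laurent_coeffs :: "real \<Rightarrow> (complex \<Rightarrow> complex) \<Rightarrow> (int \<Rightarrow> complex)" where
  "laurent_coeffs R f =
     (THE a. \<forall>z\<in>annulus R. ((\<lambda>n. a n * z powi n) has_sum f z) UNIV)"


section \<open>The double-layer class and the double-layer potential kernel\<close>

definition DLA :: "real \<Rightarrow> real \<Rightarrow> ('a::complex_hilbert \<Rightarrow>\<^sub>L 'a) set" where
  "DLA R c = {T \<in> bounded_ops.
     op_spectrum T \<subseteq> closure (annulus R) \<and>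
     (\<forall>z\<in>ball 0 1. \<forall>w\<in>ball 0 1.
        positive_op
          (2 *\<^sub>R op_Re
              (op_inverse (id_blinfun - (scalar_op (z / complex_of_real R) o\<^sub>L T))
             + op_inverse (id_blinfun - (scalar_op (w / complex_of_real R) o\<^sub>L op_inverse T)))
           - scalar_op 2 + scalar_op (complex_of_real c)))}"

text \<open>
  Arc-length parametrizations of the two components of the positively oriented boundary, the
  outer one over \<open>{0..2 * pi * R}\<close> and the (clockwise) inner one over \<open>{0..2 * pi / R}\<close>.
\<close>

definition outer_circle :: "real \<Rightarrow> real \<Rightarrow> complex" where
  "outer_circle R s = complex_of_real R * cis (s / R)"

definition inner_circle :: "real \<Rightarrow> real \<Rightarrow> complex" where
  "inner_circle R s = complex_of_real (1 / R) * cis (- (R * s))"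

definition dlp_kernel ::
    "(real \<Rightarrow> complex) \<Rightarrow> real \<Rightarrow> ('a::complex_hilbert \<Rightarrow>\<^sub>L 'a) \<Rightarrow> ('a \<Rightarrow>\<^sub>L 'a)" where
  "dlp_kernel \<gamma> s T =
     (let \<gamma>' = vector_derivative \<gamma> (at s) in
      scalar_op (1 / (2 * complex_of_real pi * \<i>)) o\<^sub>L
        ((scalar_op \<gamma>' o\<^sub>L op_inverse (scalar_op (\<gamma> s) - T))
         - (scalar_op (cnj \<gamma>') o\<^sub>L op_inverse (scalar_op (cnj (\<gamma> s)) - op_adjoint T))))"

definition dlp_integral ::
    "real \<Rightarrow> ('a::complex_hilbert \<Rightarrow>\<^sub>L 'a) \<Rightarrow> (complex \<Rightarrow> complex) \<Rightarrow> ('a \<Rightarrow>\<^sub>L 'a)" where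
  "dlp_integral R T f =
     integral {0..2 * pi * R}
       (\<lambda>s. dlp_kernel (outer_circle R) s T o\<^sub>L scalar_op (f (outer_circle R s)))
   + integral {0..2 * pi / R}
       (\<lambda>s. dlp_kernel (inner_circle R) s T o\<^sub>L scalar_op (f (inner_circle R s)))"

definition S_map ::
    "real \<Rightarrow> real \<Rightarrow> ('a::complex_hilbert \<Rightarrow>\<^sub>L 'a) \<Rightarrow> (complex \<Rightarrow> complex) \<Rightarrow> ('a \<Rightarrow>\<^sub>L 'a)" where
  "S_map R c T f = (1 / (2 + c)) *\<^sub>R
     (dlp_integral R T f + scalar_op (complex_of_real c * laurent_coeffs R f 0))"

end

theory Submission
  imports Defs
begin

text \<open>
  On the outer circle put \<open>\<sigma> = R\<zeta>\<close>, on the inner circle \<open>\<sigma> = \<zeta>/R\<close>, with \<open>\<bar>\<zeta>\<bar> = 1\<close>. With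
  \<open>U(z) = (1 - zT/R)\<^sup>-\<^sup>1\<close> and \<open>V(w) = (1 - wT\<^sup>-\<^sup>1/R)\<^sup>-\<^sup>1\<close>, the double-layer kernel times arc length
  becomes the normalised measure on the unit circle with density \<open>2 Re U(cnj \<zeta>)\<close> on the outer
  and \<open>2 Re V(\<zeta>) - 2\<close> on the inner circle (\<open>dlp_integral_eq\<close>). The constant coefficient \<open>a\<^sub>0\<close>
  is the mean of \<open>f\<close> over either circle (\<open>laurent_coeff_0\<close>). So \<open>S\<close> integrates boundary values
  of \<open>f\<close> against these densities plus \<open>c\<close>, where the constant \<open>c\<close>, or indeed any constant,
  may be moved from one circle to the other without changing the integral.

  The theorem splits into two equivalences with the intermediate property that \<open>S\<close> is positive:
  \<open>Re f \<ge> 0\<close> implies \<open>Re (S f) \<ge> 0\<close>.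

  \<^item> If \<open>T\<close> is in the class, fix a vector \<open>x\<close> and let \<open>\<alpha>\<close> be the minimum over the outer circle
    of \<open>2 Re \<langle>U(cnj \<zeta>)x, x\<rangle>\<close>. Move \<open>\<alpha>\<close> from the outer to the inner circle: both scalar densities
    are then nonnegative, the inner one by the defining inequality of the class, so \<open>S\<close> is
    positive (\<open>S_map_positive_if_DLA\<close>). The number \<open>\<alpha>\<close> depends on \<open>x\<close>, and nothing provides a
    single operator that separates the two densities; that is why positivity is tested one vector
    at a time.

  \<^item> A positive unital linear map on an algebra of functions is contractive
    (\<open>S_map_contractive_if_positive\<close>): for \<open>\<bar>f\<bar> \<le> 1\<close> and \<open>\<bar>\<omega>\<bar> = 1\<close> the Poisson-type function
    \<open>1 + 2 \<Sum> (r\<omega>f)\<^sup>n\<close> has nonnegative real part; applying \<open>S\<close> and averaging over \<open>\<omega>\<close> against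
    the vectors \<open>x - \<omega>y\<close> isolates \<open>\<langle>S(f)x, y\<rangle>\<close>.

  \<^item> A contractive unital map is positive, by expanding \<open>\<bar>1 - tf\<bar>\<close> to first order in \<open>t\<close>
    (\<open>S_map_positive_if_contractive\<close>).

  \<^item> If \<open>S\<close> is positive, test it on Laurent polynomials whose real parts are truncated Poisson
    kernels on the two circles, with independently chosen poles \<open>a\<close> and \<open>b\<close> in the unit disc
    (\<open>Laurent_polynomial_boundary_values\<close>). As the truncation is removed, the two integrals
    reproduce \<open>2 Re U(a)\<close> and \<open>2 Re V(b) - 2\<close>, which gives the inequality that defines the class
    (\<open>DLA_if_contractive\<close>).

  Three general ingredients are developed on the way: adjoints of bounded operators through the
  Riesz representation theorem, the Laurent expansion on an annulus, and the analyticity of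
  resolvents.
\<close>

section \<open>Hilbert space basics\<close>

lemma cinner_add_right: "cinner x (y + z) = cinner x y + cinner x z"
  by (metis cinner_add_left cinner_commute complex_cnj_add)

lemma cinner_scaleC_right: "cinner x (a *\<^sub>C y) = cnj a * cinner x y"
  by (metis cinner_commute cinner_scaleC_left complex_cnj_mult)

lemma scaleR_eq_scaleC: "r *\<^sub>R x = complex_of_real r *\<^sub>C (x::'a::complex_hilbert)"
  by (simp add: scaleC_of_real)

lemma scaleC_one [simp]: "1 *\<^sub>C x = (x::'a::complex_hilbert)"
  using scaleC_of_real[of 1 x] by simp

lemma scaleC_minus_one: "(- 1) *\<^sub>C x = - (x::'a::complex_hilbert)"
  using scaleC_of_real[of "-1" x] by simp

lemma scaleC_zero_left [simp]: "0 *\<^sub>C x = (0::'a::complex_hilbert)"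
  using scaleC_of_real[of 0 x] by simp

lemma cinner_minus_left: "cinner (- x) y = - cinner x y"
  by (metis cinner_scaleC_left mult_minus1 scaleC_minus_one)

lemma cinner_minus_right: "cinner x (- y) = - cinner x y"
  by (metis cinner_minus_left cinner_commute complex_cnj_minus)

lemma cinner_diff_left: "cinner (x - y) z = cinner x z - cinner y z"
  by (metis cinner_add_left cinner_minus_left diff_conv_add_uminus)

lemma cinner_diff_right: "cinner x (y - z) = cinner x y - cinner x z"
  by (metis cinner_add_right cinner_minus_right diff_conv_add_uminus)

lemma cinner_scaleR_left: "cinner (r *\<^sub>R x) y = r *\<^sub>R cinner x y"
  by (simp add: scaleR_eq_scaleC cinner_scaleC_left scaleR_conv_of_real)

lemma cinner_self: "cinner x x = complex_of_real ((norm x)\<^sup>2)"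
proof -
  have "Im (cinner x x) = 0"
    using arg_cong[OF cinner_commute[of x x], of Im] by simp
  then show ?thesis
    by (simp add: complex_eq_iff Re_cinner power2_norm_eq_inner)
qed

lemma cinner_zero_left [simp]: "cinner 0 y = 0"
  using cinner_minus_left[of 0 y] by simp

lemma cinner_eqI: "(\<And>y. cinner x y = cinner x' y) \<Longrightarrow> x = x'"
  using cinner_self[of "x - x'"]
  by (simp add: cinner_diff_left)

lemma norm_scaleC: "norm (a *\<^sub>C x) = cmod a * norm (x::'a::complex_hilbert)"
proof -
  have "complex_of_real ((norm (a *\<^sub>C x))\<^sup>2) = complex_of_real ((cmod a * norm x)\<^sup>2)"
  proof -
    have "complex_of_real ((norm (a *\<^sub>C x))\<^sup>2) = (a * cnj a) * cinner x x"
      unfolding cinner_self[symmetric] by (simp add: cinner_scaleC_left cinner_scaleC_right)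
    then show ?thesis
      by (simp add: cinner_self power_mult_distrib complex_norm_square[symmetric])
  qed
  then have "(norm (a *\<^sub>C x))\<^sup>2 = (cmod a * norm x)\<^sup>2"
    using of_real_eq_iff by blast
  then show ?thesis
    by (meson norm_ge_zero power2_eq_imp_eq zero_le_mult_iff)
qed

lemma cinner_Cauchy_Schwarz: "cmod (cinner x y) \<le> norm x * norm y"
proof (cases "cinner x y = 0")
  case False
  define a where "a = cnj (cinner x y) / cmod (cinner x y)"
  have "cmod a = 1" using False by (simp add: a_def norm_divide)
  have "a * cinner x y = cmod (cinner x y)"
    using False by (simp add: a_def complex_norm_square[symmetric] power2_eq_square mult.commute)
  then have "cmod (cinner x y) = inner (a *\<^sub>C x) y"
    by (metis Re_cinner Re_complex_of_real cinner_scaleC_left)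
  also have "\<dots> \<le> norm (a *\<^sub>C x) * norm y" by (rule norm_cauchy_schwarz)
  also have "\<dots> = norm x * norm y" by (simp add: norm_scaleC \<open>cmod a = 1\<close>)
  finally show ?thesis .
qed auto

lemma bounded_linear_cinner_left: "bounded_linear (\<lambda>x. cinner x y)"
  by (rule bounded_linear_intro[where K="norm y"])
     (auto simp: cinner_add_left cinner_scaleR_left cinner_Cauchy_Schwarz)

lemma bounded_linear_scaleC: "bounded_linear (\<lambda>x::'a::complex_hilbert. a *\<^sub>C x)"
  by (rule bounded_linear_intro[where K="cmod a"])
     (auto simp: scaleC_add_right scaleR_eq_scaleC scaleC_scaleC norm_scaleC mult.commute)

text \<open>
  The vanishing of the first variation at a minimum, for a quadratic polynomial.
\<close>

lemma quadratic_nonneg_imp_linear_zero: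
  fixes d n :: real
  assumes "\<And>t. 0 \<le> t\<^sup>2 * n + 2 * t * d" "0 \<le> n"
  shows "d = 0"
proof -
  \<comment> \<open>The denominator \<open>n + 1\<close> instead of \<open>n\<close> avoids a separate case \<open>n = 0\<close>.\<close>
  define t where "t = - d / (n + 1)"
  have d: "d = - (t * (n + 1))" using assms(2) by (simp add: t_def)
  have "0 \<le> t\<^sup>2 * n + 2 * t * d" by (rule assms(1))
  also have "\<dots> = - (t\<^sup>2 * (n + 2))" unfolding d by (simp add: power2_eq_square algebra_simps)
  finally have "t\<^sup>2 * (n + 2) \<le> 0" by simp
  then have "t = 0" using assms(2) by (simp add: mult_le_0_iff)
  with d show ?thesis by simp
qed

lemma scaleC_diff_right: "a *\<^sub>C (x - y) = a *\<^sub>C x - a *\<^sub>C (y::'a::complex_hilbert)"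
  using bounded_linear.linear[OF bounded_linear_scaleC] linear_diff by blast

lemma scaleC_minus_right: "a *\<^sub>C (- x) = - (a *\<^sub>C (x::'a::complex_hilbert))"
  using bounded_linear.linear[OF bounded_linear_scaleC] linear_neg by blast

lemma scaleC_scaleR_commute: "a *\<^sub>C (r *\<^sub>R x) = r *\<^sub>R (a *\<^sub>C (x::'a::complex_hilbert))"
  by (simp add: scaleR_eq_scaleC scaleC_scaleC mult.commute)

lemma cinner_sum_left: "cinner (\<Sum>i\<in>I. g i) y = (\<Sum>i\<in>I. cinner (g i) y)"
  by (induction I rule: infinite_finite_induct) (simp_all add: cinner_add_left)

text \<open>
  The case \<open>y = kAx\<close>, with \<open>k\<close> chosen such that \<open>y\<close> has the norm of \<open>x\<close>. The hypothesis is the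
  shape in which averaging arguments produce a bound for a sesquilinear form.
\<close>

lemma norm_blinfun_le_1I:
  fixes A :: "'b::real_inner \<Rightarrow>\<^sub>L 'b"
  assumes "\<And>x y. 2 * inner (blinfun_apply A x) y \<le> (norm x)\<^sup>2 + (norm y)\<^sup>2"
  shows "norm A \<le> 1"
proof (rule norm_blinfun_bound)
  fix x
  show "norm (blinfun_apply A x) \<le> 1 * norm x"
  proof (cases "blinfun_apply A x = 0")
    case False
    define k where "k = norm x / norm (blinfun_apply A x)"
    have kA: "norm (k *\<^sub>R blinfun_apply A x) = norm x" using False by (simp add: k_def)
    have "inner (blinfun_apply A x) (k *\<^sub>R blinfun_apply A x) =
        k * (norm (blinfun_apply A x) * norm (blinfun_apply A x))"
      by (simp add: power2_norm_eq_inner flip: power2_eq_square)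
    also have "\<dots> = norm x * norm (blinfun_apply A x)" using False by (simp add: k_def)
    finally have "2 * (norm x * norm (blinfun_apply A x)) \<le> (norm x)\<^sup>2 + (norm x)\<^sup>2"
      using assms[of x "k *\<^sub>R blinfun_apply A x"] by (simp only: kA)
    then have "norm x * norm (blinfun_apply A x) \<le> norm x * norm x"
      by (simp add: power2_eq_square)
    moreover have "x \<noteq> 0" using False by auto
    ultimately show ?thesis by simp
  qed simp
qed simp

text \<open>
  Riesz representation, by the direct method: a minimising sequence of the strictly convex
  functional \<open>\<parallel>x\<parallel>\<^sup>2 - 2 \<phi>(x)\<close> is Cauchy by the parallelogram law, and its limit
  represents \<open>\<phi>\<close> because the first variation vanishes there.
\<close>

lemma riesz_representation:
  fixes \<phi> :: "'a::{real_inner, banach} \<Rightarrow> real"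
  assumes "bounded_linear \<phi>"
  shows "\<exists>y. \<forall>x. \<phi> x = inner x y"
proof -
  interpret bounded_linear \<phi> by fact
  define J where "J x = (norm x)\<^sup>2 - 2 * \<phi> x" for x
  obtain K where K: "\<And>x. norm (\<phi> x) \<le> norm x * K" using bounded by blast
  have lower: "- K\<^sup>2 \<le> J x" for x
  proof -
    have "\<phi> x \<le> norm x * K" using K[of x] by auto
    moreover have "0 \<le> (norm x - K)\<^sup>2" by simp
    ultimately show ?thesis
      by (simp add: J_def power2_eq_square algebra_simps)
  qed
  define m where "m = Inf (range J)"
  have bdd: "bdd_below (range J)" by (rule bdd_belowI2[of _ "- K\<^sup>2"]) (rule lower)
  have m_le: "m \<le> J x" for x
    unfolding m_def by (rule cInf_lower[OF _ bdd]) auto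
  have "\<exists>x. J x < m + 1 / real (Suc n)" for n
  proof -
    have "Inf (range J) < m + 1 / real (Suc n)" by (simp add: m_def)
    then show ?thesis
      using cInf_lessD[of "range J" "m + 1 / real (Suc n)"] by auto
  qed
  then obtain X where X: "\<And>n. J (X n) < m + 1 / real (Suc n)" by metis
  \<comment> \<open>The parallelogram law; the linear part of \<open>J\<close> cancels.\<close>
  have par: "(norm (x - y))\<^sup>2 = 2 * J x + 2 * J y - 4 * J ((1/2) *\<^sub>R (x + y))" for x y
    by (simp add: J_def power2_norm_eq_inner inner_diff inner_add add scaleR
        inner_commute algebra_simps) 
  have dist: "(norm (X i - X j))\<^sup>2 < 4 / real (Suc n)" if "i \<ge> n" "j \<ge> n" for i j n
  proof -
    have *: "J (X k) < m + 1 / real (Suc n)" if "k \<ge> n" for k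
    proof -
      have "1 / real (Suc k) \<le> 1 / real (Suc n)" using that by (simp add: field_simps)
      then show ?thesis using X[of k] by linarith
    qed
    have "4 / real (Suc n) = 4 * (1 / real (Suc n))" by simp
    then show ?thesis
      using *[OF that(1)] *[OF that(2)] par[of "X i" "X j"] m_le[of "(1/2) *\<^sub>R (X i + X j)"]
      by linarith
  qed
  have "Cauchy X"
  proof (rule metric_CauchyI)
    fix e :: real assume "e > 0"
    obtain n where n: "4 / e\<^sup>2 < real (Suc n)"
      by (metis less_SucI of_nat_less_iff reals_Archimedean2 less_trans lessI)
    then have "4 / real (Suc n) < e\<^sup>2" using \<open>e > 0\<close> by (simp add: field_simps)
    then have "norm (X i - X j) < e" if "i \<ge> n" "j \<ge> n" for i j
      using dist[OF that] \<open>e > 0\<close> by (meson less_imp_le less_trans power2_less_imp_less)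
    then show "\<exists>M. \<forall>i\<ge>M. \<forall>j\<ge>M. dist (X i) (X j) < e"
      by (auto simp: dist_norm)
  qed
  then obtain y where y: "X \<longlonglongrightarrow> y" using Cauchy_convergent_iff convergent_def by blast
  have "(\<lambda>n. J (X n)) \<longlonglongrightarrow> J y"
    unfolding J_def by (intro tendsto_intros y tendsto)
  moreover have "(\<lambda>n. m + 1 / real (Suc n)) \<longlonglongrightarrow> m + 0"
    by (intro tendsto_intros LIMSEQ_Suc[OF lim_1_over_n])
  ultimately have "J y \<le> m + 0"
    by (rule LIMSEQ_le) (use X in \<open>auto intro: less_imp_le\<close>)
  then have "J y \<le> m" by simp
  have min: "J y \<le> J x" for x using \<open>J y \<le> m\<close> m_le[of x] by linarith
  have "\<phi> x = inner x y" for x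
  proof -
    have "0 \<le> t\<^sup>2 * (norm x)\<^sup>2 + 2 * t * (inner x y - \<phi> x)" for t
    proof -
      have "inner (y + t *\<^sub>R x) (y + t *\<^sub>R x) =
          inner y y + t * inner y x + (t * inner x y + t * (t * inner x x))"
        by (simp only: inner_add_left inner_add_right inner_scaleR_left inner_scaleR_right)
           (simp only: algebra_simps)
      then have "(norm (y + t *\<^sub>R x))\<^sup>2 = (norm y)\<^sup>2 + 2 * t * inner x y + t\<^sup>2 * (norm x)\<^sup>2"
        unfolding power2_norm_eq_inner inner_commute[of y x]
        by (simp add: power2_eq_square algebra_simps)
      moreover have "(norm y)\<^sup>2 - 2 * \<phi> y \<le> (norm (y + t *\<^sub>R x))\<^sup>2 - 2 * (\<phi> y + t * \<phi> x)"
        using min[of "y + t *\<^sub>R x"] by (simp only: J_def add scaleR real_scaleR_def)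
      ultimately show ?thesis by (simp add: right_diff_distrib)
    qed
    then have "inner x y - \<phi> x = 0"
      by (rule quadratic_nonneg_imp_linear_zero) simp
    then show ?thesis by simp
  qed
  then show ?thesis by blast
qed

section \<open>Bounded operators, adjoints and inverses\<close>

lemma scalar_op_apply [simp]: "blinfun_apply (scalar_op a) x = a *\<^sub>C x"
  unfolding scalar_op_def by (simp add: bounded_linear_Blinfun_apply bounded_linear_scaleC)

lemma bounded_opsD: "T \<in> bounded_ops \<Longrightarrow> blinfun_apply T (a *\<^sub>C x) = a *\<^sub>C blinfun_apply T x"
  by (simp add: bounded_ops_def)

lemma scalar_op_in: "scalar_op a \<in> bounded_ops"
  by (simp add: bounded_ops_def scaleC_scaleC mult.commute)

lemma id_in_bounded_ops: "id_blinfun \<in> bounded_ops"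
  by (simp add: bounded_ops_def)

lemma add_in_bounded_ops: "A \<in> bounded_ops \<Longrightarrow> B \<in> bounded_ops \<Longrightarrow> A + B \<in> bounded_ops"
  by (simp add: bounded_ops_def blinfun.add_left scaleC_add_right)

lemma diff_in_bounded_ops: "A \<in> bounded_ops \<Longrightarrow> B \<in> bounded_ops \<Longrightarrow> A - B \<in> bounded_ops"
  by (simp add: bounded_ops_def blinfun.diff_left scaleC_diff_right)

lemma scaleR_in_bounded_ops: "A \<in> bounded_ops \<Longrightarrow> r *\<^sub>R A \<in> bounded_ops"
  by (simp add: bounded_ops_def blinfun.scaleR_left scaleC_scaleR_commute)

lemma compose_in_bounded_ops: "A \<in> bounded_ops \<Longrightarrow> B \<in> bounded_ops \<Longrightarrow> A o\<^sub>L B \<in> bounded_ops"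
  by (simp add: bounded_ops_def)

lemmas bounded_ops_intros =
  scalar_op_in id_in_bounded_ops add_in_bounded_ops diff_in_bounded_ops
  scaleR_in_bounded_ops compose_in_bounded_ops

lemma norm_scalar_op_le: "norm (scalar_op a) \<le> cmod a"
  by (rule norm_blinfun_bound) (auto simp: norm_scaleC)

lemma bounded_linear_scalar_op: "bounded_linear scalar_op"
  by (rule bounded_linear_intro[where K=1])
     (auto intro!: blinfun_eqI simp: norm_scalar_op_le scaleC_add_left blinfun.add_left
        blinfun.scaleR_left scaleR_eq_scaleC scaleC_scaleC scaleR_conv_of_real)

lemma blinfun_compose_id [simp]: "id_blinfun o\<^sub>L A = A" "A o\<^sub>L id_blinfun = A"
  by (simp_all add: blinfun_eqI)

lemma blinfun_cinner_eqI:
  assumes "\<And>x y. cinner (blinfun_apply A x) y = cinner (blinfun_apply B x) y"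
  shows "A = B"
  by (intro blinfun_eqI cinner_eqI assms)

text \<open>
  Riesz representation of \<open>x \<mapsto> inner (T x) y\<close> gives a real adjoint. It is also the adjoint for
  \<open>cinner\<close> because the imaginary part of \<open>cinner u v\<close> is \<open>- Re (cinner (\<i>u) v)\<close> and \<open>T\<close> commutes
  with multiplication by \<open>\<i>\<close>.
\<close>

lemma op_adjoint_exists:
  assumes "T \<in> bounded_ops"
  shows "\<exists>S. S \<in> bounded_ops \<and>
     (\<forall>x y. cinner (blinfun_apply T x) y = cinner x (blinfun_apply S y))"
proof -
  have "\<exists>z. \<forall>x. inner (blinfun_apply T x) y = inner x z" for y
    by (rule riesz_representation)
       (rule bounded_linear_compose[OF bounded_linear_inner_left blinfun.bounded_linear_right])
  then obtain S where S: "\<And>x y. inner (blinfun_apply T x) y = inner x (S y)" by metis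
  have cS: "cinner (blinfun_apply T x) y = cinner x (S y)" for x y
  proof -
    have *: "Im (cinner u v) = - Re (cinner (\<i> *\<^sub>C u) v)" for u v :: 'a
      by (simp add: cinner_scaleC_left)
    have "Im (cinner (blinfun_apply T x) y) = Im (cinner x (S y))"
      unfolding * bounded_opsD[OF assms, symmetric] by (simp only: Re_cinner S)
    moreover have "Re (cinner (blinfun_apply T x) y) = Re (cinner x (S y))"
      by (simp only: Re_cinner S)
    ultimately show ?thesis by (simp add: complex_eq_iff)
  qed
  have ext: "u = v" if "\<And>x. cinner x u = cinner x v" for u v :: 'a
    by (metis cinner_commute cinner_eqI that)
  have add: "S (y + y') = S y + S y'" for y y'
    by (rule ext) (simp add: cS[symmetric] cinner_add_right)
  have scale: "S (a *\<^sub>C y) = a *\<^sub>C S y" for a y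
    by (rule ext) (simp add: cS[symmetric] cinner_scaleC_right)
  have bl: "bounded_linear S"
  proof (rule bounded_linear_intro[where K="norm T"])
    show "S (r *\<^sub>R y) = r *\<^sub>R S y" for r y
      by (simp add: scaleR_eq_scaleC scale)
    show "norm (S y) \<le> norm y * norm T" for y
    proof -
      have "(norm (S y))\<^sup>2 = inner (blinfun_apply T (S y)) y"
        by (simp add: power2_norm_eq_inner S)
      also have "\<dots> \<le> norm (blinfun_apply T (S y)) * norm y" by (rule norm_cauchy_schwarz)
      also have "\<dots> \<le> norm T * norm (S y) * norm y"
        by (intro mult_right_mono norm_blinfun) auto
      finally have "norm (S y) * norm (S y) \<le> norm (S y) * (norm y * norm T)"
        by (simp add: power2_eq_square mult_ac)
      then show ?thesis
        by (cases "S y = 0") auto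
    qed
  qed (rule add)
  show ?thesis
    by (rule exI[of _ "Blinfun S"])
       (simp add: bounded_ops_def bounded_linear_Blinfun_apply[OF bl] scale cS)
qed

lemma op_adjoint_props:
  assumes "T \<in> bounded_ops"
  shows op_adjoint_in: "op_adjoint T \<in> bounded_ops"
    and cinner_adjoint_right:
      "cinner x (blinfun_apply (op_adjoint T) y) = cinner (blinfun_apply T x) y"
proof -
  let ?P = "\<lambda>S. S \<in> bounded_ops \<and>
     (\<forall>x y. cinner (blinfun_apply T x) y = cinner x (blinfun_apply S y))"
  obtain S where S: "?P S" using op_adjoint_exists[OF assms] by blast
  have "S' = S" if "?P S'" for S'
    using S that by (intro blinfun_cinner_eqI) (metis cinner_commute)
  then have "?P (op_adjoint T)"
    unfolding op_adjoint_def using S by (rule_tac theI[of ?P S]) auto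
  then show "op_adjoint T \<in> bounded_ops"
    and "cinner x (blinfun_apply (op_adjoint T) y) = cinner (blinfun_apply T x) y"
    by auto
qed

lemma cinner_adjoint_left:
  "T \<in> bounded_ops \<Longrightarrow>
    cinner (blinfun_apply (op_adjoint T) x) y = cnj (cinner (blinfun_apply T y) x)"
  by (metis cinner_adjoint_right cinner_commute)

lemma op_adjoint_unique:
  assumes "T \<in> bounded_ops"
    and "\<And>x y. cinner (blinfun_apply S x) y = cnj (cinner (blinfun_apply T y) x)"
  shows "op_adjoint T = S"
  by (rule blinfun_cinner_eqI) (simp add: assms cinner_adjoint_left)

lemma op_adjoint_diff:
  "A \<in> bounded_ops \<Longrightarrow> B \<in> bounded_ops \<Longrightarrow> op_adjoint (A - B) = op_adjoint A - op_adjoint B"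
  by (rule op_adjoint_unique)
     (auto intro: bounded_ops_intros simp: blinfun.diff_left cinner_diff_left cinner_adjoint_left)

lemma op_adjoint_compose:
  "A \<in> bounded_ops \<Longrightarrow> B \<in> bounded_ops \<Longrightarrow> op_adjoint (A o\<^sub>L B) = op_adjoint B o\<^sub>L op_adjoint A"
  by (rule op_adjoint_unique)
     (auto intro: bounded_ops_intros simp: cinner_adjoint_left cinner_adjoint_right
        cinner_commute[symmetric])

lemma op_adjoint_scalar: "op_adjoint (scalar_op a) = scalar_op (cnj a)"
  by (rule op_adjoint_unique)
     (auto intro: bounded_ops_intros simp: cinner_scaleC_left cinner_commute[symmetric])

lemma op_adjoint_id: "op_adjoint id_blinfun = id_blinfun"
  by (rule op_adjoint_unique) (auto intro: bounded_ops_intros simp: cinner_commute[symmetric])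

lemma norm_op_adjoint_le:
  assumes "T \<in> bounded_ops"
  shows "norm (op_adjoint T) \<le> norm T"
proof (rule norm_blinfun_bound)
  fix y
  let ?s = "blinfun_apply (op_adjoint T) y"
  have "(norm ?s)\<^sup>2 = cmod (cinner ?s ?s)" by (simp add: cinner_self norm_power)
  also have "\<dots> = cmod (cinner (blinfun_apply T ?s) y)"
    by (simp add: cinner_adjoint_right[OF assms])
  also have "\<dots> \<le> norm (blinfun_apply T ?s) * norm y" by (rule cinner_Cauchy_Schwarz)
  also have "\<dots> \<le> norm T * norm ?s * norm y" by (intro mult_right_mono norm_blinfun) auto
  finally have "norm ?s * norm ?s \<le> norm ?s * (norm T * norm y)"
    by (simp add: power2_eq_square mult_ac)
  then show "norm ?s \<le> norm T * norm y"
    by (cases "?s = 0") auto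
qed simp

lemma continuous_on_op_adjoint:
  fixes A :: "'b::metric_space \<Rightarrow> ('a::complex_hilbert \<Rightarrow>\<^sub>L 'a)"
  assumes "continuous_on S A" "\<And>s. s \<in> S \<Longrightarrow> A s \<in> bounded_ops"
  shows "continuous_on S (\<lambda>s. op_adjoint (A s))"
proof (unfold continuous_on_iff, intro ballI allI impI)
  fix x e assume x: "x \<in> S" and "(0::real) < e"
  then obtain d where d: "d > 0" "\<And>x'. x' \<in> S \<Longrightarrow> dist x' x < d \<Longrightarrow> dist (A x') (A x) < e"
    using assms(1) unfolding continuous_on_iff by blast
  have "dist (op_adjoint (A x')) (op_adjoint (A x)) \<le> dist (A x') (A x)" if "x' \<in> S" for x'
    using norm_op_adjoint_le[of "A x' - A x"] assms(2) x that
    by (simp add: dist_norm op_adjoint_diff diff_in_bounded_ops)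
  with d show "\<exists>d>0. \<forall>x'\<in>S. dist x' x < d \<longrightarrow> dist (op_adjoint (A x')) (op_adjoint (A x)) < e"
    by (meson le_less_trans)
qed

lemma is_op_inverse_unique: "is_op_inverse T S \<Longrightarrow> is_op_inverse T S' \<Longrightarrow> S = S'"
  unfolding is_op_inverse_def
  by (metis blinfun_eqI blinfun_apply_blinfun_compose blinfun_apply_id_blinfun)

lemma op_inverse_eqI: "is_op_inverse T S \<Longrightarrow> op_inverse T = S"
  unfolding op_inverse_def by (rule the_equality) (auto intro: is_op_inverse_unique)

lemma is_op_inverse_op_inverse: "is_op_inverse T S \<Longrightarrow> is_op_inverse T (op_inverse T)"
  by (simp add: op_inverse_eqI)

lemma is_op_inverse_apply:
  assumes "is_op_inverse T S"
  shows "blinfun_apply T (blinfun_apply S x) = x" "blinfun_apply S (blinfun_apply T x) = x"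
  using assms unfolding is_op_inverse_def
  by (metis blinfun_apply_blinfun_compose blinfun_apply_id_blinfun)+

lemma is_op_inverseI:
  assumes "S \<in> bounded_ops" "\<And>x. blinfun_apply T (blinfun_apply S x) = x"
    "\<And>x. blinfun_apply S (blinfun_apply T x) = x"
  shows "is_op_inverse T S"
  using assms unfolding is_op_inverse_def by (auto intro!: blinfun_eqI)

lemma is_op_inverse_adjoint:
  assumes "T \<in> bounded_ops" "is_op_inverse T S"
  shows "is_op_inverse (op_adjoint T) (op_adjoint S)"
  using assms unfolding is_op_inverse_def
  by (metis op_adjoint_compose op_adjoint_id op_adjoint_in)

lemma Re_cinner_op_Re:
  assumes "X \<in> bounded_ops"
  shows "cinner (blinfun_apply (op_Re X) x) x = complex_of_real (Re (cinner (blinfun_apply X x) x))"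
  by (simp add: op_Re_def blinfun.scaleR_left blinfun.add_left cinner_scaleR_left cinner_add_left
      cinner_adjoint_left[OF assms] complex_eq_iff)

lemma op_Re_in: "X \<in> bounded_ops \<Longrightarrow> op_Re X \<in> bounded_ops"
  unfolding op_Re_def by (intro bounded_ops_intros op_adjoint_in)

section \<open>Means over the unit circle\<close>

definition circle_mean :: "(complex \<Rightarrow> 'b::real_normed_vector) \<Rightarrow> 'b" where
  "circle_mean g = (1 / (2 * pi)) *\<^sub>R integral {0..2 * pi} (\<lambda>t. g (cis t))"

lemma continuous_on_circle_cis:
  "continuous_on (sphere 0 1) g \<Longrightarrow> continuous_on S (\<lambda>t. g (cis t))"
  by (rule continuous_on_compose2[where f=cis and g=g]) (auto intro!: continuous_intros)

lemma integrable_circle_cis: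
  fixes g :: "complex \<Rightarrow> 'b::banach"
  assumes "continuous_on (sphere 0 1) g"
  shows "(\<lambda>t. g (cis t)) integrable_on {0..2 * pi}"
  by (intro integrable_continuous_real continuous_on_circle_cis assms)

lemma circle_mean_cong:
  "(\<And>\<zeta>. cmod \<zeta> = 1 \<Longrightarrow> f \<zeta> = g \<zeta>) \<Longrightarrow> circle_mean f = circle_mean g"
  unfolding circle_mean_def by simp

lemma circle_mean_const [simp]: "circle_mean (\<lambda>_. c) = (c::'b::banach)"
  by (simp add: circle_mean_def)

lemma circle_mean_add:
  fixes f g :: "complex \<Rightarrow> 'b::banach"
  assumes "continuous_on (sphere 0 1) f" "continuous_on (sphere 0 1) g"
  shows "circle_mean (\<lambda>\<zeta>. f \<zeta> + g \<zeta>) = circle_mean f + circle_mean g"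
  unfolding circle_mean_def
  by (simp add: integral_add integrable_circle_cis assms scaleR_add_right)

lemma circle_mean_diff:
  fixes f g :: "complex \<Rightarrow> 'b::banach"
  assumes "continuous_on (sphere 0 1) f" "continuous_on (sphere 0 1) g"
  shows "circle_mean (\<lambda>\<zeta>. f \<zeta> - g \<zeta>) = circle_mean f - circle_mean g"
  unfolding circle_mean_def
  by (simp add: integral_diff integrable_circle_cis assms scaleR_diff_right)

lemma circle_mean_linear:
  fixes f :: "complex \<Rightarrow> 'b::banach" and h :: "'b \<Rightarrow> 'c::banach"
  assumes "bounded_linear h" "continuous_on (sphere 0 1) f"
  shows "circle_mean (\<lambda>\<zeta>. h (f \<zeta>)) = h (circle_mean f)"
proof -
  interpret bounded_linear h by fact
  have "integral {0..2 * pi} (h \<circ> (\<lambda>t. f (cis t))) = h (integral {0..2 * pi} (\<lambda>t. f (cis t)))"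
    by (rule integral_linear[OF integrable_circle_cis[OF assms(2)] assms(1)])
  then show ?thesis by (simp add: circle_mean_def o_def scaleR)
qed

lemma circle_mean_mult_left:
  fixes f :: "complex \<Rightarrow> complex"
  assumes "continuous_on (sphere 0 1) f"
  shows "circle_mean (\<lambda>\<zeta>. c * f \<zeta>) = c * circle_mean f"
  by (rule circle_mean_linear[OF bounded_linear_mult_right assms])

lemma circle_mean_mult_right:
  fixes f :: "complex \<Rightarrow> complex"
  assumes "continuous_on (sphere 0 1) f"
  shows "circle_mean (\<lambda>\<zeta>. f \<zeta> * c) = circle_mean f * c"
  by (rule circle_mean_linear[OF bounded_linear_mult_left assms])

lemma circle_mean_sum:
  fixes f :: "'i \<Rightarrow> complex \<Rightarrow> 'b::banach"
  assumes "finite I" "\<And>i. i \<in> I \<Longrightarrow> continuous_on (sphere 0 1) (f i)"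
  shows "circle_mean (\<lambda>\<zeta>. \<Sum>i\<in>I. f i \<zeta>) = (\<Sum>i\<in>I. circle_mean (f i))"
  using assms by (induction I) (simp_all add: circle_mean_add continuous_on_sum)

lemma circle_mean_nonneg:
  fixes f :: "complex \<Rightarrow> real"
  assumes "continuous_on (sphere 0 1) f" "\<And>\<zeta>. cmod \<zeta> = 1 \<Longrightarrow> 0 \<le> f \<zeta>"
  shows "0 \<le> circle_mean f"
  unfolding circle_mean_def
  by (simp add: integral_nonneg integrable_circle_cis assms)

lemma norm_circle_mean_le:
  fixes f :: "complex \<Rightarrow> 'b::banach"
  assumes "continuous_on (sphere 0 1) f" "\<And>\<zeta>. cmod \<zeta> = 1 \<Longrightarrow> norm (f \<zeta>) \<le> M"
  shows "norm (circle_mean f) \<le> M"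
proof -
  have "norm (integral {0..2 * pi} (\<lambda>t. f (cis t))) \<le> M * (2 * pi - 0)"
    by (rule integral_bound) (auto intro!: continuous_on_circle_cis assms)
  then show ?thesis
    by (simp add: circle_mean_def field_simps)
qed

text \<open>
  Conjugation reverses the orientation of the circle and preserves arc length. This is what
  removes the clockwise orientation of the inner boundary circle.
\<close>

lemma circle_mean_cnj:
  fixes g :: "complex \<Rightarrow> 'b::real_normed_vector"
  shows "circle_mean (\<lambda>\<zeta>. g (cnj \<zeta>)) = circle_mean g"
proof -
  have "integral {0..2 * pi} (\<lambda>t. g (cis t)) = integral {-2 * pi..0} (\<lambda>t. g (cis (t + 2 * pi)))"
    using integral_shift_real_ivl[where a=0 and b="2 * pi" and c="2 * pi" and f="\<lambda>t. g (cis t)"] by simp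
  also have "\<dots> = integral {-2 * pi..0} (\<lambda>t. g (cis t))"
    by (simp flip: cis_mult)
  also have "\<dots> = integral {0..2 * pi} (\<lambda>t. g (cis (- t)))"
    using Henstock_Kurzweil_Integration.integral_reflect_real
      [where a="-2 * pi" and b=0 and f="\<lambda>t. g (cis t)"] by simp
  finally show ?thesis by (simp add: circle_mean_def cis_cnj)
qed

lemma contour_integral_circle_mean:
  assumes "r > 0"
  shows "contour_integral (circlepath 0 r) (\<lambda>u. g u / u) =
    2 * of_real pi * \<i> * circle_mean (\<lambda>\<zeta>. g (of_real r * \<zeta>))"
proof -
  have "contour_integral (circlepath 0 r) (\<lambda>u. g u / u) =
      integral {0..2 * pi} (\<lambda>t. \<i> * g (of_real r * cis t))"
    unfolding circlepath_def
    by (subst contour_integral_part_circlepath_eq)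
       (use assms in \<open>auto intro!: integral_cong\<close>)
  also have "\<dots> = \<i> * integral {0..2 * pi} (\<lambda>t. g (of_real r * cis t))"
    by simp
  finally show ?thesis by (simp add: circle_mean_def scaleR_conv_of_real)
qed

lemma cnj_eq_inverse: "cmod z = 1 \<Longrightarrow> cnj z = inverse z"
  using divide_conv_cnj[of z 1] by (simp add: inverse_eq_divide)

text \<open>
  Cauchy's formula for higher derivatives on the boundary circle itself, because the resolvents
  below are considered on the closed disc and not on a neighbourhood of it.
\<close>

lemma circle_mean_Taylor:
  assumes "continuous_on (cball 0 1) U" "U holomorphic_on ball 0 1"
  shows "circle_mean (\<lambda>\<zeta>. U \<zeta> * cnj \<zeta> ^ n) = (deriv ^^ n) U 0 / fact n"
proof -
  have "((\<lambda>u. U u / (u - 0) ^ Suc n) has_contour_integral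
      2 * of_real pi * \<i> / fact n * (deriv ^^ n) U 0) (circlepath 0 1)"
    using Cauchy_has_contour_integral_higher_derivative_circlepath[OF assms, of 0 n] by simp
  then have "contour_integral (circlepath 0 1) (\<lambda>u. (U u / u ^ n) / u) =
      2 * of_real pi * \<i> / fact n * (deriv ^^ n) U 0"
    by (simp add: contour_integral_unique mult.commute)
  then have "2 * of_real pi * \<i> * circle_mean (\<lambda>\<zeta>. U \<zeta> / \<zeta> ^ n) =
      2 * of_real pi * \<i> * ((deriv ^^ n) U 0 / fact n)"
    unfolding contour_integral_circle_mean[OF zero_less_one] by simp
  then have "circle_mean (\<lambda>\<zeta>. U \<zeta> / \<zeta> ^ n) = (deriv ^^ n) U 0 / fact n"
    by (simp only: mult_cancel_left) simp
  moreover have "circle_mean (\<lambda>\<zeta>. U \<zeta> * cnj \<zeta> ^ n) = circle_mean (\<lambda>\<zeta>. U \<zeta> / \<zeta> ^ n)"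
    by (rule circle_mean_cong) (simp only: cnj_eq_inverse power_inverse divide_inverse)
  ultimately show ?thesis by simp
qed

lemma circle_mean_centre:
  assumes "continuous_on (cball 0 1) U" "U holomorphic_on ball 0 1"
  shows "circle_mean U = U 0"
  using circle_mean_Taylor[OF assms, of 0] by simp

lemma circle_mean_mult_power:
  assumes "continuous_on (cball 0 1) U" "U holomorphic_on ball 0 1" "n > 0"
  shows "circle_mean (\<lambda>\<zeta>. U \<zeta> * \<zeta> ^ n) = 0"
  by (subst circle_mean_centre) (use assms in \<open>auto intro!: continuous_intros holomorphic_intros\<close>)

lemma circle_mean_powi: "circle_mean (\<lambda>\<zeta>. \<zeta> powi k) = (if k = 0 then 1 else 0)"
proof -
  have pos: "circle_mean (\<lambda>\<zeta>. \<zeta> ^ n) = 0" if "n > 0" for n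
    using circle_mean_mult_power[of "\<lambda>_. 1" n] that by simp
  consider "k = 0" | "k > 0" | "k < 0" by linarith
  then show ?thesis
  proof cases
    case 3
    have "circle_mean (\<lambda>\<zeta>. \<zeta> powi k) = circle_mean (\<lambda>\<zeta>. cnj \<zeta> ^ nat (- k))"
      by (rule circle_mean_cong)
         (use 3 in \<open>simp add: power_int_def cnj_eq_inverse\<close>)
    also have "\<dots> = circle_mean (\<lambda>\<zeta>. \<zeta> ^ nat (- k))"
      by (rule circle_mean_cnj[of "\<lambda>\<zeta>. \<zeta> ^ nat (- k)"])
    finally show ?thesis using 3 pos by simp
  qed (auto simp: power_int_def pos)
qed

section \<open>The annulus\<close>

lemma open_annulus: "open (annulus R)"
proof -
  have "annulus R = {z. 1 / R < cmod z} \<inter> {z. cmod z < R}" by (auto simp: annulus_def)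
  then show ?thesis
    by (auto intro!: open_Int open_Collect_less continuous_intros)
qed

text \<open>
  A boundary point is approached radially, by moving its modulus towards \<open>1\<close>.
\<close>

lemma closure_annulus:
  assumes "R > 1"
  shows "closure (annulus R) = {z. 1 / R \<le> cmod z \<and> cmod z \<le> R}"
proof
  have "closed ({z. 1 / R \<le> cmod z} \<inter> {z. cmod z \<le> R})"
    by (intro closed_Int closed_Collect_le continuous_intros)
  then have "closed {z. 1 / R \<le> cmod z \<and> cmod z \<le> R}"
    by (simp add: Collect_conj_eq)
  then show "closure (annulus R) \<subseteq> {z. 1 / R \<le> cmod z \<and> cmod z \<le> R}"
    by (rule closure_minimal[rotated]) (auto simp: annulus_def)
  show "{z. 1 / R \<le> cmod z \<and> cmod z \<le> R} \<subseteq> closure (annulus R)"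
  proof
    fix z assume "z \<in> {z. 1 / R \<le> cmod z \<and> cmod z \<le> R}"
    then have z: "1 / R \<le> cmod z" "cmod z \<le> R" by auto
    have R1: "1 / R < 1" using assms by simp
    then have "z \<noteq> 0" using z assms by (auto simp: field_simps)
    show "z \<in> closure (annulus R)"
      unfolding closure_approachable
    proof (intro allI impI)
      fix e :: real assume "e > 0"
      define t where "t = min 1 (e / (2 * R))"
      have t: "0 < t" "t \<le> 1" "t * R < e"
        using \<open>e > 0\<close> assms by (auto simp: t_def min_def field_simps)
      define \<rho> where "\<rho> = cmod z + t * (1 - cmod z)"
      have eq: "\<rho> - a = (1 - t) * (cmod z - a) + t * (1 - a)" for a
        unfolding \<rho>_def by (simp add: algebra_simps)
      have "0 < \<rho> - 1 / R" "\<rho> - R < 0"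
      proof -
        have "0 \<le> (1 - t) * (cmod z - 1 / R)" "0 < t * (1 - 1 / R)"
          using t z R1 by simp_all
        then show "0 < \<rho> - 1 / R" unfolding eq[of "1 / R"] by (rule add_nonneg_pos)
        have "(1 - t) * (cmod z - R) \<le> 0" "t * (1 - R) < 0"
          using t z assms by (simp_all add: mult_nonneg_nonpos mult_pos_neg)
        then show "\<rho> - R < 0" unfolding eq[of R] by (rule add_nonpos_neg)
      qed
      then have \<rho>: "1 / R < \<rho>" "\<rho> < R" by simp_all
      have "0 < \<rho>" using \<rho> assms by (meson less_trans divide_pos_pos zero_less_one)
      have "dist (of_real \<rho> * sgn z) z = cmod ((of_real \<rho> - of_real (cmod z)) * sgn z)"
        by (simp add: dist_norm algebra_simps sgn_eq)
      also have "\<dots> = \<bar>\<rho> - cmod z\<bar>"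
        using \<open>z \<noteq> 0\<close> by (simp add: norm_mult norm_sgn flip: of_real_diff)
      also have "\<dots> = t * \<bar>1 - cmod z\<bar>" using t by (simp add: \<rho>_def abs_mult)
      also have "\<dots> \<le> t * R"
      proof (rule mult_left_mono)
        show "\<bar>1 - cmod z\<bar> \<le> R" using norm_ge_zero[of z] z(2) assms by linarith
      qed (use t in simp)
      also have "\<dots> < e" by fact
      finally show "\<exists>y\<in>annulus R. dist y z < e"
        using \<rho> \<open>z \<noteq> 0\<close> \<open>0 < \<rho>\<close>
        by (intro bexI[of _ "of_real \<rho> * sgn z"]) (auto simp: annulus_def norm_mult norm_sgn)
    qed
  qed
qed

lemma compact_closure_annulus: "compact (closure (annulus R))"
proof -
  have "bounded (annulus R)"
    by (rule boundedI[of _ R]) (auto simp: annulus_def)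
  then show ?thesis by simp
qed

lemma frontier_annulus_cmod:
  assumes "R > 1" "z \<in> frontier (annulus R)"
  shows "cmod z = R \<or> cmod z = 1 / R"
proof -
  have "z \<in> closure (annulus R)" "z \<notin> annulus R"
    using assms(2) by (auto simp: frontier_def interior_open[OF open_annulus])
  then show ?thesis
    unfolding closure_annulus[OF assms(1)] by (auto simp: annulus_def)
qed

lemma cmod_le_annulus_norm:
  assumes "f \<in> annulus_algebra R" "z \<in> closure (annulus R)"
  shows "cmod (f z) \<le> annulus_norm R f"
  unfolding annulus_norm_def
proof (rule cSUP_upper[OF assms(2)])
  have "compact ((\<lambda>z. cmod (f z)) ` closure (annulus R))"
    using assms(1)
    by (intro compact_continuous_image compact_closure_annulus continuous_intros)
       (auto simp: annulus_algebra_def)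
  then show "bdd_above ((\<lambda>z. cmod (f z)) ` closure (annulus R))"
    by (intro bounded_imp_bdd_above compact_imp_bounded)
qed

lemma annulus_norm_le:
  assumes "R > 1" "\<And>z. z \<in> closure (annulus R) \<Longrightarrow> cmod (f z) \<le> M"
  shows "annulus_norm R f \<le> M"
  unfolding annulus_norm_def
proof (rule cSUP_least)
  have "1 \<in> closure (annulus R)" using assms(1) by (simp add: closure_annulus)
  then show "closure (annulus R) \<noteq> {}" by (rule_tac notI) simp
qed (simp add: assms(2))

lemma continuous_on_annulus_circle:
  assumes "R > 1" "continuous_on (closure (annulus R)) f" "1 / R \<le> r" "r \<le> R"
  shows "continuous_on (sphere 0 1) (\<lambda>\<zeta>. f (of_real r * \<zeta>))"
proof (rule continuous_on_compose2[OF assms(2)])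
  have "0 < 1 / R" using assms(1) by simp
  then have "0 \<le> r" using assms(3) by linarith
  then show "(\<lambda>\<zeta>. of_real r * \<zeta>) ` sphere 0 1 \<subseteq> closure (annulus R)"
    using assms by (auto simp: closure_annulus norm_mult)
qed (auto intro!: continuous_intros)

section \<open>Laurent expansions on the annulus\<close>

text \<open>
  Cauchy's theorem for \<open>g(u)/u\<close>: concentric circles are homotopic along radii.
\<close>

lemma circle_mean_radius_open:
  assumes "R > 1" "g holomorphic_on annulus R" "1 / R < r" "r < R" "1 / R < r'" "r' < R"
  shows "circle_mean (\<lambda>\<zeta>. g (of_real r * \<zeta>)) = circle_mean (\<lambda>\<zeta>. g (of_real r' * \<zeta>))"
proof -
  have "0 < 1 / R" using assms(1) by simp
  then have pos: "0 < r" "0 < r'" using assms by linarith+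
  have "contour_integral (circlepath 0 r) (\<lambda>u. g u / u) =
      contour_integral (circlepath 0 r') (\<lambda>u. g u / u)"
  proof (rule Cauchy_theorem_homotopic_loops[OF _ open_annulus])
    show "homotopic_loops (annulus R) (circlepath 0 r) (circlepath 0 r')"
    proof (rule homotopic_loops_linear; (simp; fail)?)
      fix t :: real
      show "closed_segment (circlepath 0 r t) (circlepath 0 r' t) \<subseteq> annulus R"
      proof
        fix w assume "w \<in> closed_segment (circlepath 0 r t) (circlepath 0 r' t)"
        then obtain s where s: "0 \<le> s" "s \<le> 1"
          "w = (1 - s) *\<^sub>R circlepath 0 r t + s *\<^sub>R circlepath 0 r' t"
          by (auto simp: closed_segment_def)
        let ?\<rho> = "(1 - s) * r + s * r'"
        have "w = of_real ?\<rho> * exp (2 * of_real pi * \<i> * of_real t)"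
          unfolding s(3) by (simp add: circlepath scaleR_conv_of_real algebra_simps)
        then have "cmod w = \<bar>?\<rho>\<bar>"
          by (simp only: norm_mult norm_of_real) (simp add: norm_exp_eq_Re)
        moreover have "?\<rho> < R"
          by (rule convex_bound_lt) (use s assms in simp_all)
        moreover have "(1 - s) * - r + s * - r' < - (1 / R)"
          by (rule convex_bound_lt) (use s assms in simp_all)
        then have "1 / R < ?\<rho>" by simp
        ultimately show "w \<in> annulus R"
          using \<open>0 < 1 / R\<close> by (simp only: annulus_def mem_Collect_eq) linarith
      qed
    qed
    show "(\<lambda>u. g u / u) holomorphic_on annulus R"
      by (intro holomorphic_intros assms) (use assms in \<open>auto simp: annulus_def\<close>)
  qed simp_all
  then show ?thesis
    using pos by (simp add: contour_integral_circle_mean)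
qed

text \<open>
  The mean is constant for radii inside the annulus and continuous up to the boundary radii.
\<close>

lemma circle_mean_radius:
  assumes "R > 1" "f \<in> annulus_algebra R" "1 / R \<le> r" "r \<le> R"
  shows "circle_mean (\<lambda>\<zeta>. f (of_real r * \<zeta>)) = circle_mean f"
proof -
  have cont: "continuous_on (closure (annulus R)) f" and hol: "f holomorphic_on annulus R"
    using assms(2) by (auto simp: annulus_algebra_def)
  have lt: "1 / R < 1" using assms(1) by simp
  have "0 < 1 / R" using assms(1) by simp
  define I where "I \<rho> = circle_mean (\<lambda>\<zeta>. f (of_real \<rho> * \<zeta>))" for \<rho> :: real
  have "continuous_on ({1 / R..R} \<times> cbox 0 (2 * pi)) (\<lambda>(\<rho>, t). f (of_real \<rho> * cis t))"
    unfolding case_prod_unfold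
    by (rule continuous_on_compose2[OF cont])
       (use order_trans[OF less_imp_le[OF \<open>0 < 1 / R\<close>]] assms(1) in
         \<open>auto intro!: continuous_intros simp: closure_annulus norm_mult\<close>)
  then have "continuous_on {1 / R..R} (\<lambda>\<rho>. integral {0..2 * pi} (\<lambda>t. f (of_real \<rho> * cis t)))"
    using integral_continuous_on_param[of "{1 / R..R}" 0 "2 * pi" "\<lambda>\<rho> t. f (of_real \<rho> * cis t)"]
    by simp
  then have "continuous_on {1 / R..R} I"
    unfolding I_def circle_mean_def by (intro continuous_intros)
  moreover have "closure {1 / R<..<R} = {1 / R..R}"
    using lt assms(1) by (intro closure_greaterThanLessThan) linarith
  moreover have "I \<rho> = circle_mean f" if "\<rho> \<in> {1 / R<..<R}" for \<rho>
    using circle_mean_radius_open[OF assms(1) hol, of \<rho> 1] that lt assms(1) by (simp add: I_def)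
  ultimately have "I r = circle_mean f"
    using continuous_constant_on_closure[of "{1 / R<..<R}" I "circle_mean f" r] assms by auto
  then show ?thesis by (simp add: I_def)
qed

text \<open>
  Termwise integration of a geometric series whose ratio has constant modulus \<open>q < 1\<close> on the
  circle. It expands both Cauchy kernels of the annulus, with ratio \<open>z/u\<close> on a large circle and
  \<open>u/z\<close> on a small one.
\<close>

lemma circle_mean_geometric:
  fixes F k :: "complex \<Rightarrow> complex"
  assumes F: "continuous_on (sphere 0 1) F" and k: "continuous_on (sphere 0 1) k"
    and q: "\<And>\<zeta>. cmod \<zeta> = 1 \<Longrightarrow> cmod (k \<zeta>) = q" and "q < 1"
  shows "((\<lambda>n. circle_mean (\<lambda>\<zeta>. F \<zeta> * k \<zeta> ^ n)) has_sum
      circle_mean (\<lambda>\<zeta>. F \<zeta> / (1 - k \<zeta>))) UNIV"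
proof -
  have "0 \<le> q" using q[of 1] norm_ge_zero[of "k 1"] by simp
  have "compact (F ` sphere 0 1)" by (intro compact_continuous_image F compact_sphere)
  then obtain M where M: "\<And>\<zeta>. cmod \<zeta> = 1 \<Longrightarrow> cmod (F \<zeta>) \<le> M"
    using compact_imp_bounded[of "F ` sphere 0 1"] by (force simp: bounded_iff)
  have "0 \<le> M" using M[of 1] by (metis norm_ge_zero norm_one order_trans)
  have ne: "k \<zeta> \<noteq> 1" if "cmod \<zeta> = 1" for \<zeta>
  proof
    assume "k \<zeta> = 1"
    then show False using q[OF that] \<open>q < 1\<close> by simp
  qed
  have cterm: "continuous_on (sphere 0 1) (\<lambda>\<zeta>. F \<zeta> * k \<zeta> ^ n)" for n
    by (intro continuous_intros F k)
  have cquot: "continuous_on (sphere 0 1) (\<lambda>\<zeta>. F \<zeta> / (1 - k \<zeta>))"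
    by (intro continuous_intros F k) (use ne in auto)
  have tb: "cmod (F \<zeta> * k \<zeta> ^ n) \<le> M * q ^ n" if "cmod \<zeta> = 1" for \<zeta> n
    using M[OF that] q[OF that] \<open>0 \<le> q\<close> by (simp add: norm_mult norm_power mult_right_mono)
  have b: "cmod (circle_mean (\<lambda>\<zeta>. F \<zeta> * k \<zeta> ^ n)) \<le> M * q ^ n" for n
    by (rule norm_circle_mean_le[OF cterm tb])
  have sm: "summable (\<lambda>n. M * q ^ n)"
    using \<open>0 \<le> q\<close> \<open>q < 1\<close> by (intro summable_mult summable_geometric) simp
  have ns: "summable (\<lambda>n. norm (circle_mean (\<lambda>\<zeta>. F \<zeta> * k \<zeta> ^ n)))"
    by (rule summable_comparison_test'[OF sm, of 0]) (simp add: b)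
  have "(\<lambda>n. circle_mean (\<lambda>\<zeta>. F \<zeta> * k \<zeta> ^ n)) sums circle_mean (\<lambda>\<zeta>. F \<zeta> / (1 - k \<zeta>))"
    unfolding sums_def
  proof (rule LIM_zero_cancel, rule Lim_null_comparison)
    have "(\<Sum>n<N. circle_mean (\<lambda>\<zeta>. F \<zeta> * k \<zeta> ^ n)) - circle_mean (\<lambda>\<zeta>. F \<zeta> / (1 - k \<zeta>))
       = circle_mean (\<lambda>\<zeta>. - (F \<zeta> / (1 - k \<zeta>)) * k \<zeta> ^ N)" for N
    proof -
      have "(\<Sum>n<N. circle_mean (\<lambda>\<zeta>. F \<zeta> * k \<zeta> ^ n)) - circle_mean (\<lambda>\<zeta>. F \<zeta> / (1 - k \<zeta>))
       = circle_mean (\<lambda>\<zeta>. (\<Sum>n<N. F \<zeta> * k \<zeta> ^ n) - F \<zeta> / (1 - k \<zeta>))"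
        by (subst circle_mean_diff, intro continuous_on_sum cterm, rule cquot)
           (simp add: circle_mean_sum cterm)
      also have "\<dots> = circle_mean (\<lambda>\<zeta>. - (F \<zeta> / (1 - k \<zeta>)) * k \<zeta> ^ N)"
      proof (rule circle_mean_cong)
        fix \<zeta> :: complex assume z: "cmod \<zeta> = 1"
        have "(\<Sum>n<N. F \<zeta> * k \<zeta> ^ n) = F \<zeta> * ((1 - k \<zeta> ^ N) / (1 - k \<zeta>))"
          using ne[OF z] by (simp add: sum_gp_strict flip: sum_distrib_left)
        then show "(\<Sum>n<N. F \<zeta> * k \<zeta> ^ n) - F \<zeta> / (1 - k \<zeta>) = - (F \<zeta> / (1 - k \<zeta>)) * k \<zeta> ^ N"
          by (simp add: divide_inverse algebra_simps)
      qed
      finally show ?thesis .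
    qed
    moreover have "cmod (circle_mean (\<lambda>\<zeta>. - (F \<zeta> / (1 - k \<zeta>)) * k \<zeta> ^ N)) \<le> M / (1 - q) * q ^ N"
      for N
    proof (rule norm_circle_mean_le)
      show "continuous_on (sphere 0 1) (\<lambda>\<zeta>. - (F \<zeta> / (1 - k \<zeta>)) * k \<zeta> ^ N)"
        by (intro continuous_intros cquot k)
      fix \<zeta> :: complex assume z: "cmod \<zeta> = 1"
      have "1 - q \<le> cmod (1 - k \<zeta>)"
        using norm_triangle_ineq2[of 1 "k \<zeta>"] q[OF z] by simp
      then have "cmod (F \<zeta>) / cmod (1 - k \<zeta>) \<le> M / (1 - q)"
        using M[OF z] \<open>q < 1\<close> by (intro frac_le) (auto simp: \<open>0 \<le> M\<close>)
      then show "cmod (- (F \<zeta> / (1 - k \<zeta>)) * k \<zeta> ^ N) \<le> M / (1 - q) * q ^ N"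
        using mult_right_mono[of "cmod (F \<zeta>) / cmod (1 - k \<zeta>)" "M / (1 - q)" "q ^ N"] \<open>0 \<le> q\<close>
        by (simp only: norm_mult norm_divide norm_power norm_minus_cancel q[OF z] zero_le_power)
    qed
    ultimately show "\<forall>\<^sub>F N in sequentially.
        cmod ((\<Sum>n<N. circle_mean (\<lambda>\<zeta>. F \<zeta> * k \<zeta> ^ n)) - circle_mean (\<lambda>\<zeta>. F \<zeta> / (1 - k \<zeta>)))
          \<le> M / (1 - q) * q ^ N"
      by simp
    show "(\<lambda>N. M / (1 - q) * q ^ N) \<longlonglongrightarrow> 0"
      using \<open>0 \<le> q\<close> \<open>q < 1\<close> by (intro tendsto_mult_right_zero LIMSEQ_realpow_zero) auto
  qed
  with ns show ?thesis by (rule norm_summable_imp_has_sum)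
qed

lemma circle_mean_Laurent_radius:
  assumes "R > 1" "f \<in> annulus_algebra R" "1 / R < r" "r < R"
  shows "circle_mean (\<lambda>\<zeta>. f \<zeta> * \<zeta> powi (- n)) * z powi n =
    circle_mean (\<lambda>\<zeta>. f (of_real r * \<zeta>) * (z / (of_real r * \<zeta>)) powi n)"
proof -
  have cont: "continuous_on (closure (annulus R)) f" and hol: "f holomorphic_on annulus R"
    using assms(2) by (auto simp: annulus_algebra_def)
  have "0 < 1 / R" "1 / R < 1" using assms(1) by auto
  then have "r > 0" using assms(3) by (rule_tac less_trans)
  have "(\<lambda>u. f u * u powi (- n)) holomorphic_on annulus R"
    by (intro holomorphic_intros hol) (use \<open>0 < 1 / R\<close> in \<open>auto simp: annulus_def\<close>)
  then have "circle_mean (\<lambda>\<zeta>. f \<zeta> * \<zeta> powi (- n)) =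
      circle_mean (\<lambda>\<zeta>. f (of_real r * \<zeta>) * (of_real r * \<zeta>) powi (- n))"
    using circle_mean_radius_open[of R "\<lambda>u. f u * u powi (- n)" 1 r] assms \<open>1 / R < 1\<close> by simp
  moreover have "continuous_on (sphere 0 1) (\<lambda>\<zeta>. f (of_real r * \<zeta>) * (of_real r * \<zeta>) powi (- n))"
    by (intro continuous_intros continuous_on_annulus_circle[OF assms(1) cont])
       (use assms \<open>r > 0\<close> in auto)
  ultimately have "circle_mean (\<lambda>\<zeta>. f \<zeta> * \<zeta> powi (- n)) * z powi n =
      circle_mean (\<lambda>\<zeta>. f (of_real r * \<zeta>) * (of_real r * \<zeta>) powi (- n) * z powi n)"
    by (simp only: circle_mean_mult_right)
  also have "\<dots> = circle_mean (\<lambda>\<zeta>. f (of_real r * \<zeta>) * (z / (of_real r * \<zeta>)) powi n)"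
    by (rule circle_mean_cong)
       (simp add: power_int_divide_distrib power_int_minus field_simps)
  finally show ?thesis .
qed

text \<open>
  Choose \<open>r < \<bar>z\<bar> < s\<close>. The difference quotient \<open>q(u) = (f u - f z)/(u - z)\<close> extends
  holomorphically to \<open>u = z\<close>, so \<open>u q(u)\<close> has the same mean on the circles of radius \<open>r\<close> and \<open>s\<close>.
  The means of \<open>u/(u - z)\<close> are \<open>1\<close> on the outer and \<open>0\<close> on the inner circle, which turns this
  equality into Cauchy's formula for the annulus, \<open>f z = X + Y\<close>. Geometric series expand \<open>X\<close>
  into the terms with nonnegative exponents and \<open>Y\<close> into those with negative exponents.
\<close>

lemma Laurent_expansion_annulus:
  assumes "R > 1" "f \<in> annulus_algebra R" "z \<in> annulus R"
  shows "((\<lambda>n. circle_mean (\<lambda>\<zeta>. f \<zeta> * \<zeta> powi (- n)) * z powi n) has_sum f z) UNIV"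
proof -
  define t where "t = (\<lambda>n. circle_mean (\<lambda>\<zeta>. f \<zeta> * \<zeta> powi (- n)) * z powi n)"
  have cont: "continuous_on (closure (annulus R)) f" and hol: "f holomorphic_on annulus R"
    using assms(2) by (auto simp: annulus_algebra_def)
  have z: "1 / R < cmod z" "cmod z < R" using assms(3) by (auto simp: annulus_def)
  have "0 < 1 / R" using assms(1) by simp
  obtain r where r: "1 / R < r" "r < cmod z" using dense[OF z(1)] by blast
  obtain s where s: "cmod z < s" "s < R" using dense[OF z(2)] by blast
  have "0 < r" using \<open>0 < 1 / R\<close> r(1) by (rule less_trans)
  then have "z \<noteq> 0" "0 < s" using r s by auto
  have rs: "r < R" "1 / R < s" using r s z by (auto intro: less_trans)
  \<comment> \<open>The value at \<open>z\<close> removes the singularity.\<close>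
  define q where "q u = (if u = z then deriv f z else (f u - f z) / (u - z))" for u
  have "q holomorphic_on annulus R"
    unfolding q_def using pole_lemma[OF hol, of z] assms(3) open_annulus by (simp add: interior_open)
  then have "circle_mean (\<lambda>\<zeta>. of_real s * \<zeta> * q (of_real s * \<zeta>)) =
      circle_mean (\<lambda>\<zeta>. of_real r * \<zeta> * q (of_real r * \<zeta>))"
    by (intro circle_mean_radius_open[of R "\<lambda>u. u * q u"] holomorphic_intros assms r s rs)
  \<comment> \<open>The ratios of the two geometric series.\<close>
  define k where "k \<zeta> = z / (of_real s * \<zeta>)" for \<zeta>
  define l where "l \<zeta> = of_real r * \<zeta> / z" for \<zeta>
  have k: "cmod (k \<zeta>) = cmod z / s" if "cmod \<zeta> = 1" for \<zeta>
    using that \<open>0 < s\<close> by (simp add: k_def norm_divide norm_mult)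
  have l: "cmod (l \<zeta>) = r / cmod z" if "cmod \<zeta> = 1" for \<zeta>
    using that \<open>0 < r\<close> by (simp add: l_def norm_divide norm_mult)
  have k1: "cmod z / s < 1" and l1: "r / cmod z < 1"
    using \<open>0 < s\<close> s(1) r(2) \<open>z \<noteq> 0\<close> by (simp_all add: divide_less_eq_1)
  have k0: "k \<zeta> \<noteq> 1" and l0: "l \<zeta> \<noteq> 1" if "cmod \<zeta> = 1" for \<zeta>
    using k[OF that] l[OF that] k1 l1 by auto
  have ck: "continuous_on (sphere 0 1) k" and cl: "continuous_on (sphere 0 1) l"
    unfolding k_def l_def using \<open>0 < s\<close> \<open>z \<noteq> 0\<close> by (auto intro!: continuous_intros)
  have cs: "continuous_on (sphere 0 1) (\<lambda>\<zeta>. f (of_real s * \<zeta>))"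
    and cr: "continuous_on (sphere 0 1) (\<lambda>\<zeta>. f (of_real r * \<zeta>))"
    using continuous_on_annulus_circle[OF assms(1) cont] r s rs by (simp_all add: less_imp_le)
  define X where "X = circle_mean (\<lambda>\<zeta>. f (of_real s * \<zeta>) / (1 - k \<zeta>))"
  define Y where "Y = circle_mean (\<lambda>\<zeta>. f (of_real r * \<zeta>) * l \<zeta> / (1 - l \<zeta>))"

  have outer_one: "circle_mean (\<lambda>\<zeta>. 1 / (1 - k \<zeta>)) = 1"
  proof -
    define h where "h w = 1 / (1 - z / of_real s * w)" for w
    have ne: "1 - z / of_real s * w \<noteq> 0" if "cmod w \<le> 1" for w
    proof
      assume "1 - z / of_real s * w = 0"
      then have "z / of_real s * w = 1" by (simp add: algebra_simps)
      then have "cmod z / s * cmod w = 1"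
        using \<open>0 < s\<close> by (metis norm_divide norm_mult norm_of_real norm_one abs_of_pos)
      moreover have "cmod z / s * cmod w \<le> cmod z / s * 1"
        using that \<open>0 < s\<close> by (intro mult_left_mono) auto
      ultimately show False using k1 by linarith
    qed
    have "circle_mean (\<lambda>\<zeta>. h (cnj \<zeta>)) = circle_mean h" by (rule circle_mean_cnj)
    moreover have "circle_mean h = h 0"
    proof (rule circle_mean_centre)
      show "continuous_on (cball 0 1) h"
        unfolding h_def by (intro continuous_on_divide continuous_intros ballI ne) simp
      show "h holomorphic_on ball 0 1"
        unfolding h_def by (intro holomorphic_intros ne) simp
    qed
    moreover have "circle_mean (\<lambda>\<zeta>. h (cnj \<zeta>)) = circle_mean (\<lambda>\<zeta>. 1 / (1 - k \<zeta>))"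
      by (rule circle_mean_cong) (simp add: h_def k_def cnj_eq_inverse divide_inverse)
    ultimately show ?thesis by (simp add: h_def)
  qed
  have inner_zero: "circle_mean (\<lambda>\<zeta>. l \<zeta> / (1 - l \<zeta>)) = 0"
  proof -
    have ne: "1 - l w \<noteq> 0" if "cmod w \<le> 1" for w
    proof
      assume "1 - l w = 0"
      then have "r / cmod z * cmod w = 1"
        using \<open>0 < r\<close> by (simp add: l_def) (metis abs_of_pos norm_divide norm_mult norm_of_real norm_one)
      moreover have "r / cmod z * cmod w \<le> r / cmod z * 1"
        using that \<open>0 < r\<close> by (intro mult_left_mono) auto
      ultimately show False using l1 by linarith
    qed
    have "circle_mean (\<lambda>\<zeta>. l \<zeta> / (1 - l \<zeta>)) = l 0 / (1 - l 0)"
    proof (rule circle_mean_centre)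
      show "continuous_on (cball 0 1) (\<lambda>\<zeta>. l \<zeta> / (1 - l \<zeta>))"
        by (intro continuous_on_divide ballI ne continuous_on_diff continuous_on_const)
           (auto simp: l_def \<open>z \<noteq> 0\<close> intro!: continuous_intros)
      show "(\<lambda>\<zeta>. l \<zeta> / (1 - l \<zeta>)) holomorphic_on ball 0 1"
        by (intro holomorphic_on_divide ne holomorphic_on_diff holomorphic_on_const)
           (auto simp: l_def \<open>z \<noteq> 0\<close> intro!: holomorphic_intros)
    qed
    then show ?thesis by (simp add: l_def)
  qed
  have cX: "continuous_on (sphere 0 1) (\<lambda>\<zeta>. f (of_real s * \<zeta>) / (1 - k \<zeta>))"
    "continuous_on (sphere 0 1) (\<lambda>\<zeta>. 1 / (1 - k \<zeta>))"
    by (intro continuous_intros cs ck; use k0 in force)+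
  have cY: "continuous_on (sphere 0 1) (\<lambda>\<zeta>. f (of_real r * \<zeta>) * l \<zeta> / (1 - l \<zeta>))"
    "continuous_on (sphere 0 1) (\<lambda>\<zeta>. l \<zeta> / (1 - l \<zeta>))"
    by (intro continuous_intros cr cl; use l0 in force)+
  have "X - f z = circle_mean (\<lambda>\<zeta>. f (of_real s * \<zeta>) / (1 - k \<zeta>) - f z * (1 / (1 - k \<zeta>)))"
    unfolding X_def using cX
    by (simp only: circle_mean_diff circle_mean_mult_left continuous_on_mult_left outer_one mult_1_right)
  also have "\<dots> = circle_mean (\<lambda>\<zeta>. of_real s * \<zeta> * q (of_real s * \<zeta>))"
  proof (rule circle_mean_cong)
    fix \<zeta> :: complex assume \<zeta>: "cmod \<zeta> = 1"
    then have "of_real s * \<zeta> \<noteq> 0" "of_real s * \<zeta> \<noteq> z"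
      using \<open>0 < s\<close> s by (auto simp: norm_mult)
    then show "f (of_real s * \<zeta>) / (1 - k \<zeta>) - f z * (1 / (1 - k \<zeta>)) =
        of_real s * \<zeta> * q (of_real s * \<zeta>)"
      by (simp add: q_def k_def divide_simps) (simp add: algebra_simps)
  qed
  also have "\<dots> = circle_mean (\<lambda>\<zeta>. of_real r * \<zeta> * q (of_real r * \<zeta>))" by fact
  also have "\<dots> = circle_mean (\<lambda>\<zeta>. f z * (l \<zeta> / (1 - l \<zeta>)) - f (of_real r * \<zeta>) * l \<zeta> / (1 - l \<zeta>))"
  proof (rule circle_mean_cong)
    fix \<zeta> :: complex assume \<zeta>: "cmod \<zeta> = 1"
    then have "of_real r * \<zeta> \<noteq> 0" "of_real r * \<zeta> \<noteq> z"
      using \<open>0 < r\<close> r by (auto simp: norm_mult)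
    then show "of_real r * \<zeta> * q (of_real r * \<zeta>) =
        f z * (l \<zeta> / (1 - l \<zeta>)) - f (of_real r * \<zeta>) * l \<zeta> / (1 - l \<zeta>)"
      using \<open>z \<noteq> 0\<close> by (simp add: q_def l_def divide_simps) (simp add: algebra_simps)
  qed
  also have "\<dots> = - Y"
    unfolding Y_def using cY
    by (simp only: circle_mean_diff circle_mean_mult_left continuous_on_mult_left inner_zero)
       simp
  finally have fz: "X + Y = f z" by (simp add: algebra_simps)

  have "((\<lambda>n. circle_mean (\<lambda>\<zeta>. f (of_real s * \<zeta>) * k \<zeta> ^ n)) has_sum X) UNIV"
    unfolding X_def by (rule circle_mean_geometric[OF cs ck k k1])
  moreover have "circle_mean (\<lambda>\<zeta>. f (of_real s * \<zeta>) * k \<zeta> ^ n) = t (int n)" for n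
    unfolding t_def circle_mean_Laurent_radius[OF assms(1,2) rs(2) s(2)] k_def by simp
  ultimately have "((t \<circ> int) has_sum X) UNIV" by (simp add: o_def)
  then have tX: "(t has_sum X) (range int)" by (simp add: has_sum_reindex)

  have "((\<lambda>n. circle_mean (\<lambda>\<zeta>. f (of_real r * \<zeta>) * l \<zeta> * l \<zeta> ^ n)) has_sum Y) UNIV"
    unfolding Y_def by (rule circle_mean_geometric[OF continuous_on_mult[OF cr cl] cl l l1])
  moreover have "circle_mean (\<lambda>\<zeta>. f (of_real r * \<zeta>) * l \<zeta> * l \<zeta> ^ n) = t (- int (Suc n))" for n
    unfolding t_def circle_mean_Laurent_radius[OF assms(1,2) r(1) rs(1)]
  proof (rule circle_mean_cong)
    fix \<zeta>
    have "l \<zeta> * l \<zeta> ^ n = (z / (of_real r * \<zeta>)) powi (- int (Suc n))"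
      by (simp only: power_int_minus power_int_of_nat flip: power_inverse) (simp add: l_def)
    then show "f (of_real r * \<zeta>) * l \<zeta> * l \<zeta> ^ n =
        f (of_real r * \<zeta>) * (z / (of_real r * \<zeta>)) powi (- int (Suc n))"
      by (simp only: mult.assoc)
  qed
  ultimately have "((t \<circ> (\<lambda>n. - int (Suc n))) has_sum Y) UNIV" by (simp add: o_def)
  then have tY: "(t has_sum Y) (range (\<lambda>n. - int (Suc n)))"
    by (subst has_sum_reindex) (auto simp: inj_on_def)

  have "range int \<union> range (\<lambda>n. - int (Suc n)) = UNIV"
  proof -
    have "i \<in> range int \<union> range (\<lambda>n. - int (Suc n))" for i
      by (cases i rule: int_cases) auto
    then show ?thesis by blast
  qed
  moreover have "range int \<inter> range (\<lambda>n. - int (Suc n)) = {}" by auto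
  ultimately have "(t has_sum (X + Y)) UNIV"
    using has_sum_Un_disjoint[OF tX tY] by simp
  then show ?thesis by (simp add: fz t_def)
qed

text \<open>
  Convergence at the point \<open>1\<close> already makes the coefficients absolutely summable, so the series
  converges uniformly on the unit circle and may be integrated against \<open>\<zeta> powi (- k)\<close>.
\<close>

lemma Laurent_coefficients_unique:
  assumes "\<And>\<zeta>. cmod \<zeta> = 1 \<Longrightarrow> ((\<lambda>n. a n * \<zeta> powi n) has_sum f \<zeta>) UNIV"
    and cont: "continuous_on (sphere 0 1) f"
  shows "a k = circle_mean (\<lambda>\<zeta>. f \<zeta> * \<zeta> powi (- k))"
proof -
  have "a summable_on UNIV"
    using assms(1)[of 1] by (simp add: has_sum_imp_summable)
  then have "(\<lambda>n. norm (a n)) summable_on UNIV"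
    by (simp add: summable_on_iff_abs_summable_on_complex)
  then have "uniform_limit (sphere 0 1) (\<lambda>X \<zeta>. \<Sum>n\<in>X. a n * \<zeta> powi n)
      (\<lambda>\<zeta>. \<Sum>\<^sub>\<infinity>n. a n * \<zeta> powi n) (finite_subsets_at_top UNIV)"
    by (intro Weierstrass_m_test_general[where M="\<lambda>n. norm (a n)"])
       (simp_all add: norm_mult norm_power_int)
  note ul = uniform_limitD[OF this]
  have "cmod (circle_mean (\<lambda>\<zeta>. f \<zeta> * \<zeta> powi (- k)) - a k) \<le> e" if "e > 0" for e
  proof -
    have "\<forall>\<^sub>F X in finite_subsets_at_top UNIV. finite X \<and> k \<in> X"
      unfolding eventually_finite_subsets_at_top by (intro exI[of _ "{k}"]) simp
    from eventually_conj[OF ul[OF that] this]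
    have "\<exists>X. (\<forall>\<zeta>\<in>sphere 0 1. dist (\<Sum>n\<in>X. a n * \<zeta> powi n) (\<Sum>\<^sub>\<infinity>n. a n * \<zeta> powi n) < e)
        \<and> finite X \<and> k \<in> X"
      by (rule eventually_happens'[rotated]) simp
    then obtain X where "\<forall>\<zeta>\<in>sphere 0 1.
        dist (\<Sum>n\<in>X. a n * \<zeta> powi n) (\<Sum>\<^sub>\<infinity>n. a n * \<zeta> powi n) < e"
      and X: "finite X" "k \<in> X"
      by blast
    then have close: "cmod (f \<zeta> - (\<Sum>n\<in>X. a n * \<zeta> powi n)) \<le> e" if "cmod \<zeta> = 1" for \<zeta>
      using that infsumI[OF assms(1)[OF that]]
      by (metis dist_commute dist_norm less_imp_le mem_sphere_0)
    have ct: "continuous_on (sphere 0 1) (\<lambda>\<zeta>::complex. \<zeta> powi n)" for n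
      by (intro continuous_intros) auto
    have "a k = (\<Sum>n\<in>X. a n * (if n + (- k) = 0 then 1 else 0))"
      using X by (simp add: if_distrib[of "\<lambda>x. _ * x"] cong: if_cong) 
    also have "\<dots> = (\<Sum>n\<in>X. circle_mean (\<lambda>\<zeta>. a n * \<zeta> powi (n + (- k))))"
      by (simp only: circle_mean_mult_left ct circle_mean_powi)
    also have "\<dots> = circle_mean (\<lambda>\<zeta>. \<Sum>n\<in>X. a n * \<zeta> powi (n + (- k)))"
      by (rule circle_mean_sum[symmetric]) (intro X(1) continuous_intros ct)+
    also have "\<dots> = circle_mean (\<lambda>\<zeta>. (\<Sum>n\<in>X. a n * \<zeta> powi n) * \<zeta> powi (- k))"
    proof (rule circle_mean_cong)
      fix \<zeta> :: complex assume "cmod \<zeta> = 1"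
      then have "\<zeta> \<noteq> 0" by auto
      then show "(\<Sum>n\<in>X. a n * \<zeta> powi (n + (- k))) = (\<Sum>n\<in>X. a n * \<zeta> powi n) * \<zeta> powi (- k)"
        by (simp only: power_int_add sum_distrib_right mult.assoc simp_thms)
    qed
    finally have "circle_mean (\<lambda>\<zeta>. f \<zeta> * \<zeta> powi (- k)) - a k =
        circle_mean (\<lambda>\<zeta>. (f \<zeta> - (\<Sum>n\<in>X. a n * \<zeta> powi n)) * \<zeta> powi (- k))"
      by (simp only: left_diff_distrib)
         (rule circle_mean_diff[symmetric]; intro continuous_intros cont ct)
    also have "cmod \<dots> \<le> e"
      by (rule norm_circle_mean_le)
         (use close in \<open>auto intro!: continuous_intros cont ct simp: norm_mult norm_power_int\<close>)
    finally show ?thesis .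
  qed
  then have "cmod (circle_mean (\<lambda>\<zeta>. f \<zeta> * \<zeta> powi (- k)) - a k) \<le> 0"
    by (rule field_le_epsilon) simp
  then show ?thesis by simp
qed

lemma laurent_coeffs_eq:
  assumes "R > 1" "f \<in> annulus_algebra R"
  shows "laurent_coeffs R f = (\<lambda>n. circle_mean (\<lambda>\<zeta>. f \<zeta> * \<zeta> powi (- n)))"
  unfolding laurent_coeffs_def
proof (rule the_equality)
  show "\<forall>z\<in>annulus R. ((\<lambda>n. circle_mean (\<lambda>\<zeta>. f \<zeta> * \<zeta> powi (- n)) * z powi n) has_sum f z) UNIV"
    using Laurent_expansion_annulus[OF assms] by blast
next
  fix a assume a: "\<forall>z\<in>annulus R. ((\<lambda>n. a n * z powi n) has_sum f z) UNIV"
  show "a = (\<lambda>n. circle_mean (\<lambda>\<zeta>. f \<zeta> * \<zeta> powi (- n)))"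
  proof (rule ext, rule Laurent_coefficients_unique)
    fix \<zeta> :: complex assume "cmod \<zeta> = 1"
    then have "\<zeta> \<in> annulus R" using assms(1) by (simp add: annulus_def)
    then show "((\<lambda>n. a n * \<zeta> powi n) has_sum f \<zeta>) UNIV" using a by blast
  next
    show "continuous_on (sphere 0 1) f"
      using continuous_on_annulus_circle[of R f 1] assms by (simp add: annulus_algebra_def)
  qed
qed

lemma laurent_coeff_0:
  assumes "R > 1" "f \<in> annulus_algebra R" "1 / R \<le> r" "r \<le> R"
  shows "laurent_coeffs R f 0 = circle_mean (\<lambda>\<zeta>. f (of_real r * \<zeta>))"
  by (simp add: laurent_coeffs_eq[OF assms(1,2)] circle_mean_radius[OF assms])

section \<open>Resolvents on the closed unit disc\<close>

text \<open>
  The first resolvent identity. It yields both continuity and complex differentiability.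
\<close>

lemma resolvent_difference:
  assumes "is_op_inverse (id_blinfun - (scalar_op z o\<^sub>L B)) M"
    and "is_op_inverse (id_blinfun - (scalar_op w o\<^sub>L B)) N"
  shows "M - N = scalar_op (z - w) o\<^sub>L (M o\<^sub>L (B o\<^sub>L N))"
proof (rule blinfun_eqI)
  fix x
  define u where "u = blinfun_apply N x"
  have M: "M \<in> bounded_ops" using assms(1) by (simp add: is_op_inverse_def)
  have x: "u - w *\<^sub>C blinfun_apply B u = x"
    using is_op_inverse_apply(1)[OF assms(2), of x] by (simp add: u_def blinfun.diff_left)
  have u: "blinfun_apply M (u - z *\<^sub>C blinfun_apply B u) = u"
    using is_op_inverse_apply(2)[OF assms(1), of u] by (simp add: blinfun.diff_left)
  have "blinfun_apply M x - u = blinfun_apply M ((u - w *\<^sub>C blinfun_apply B u) - (u - z *\<^sub>C blinfun_apply B u))"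
    by (simp only: x u blinfun.diff_right[of M x "u - z *\<^sub>C blinfun_apply B u"])
  also have "(u - w *\<^sub>C blinfun_apply B u) - (u - z *\<^sub>C blinfun_apply B u) = (z - w) *\<^sub>C blinfun_apply B u"
    using scaleC_add_left[of "z - w" w "blinfun_apply B u"] by (simp add: algebra_simps)
  finally show "blinfun_apply (M - N) x =
      blinfun_apply (scalar_op (z - w) o\<^sub>L (M o\<^sub>L (B o\<^sub>L N))) x"
    by (simp add: blinfun.diff_left u_def bounded_opsD[OF M])
qed

text \<open>
  Near \<open>w\<close> the resolvent identity itself bounds the norm of \<open>N z\<close> by twice that of \<open>N w\<close>; inserted
  into the identity again, this bound gives a Lipschitz estimate at \<open>w\<close>.
\<close>

lemma continuous_on_resolvent:
  assumes inv: "\<And>z. z \<in> D \<Longrightarrow> is_op_inverse (id_blinfun - (scalar_op z o\<^sub>L B)) (N z)"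
  shows "continuous_on D N"
proof (unfold continuous_on_iff, intro ballI allI impI)
  fix w and e :: real assume w: "w \<in> D" and "e > 0"
  define K where "K = norm B * norm (N w)"
  have "0 \<le> K" by (simp add: K_def)
  have bound: "norm (N z - N w) \<le> cmod (z - w) * K * norm (N z)" if "z \<in> D" for z
  proof -
    have "norm (N z - N w) \<le> norm (scalar_op (z - w)::'a \<Rightarrow>\<^sub>L 'a) * norm (N z o\<^sub>L (B o\<^sub>L N w))"
      unfolding resolvent_difference[OF inv[OF that] inv[OF w]] by (rule norm_blinfun_compose)
    also have "\<dots> \<le> cmod (z - w) * (norm (N z) * (norm B * norm (N w)))"
      by (intro mult_mono norm_scalar_op_le order_trans[OF norm_blinfun_compose]
            mult_left_mono norm_blinfun_compose) auto
    finally show ?thesis by (simp add: K_def mult_ac)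
  qed
  define d where "d = min (1 / (2 * (K + 1))) (e / (2 * (K * norm (N w) + 1)))"
  have "d > 0" using \<open>0 \<le> K\<close> \<open>e > 0\<close>
    by (auto simp: d_def intro!: divide_pos_pos add_nonneg_pos mult_pos_pos mult_nonneg_nonneg)
  moreover have "dist (N z) (N w) < e" if z: "z \<in> D" "dist z w < d" for z
  proof -
    have d1: "cmod (z - w) * (2 * (K + 1)) < 1" and d2: "cmod (z - w) * (2 * (K * norm (N w) + 1)) < e"
      using z(2) \<open>0 \<le> K\<close> unfolding d_def min_less_iff_conj dist_norm
      by (auto simp: pos_less_divide_eq add_nonneg_pos)
    have "cmod (z - w) * K \<le> 1 / 2"
    proof -
      have "2 * (cmod (z - w) * K) + 2 * cmod (z - w) < 1" using d1 by (simp add: algebra_simps)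
      then show ?thesis using norm_ge_zero[of "z - w"] by linarith
    qed
    then have "cmod (z - w) * K * norm (N z) \<le> 1 / 2 * norm (N z)"
      by (rule mult_right_mono) simp
    then have "norm (N z) \<le> 2 * norm (N w)"
      using bound[OF z(1)] norm_triangle_ineq2[of "N z" "N w"] by simp
    then have "cmod (z - w) * K * norm (N z) \<le> cmod (z - w) * K * (2 * norm (N w))"
      using \<open>0 \<le> K\<close> by (intro mult_left_mono) auto
    also have "\<dots> \<le> cmod (z - w) * (2 * (K * norm (N w) + 1))"
      by (simp add: algebra_simps)
    finally show ?thesis using bound[OF z(1)] d2 by (simp add: dist_norm)
  qed
  ultimately show "\<exists>d>0. \<forall>z\<in>D. dist z w < d \<longrightarrow> dist (N z) (N w) < e" by blast
qed

lemma continuous_on_cinner_apply: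
  assumes "continuous_on D N"
  shows "continuous_on D (\<lambda>z. cinner (blinfun_apply (N z) x) y)"
  by (intro bounded_linear.continuous_on[OF bounded_linear_cinner_left]
        bounded_linear.continuous_on[OF blinfun.bounded_linear_left] assms)

lemma holomorphic_on_resolvent:
  assumes inv: "\<And>z. z \<in> D \<Longrightarrow> is_op_inverse (id_blinfun - (scalar_op z o\<^sub>L B)) (N z)"
  shows "(\<lambda>z. cinner (blinfun_apply (N z) x) y) holomorphic_on D"
proof (rule holomorphic_onI)
  fix w assume w: "w \<in> D"
  define v where "v = blinfun_apply B (blinfun_apply (N w) x)"
  have "continuous_on D (\<lambda>z. cinner (blinfun_apply (N z) v) y)"
    by (rule continuous_on_cinner_apply[OF continuous_on_resolvent[OF inv]])
  then have lim: "((\<lambda>z. cinner (blinfun_apply (N z) v) y) \<longlongrightarrow> cinner (blinfun_apply (N w) v) y) (at w within D)"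
    using w by (simp add: continuous_on)
  have "((\<lambda>z. (cinner (blinfun_apply (N z) x) y - cinner (blinfun_apply (N w) x) y) / (z - w))
      \<longlongrightarrow> cinner (blinfun_apply (N w) v) y) (at w within D)"
  proof (rule Lim_transform_eventually[OF lim])
    have "cinner (blinfun_apply (N z) v) y =
        (cinner (blinfun_apply (N z) x) y - cinner (blinfun_apply (N w) x) y) / (z - w)"
      if "z \<in> D" "z \<noteq> w" for z
    proof -
      have "blinfun_apply (N z) x - blinfun_apply (N w) x = (z - w) *\<^sub>C blinfun_apply (N z) v"
        using arg_cong[OF resolvent_difference[OF inv[OF that(1)] inv[OF w]], of "\<lambda>A. blinfun_apply A x"]
        by (simp add: blinfun.diff_left v_def)
      from arg_cong[OF this, of "\<lambda>u. cinner u y"] that(2) show ?thesis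
        by (simp add: cinner_diff_left cinner_scaleC_left)
    qed
    then show "\<forall>\<^sub>F z in at w within D. cinner (blinfun_apply (N z) v) y =
        (cinner (blinfun_apply (N z) x) y - cinner (blinfun_apply (N w) x) y) / (z - w)"
      by (simp add: eventually_at_filter)
  qed
  then show "(\<lambda>z. cinner (blinfun_apply (N z) x) y) field_differentiable (at w within D)"
    unfolding field_differentiable_def has_field_derivative_iff by blast
qed

definition disc_resolvent :: "real \<Rightarrow> ('a::complex_hilbert \<Rightarrow>\<^sub>L 'a) \<Rightarrow> complex \<Rightarrow> ('a \<Rightarrow>\<^sub>L 'a)" where
  "disc_resolvent R A z = op_inverse (id_blinfun - (scalar_op (z / complex_of_real R) o\<^sub>L A))"

text \<open>
  Existence of all the inverses \<open>(1 - zA/R)\<^sup>-\<^sup>1\<close> on the closed unit disc. For \<open>A = T\<close> it says that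
  \<open>T\<close> has no spectrum on or outside the outer circle, for \<open>A = T\<^sup>-\<^sup>1\<close> none on or inside the inner
  circle.
\<close>

definition disc_regular :: "real \<Rightarrow> ('a::complex_hilbert \<Rightarrow>\<^sub>L 'a) \<Rightarrow> bool" where
  "disc_regular R A \<longleftrightarrow> (\<forall>z. cmod z \<le> 1 \<longrightarrow>
     is_op_inverse (id_blinfun - (scalar_op (z / complex_of_real R) o\<^sub>L A)) (disc_resolvent R A z))"

lemma disc_regularI:
  assumes "\<And>z. cmod z \<le> 1 \<Longrightarrow>
    \<exists>S. is_op_inverse (id_blinfun - (scalar_op (z / complex_of_real R) o\<^sub>L A)) S"
  shows "disc_regular R A"
  using assms unfolding disc_regular_def disc_resolvent_def
  by (meson is_op_inverse_op_inverse)

lemma disc_regular_family: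
  assumes "disc_regular R A" "cmod z \<le> 1"
  shows "is_op_inverse (id_blinfun - (scalar_op z o\<^sub>L (scalar_op (1 / complex_of_real R) o\<^sub>L A)))
    (disc_resolvent R A z)"
proof -
  have "scalar_op z o\<^sub>L (scalar_op (1 / complex_of_real R) o\<^sub>L A) = scalar_op (z / complex_of_real R) o\<^sub>L A"
    by (rule blinfun_eqI) (simp add: scaleC_scaleC)
  then show ?thesis using assms by (simp add: disc_regular_def)
qed

lemma disc_resolvent_in:
  "disc_regular R A \<Longrightarrow> cmod z \<le> 1 \<Longrightarrow> disc_resolvent R A z \<in> bounded_ops"
  by (simp add: disc_regular_def is_op_inverse_def)

lemma disc_resolvent_0: "disc_resolvent R A 0 = id_blinfun"
proof -
  have "id_blinfun - (scalar_op 0 o\<^sub>L A) = id_blinfun"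
    using scaleC_add_left[of 0 0] by (intro blinfun_eqI) (simp add: blinfun.diff_left)
  then show ?thesis
    unfolding disc_resolvent_def
    by (intro op_inverse_eqI) (simp add: is_op_inverse_def id_in_bounded_ops)
qed

lemma continuous_on_disc_resolvent:
  assumes "disc_regular R A"
  shows "continuous_on (cball 0 1) (disc_resolvent R A)"
  by (rule continuous_on_resolvent[where B = "scalar_op (1 / complex_of_real R) o\<^sub>L A"])
     (use disc_regular_family[OF assms] in simp)

lemma continuous_on_disc_resolvent_form:
  assumes "disc_regular R A"
  shows "continuous_on (cball 0 1) (\<lambda>z. cinner (blinfun_apply (disc_resolvent R A z) x) y)"
  by (rule continuous_on_cinner_apply[OF continuous_on_disc_resolvent[OF assms]])

lemma holomorphic_on_disc_resolvent_form:
  assumes "disc_regular R A"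
  shows "(\<lambda>z. cinner (blinfun_apply (disc_resolvent R A z) x) y) holomorphic_on ball 0 1"
  by (rule holomorphic_on_resolvent[where B = "scalar_op (1 / complex_of_real R) o\<^sub>L A"])
     (use disc_regular_family[OF assms] in simp)

lemma resolvent_outside:
  assumes "op_spectrum T \<subseteq> annulus R" "u \<notin> annulus R"
  shows "is_op_inverse (scalar_op u - T) (op_inverse (scalar_op u - T))"
proof -
  have "u \<notin> op_spectrum T" using assms by blast
  then show ?thesis by (auto simp: op_spectrum_def intro: is_op_inverse_op_inverse)
qed

text \<open>
  \<open>1 - zT/R = (u - T)/u\<close> for \<open>u = R/z\<close>, a point outside the annulus.
\<close>

lemma op_inverse_outer:
  assumes T: "T \<in> bounded_ops" and sp: "op_spectrum T \<subseteq> annulus R"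
    and "0 < R" "cmod z \<le> 1" "z \<noteq> 0"
  defines "u \<equiv> complex_of_real R / z"
  shows "is_op_inverse (id_blinfun - (scalar_op (z / complex_of_real R) o\<^sub>L T))
      (scalar_op u o\<^sub>L op_inverse (scalar_op u - T))"
proof -
  have "R \<le> cmod u"
    using assms(3-5) by (simp add: u_def norm_divide pos_le_divide_eq mult_left_le)
  then have "u \<notin> annulus R" by (simp add: annulus_def)
  then have inv: "is_op_inverse (scalar_op u - T) (op_inverse (scalar_op u - T))"
    by (rule resolvent_outside[OF sp])
  let ?S = "op_inverse (scalar_op u - T)"
  have S: "?S \<in> bounded_ops" using inv by (simp add: is_op_inverse_def)
  have zu: "z / complex_of_real R * u = 1" using assms(3,5) by (simp add: u_def)
  have 1: "u *\<^sub>C blinfun_apply ?S x - blinfun_apply T (blinfun_apply ?S x) = x" for x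
    using is_op_inverse_apply(1)[OF inv, of x] by (simp add: blinfun.diff_left)
  have 2: "u *\<^sub>C blinfun_apply ?S x - blinfun_apply ?S (blinfun_apply T x) = x" for x
    using is_op_inverse_apply(2)[OF inv, of x]
    by (simp add: blinfun.diff_left blinfun.diff_right bounded_opsD[OF S])
  show ?thesis
  proof (rule is_op_inverseI)
    fix x
    show "blinfun_apply (id_blinfun - (scalar_op (z / complex_of_real R) o\<^sub>L T))
        (blinfun_apply (scalar_op u o\<^sub>L ?S) x) = x"
      using 1[of x] zu
      by (simp add: blinfun.diff_left bounded_opsD[OF T] scaleC_scaleC)
    show "blinfun_apply (scalar_op u o\<^sub>L ?S)
        (blinfun_apply (id_blinfun - (scalar_op (z / complex_of_real R) o\<^sub>L T)) x) = x"
      using 2[of x] zu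
      by (simp add: blinfun.diff_left blinfun.diff_right bounded_opsD[OF S] scaleC_diff_right
          scaleC_scaleC mult.commute)
  qed (intro bounded_ops_intros S)
qed

lemma is_op_inverse_annulus:
  assumes "op_spectrum T \<subseteq> annulus R" "0 < R"
  shows "is_op_inverse T (op_inverse T)"
proof -
  have "0 \<notin> annulus R" using assms(2) by (simp add: annulus_def)
  from resolvent_outside[OF assms(1) this]
  obtain S where S: "is_op_inverse (scalar_op 0 - T) S" by blast
  have "is_op_inverse T (scalar_op (- 1) o\<^sub>L S)"
  proof (rule is_op_inverseI)
    fix x
    show "blinfun_apply T (blinfun_apply (scalar_op (- 1) o\<^sub>L S) x) = x"
      using is_op_inverse_apply(1)[OF S, of x]
      by (simp add: blinfun.diff_left scaleC_minus_one blinfun.minus_right)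
    show "blinfun_apply (scalar_op (- 1) o\<^sub>L S) (blinfun_apply T x) = x"
      using is_op_inverse_apply(2)[OF S, of x]
      by (simp add: blinfun.diff_left scaleC_minus_one blinfun.minus_right)
  qed (use S in \<open>auto simp: is_op_inverse_def intro: bounded_ops_intros\<close>)
  then show ?thesis by (rule is_op_inverse_op_inverse)
qed

text \<open>
  From \<open>1 - u(u - T)\<^sup>-\<^sup>1 = - T(u - T)\<^sup>-\<^sup>1\<close> and \<open>1 - uT\<^sup>-\<^sup>1 = - (u - T)T\<^sup>-\<^sup>1\<close>. In this form the case
  \<open>u = 0\<close> is included.
\<close>

lemma op_inverse_inner:
  assumes T: "T \<in> bounded_ops" and sp: "op_spectrum T \<subseteq> annulus R"
    and "0 < R" "cmod w \<le> 1"
  defines "u \<equiv> w / complex_of_real R"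
  shows "is_op_inverse (id_blinfun - (scalar_op u o\<^sub>L op_inverse T))
      (id_blinfun - (scalar_op u o\<^sub>L op_inverse (scalar_op u - T)))"
proof -
  have "cmod u \<le> 1 / R"
    using assms(3,4) by (simp add: u_def norm_divide divide_right_mono)
  then have "u \<notin> annulus R" by (simp add: annulus_def)
  then have inv: "is_op_inverse (scalar_op u - T) (op_inverse (scalar_op u - T))"
    by (rule resolvent_outside[OF sp])
  let ?S = "op_inverse (scalar_op u - T)"
  have S: "?S \<in> bounded_ops" using inv by (simp add: is_op_inverse_def)
  have T': "is_op_inverse T (op_inverse T)" by (rule is_op_inverse_annulus[OF sp \<open>0 < R\<close>])
  have T'_in: "op_inverse T \<in> bounded_ops" using T' by (simp add: is_op_inverse_def)
  have 1: "x - u *\<^sub>C blinfun_apply ?S x = - blinfun_apply T (blinfun_apply ?S x)" for x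
    using is_op_inverse_apply(1)[OF inv, of x] by (simp add: blinfun.diff_left algebra_simps)
  have 2: "blinfun_apply ?S (u *\<^sub>C x - blinfun_apply T x) = x" for x
    using is_op_inverse_apply(2)[OF inv, of x] by (simp add: blinfun.diff_left)
  show ?thesis
  proof (rule is_op_inverseI)
    fix x
    let ?y = "blinfun_apply ?S x"
    have "blinfun_apply (id_blinfun - (scalar_op u o\<^sub>L op_inverse T)) (- blinfun_apply T ?y) =
        u *\<^sub>C ?y - blinfun_apply T ?y"
      using is_op_inverse_apply(2)[OF T', of ?y]
      by (simp add: blinfun.diff_left blinfun.minus_right scaleC_minus_right)
    also have "\<dots> = x" using 1[of x] by (simp add: algebra_simps)
    finally show "blinfun_apply (id_blinfun - (scalar_op u o\<^sub>L op_inverse T))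
        (blinfun_apply (id_blinfun - (scalar_op u o\<^sub>L ?S)) x) = x"
      by (simp add: blinfun.diff_left[of id_blinfun "scalar_op u o\<^sub>L ?S"] 1)
    let ?v = "blinfun_apply (op_inverse T) x"
    have x: "blinfun_apply T ?v = x" by (rule is_op_inverse_apply(1)[OF T'])
    have "blinfun_apply ?S (x - u *\<^sub>C ?v) = - ?v"
      using arg_cong[OF 2[of ?v], of uminus] x
      by (simp flip: blinfun.minus_right)
    then show "blinfun_apply (id_blinfun - (scalar_op u o\<^sub>L ?S))
        (blinfun_apply (id_blinfun - (scalar_op u o\<^sub>L op_inverse T)) x) = x"
      by (simp add: blinfun.diff_left scaleC_minus_right)
  qed (intro bounded_ops_intros S)
qed

lemma disc_regular_outer:
  assumes "T \<in> bounded_ops" "op_spectrum T \<subseteq> annulus R" "0 < R"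
  shows "disc_regular R T"
proof (rule disc_regularI)
  fix z :: complex assume z: "cmod z \<le> 1"
  show "\<exists>S. is_op_inverse (id_blinfun - (scalar_op (z / complex_of_real R) o\<^sub>L T)) S"
  proof (cases "z = 0")
    case True
    have "scalar_op 0 o\<^sub>L T = 0" by (rule blinfun_eqI) simp
    then show ?thesis
      by (intro exI[of _ id_blinfun]) (simp add: True is_op_inverse_def id_in_bounded_ops)
  qed (use op_inverse_outer[OF assms z] in blast)
qed

lemma disc_regular_inner:
  assumes "T \<in> bounded_ops" "op_spectrum T \<subseteq> annulus R" "0 < R"
  shows "disc_regular R (op_inverse T)"
  using op_inverse_inner[OF assms] by (intro disc_regularI) blast

lemma resolvent_outer_circle:
  assumes "T \<in> bounded_ops" "op_spectrum T \<subseteq> annulus R" "0 < R" "cmod \<zeta> = 1"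
  shows "is_op_inverse (scalar_op (complex_of_real R * \<zeta>) - T)
    (scalar_op (1 / (complex_of_real R * \<zeta>)) o\<^sub>L disc_resolvent R T (cnj \<zeta>))"
proof -
  have "\<zeta> \<noteq> 0" using assms(4) by auto
  define u where "u = complex_of_real R * \<zeta>"
  have u: "complex_of_real R / cnj \<zeta> = u" "u \<noteq> 0"
    using assms(3,4) \<open>\<zeta> \<noteq> 0\<close> by (simp_all add: u_def cnj_eq_inverse divide_inverse)
  have "disc_resolvent R T (cnj \<zeta>) = scalar_op u o\<^sub>L op_inverse (scalar_op u - T)"
    unfolding disc_resolvent_def
    using op_inverse_eqI[OF op_inverse_outer[OF assms(1-3), of "cnj \<zeta>"]] assms(4) \<open>\<zeta> \<noteq> 0\<close>
    by (simp add: u)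
  then have "scalar_op (1 / u) o\<^sub>L disc_resolvent R T (cnj \<zeta>) = op_inverse (scalar_op u - T)"
    by (intro blinfun_eqI) (simp add: scaleC_scaleC u)
  moreover have "u \<notin> annulus R"
    using assms(3,4) by (simp add: u_def annulus_def norm_mult)
  ultimately show ?thesis
    using resolvent_outside[OF assms(2), of u] by (simp add: u_def)
qed

lemma resolvent_inner_circle:
  assumes "T \<in> bounded_ops" "op_spectrum T \<subseteq> annulus R" "0 < R" "cmod \<zeta> = 1"
  shows "is_op_inverse (scalar_op (\<zeta> / complex_of_real R) - T)
    (scalar_op (1 / (\<zeta> / complex_of_real R)) o\<^sub>L (id_blinfun - disc_resolvent R (op_inverse T) \<zeta>))"
proof -
  define u where "u = \<zeta> / complex_of_real R"
  have u: "u \<noteq> 0" using assms(3,4) by (auto simp: u_def)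
  have "disc_resolvent R (op_inverse T) \<zeta> = id_blinfun - (scalar_op u o\<^sub>L op_inverse (scalar_op u - T))"
    unfolding disc_resolvent_def
    using op_inverse_eqI[OF op_inverse_inner[OF assms(1-3), of \<zeta>]] assms(4)
    by (simp add: u_def)
  then have "scalar_op (1 / u) o\<^sub>L (id_blinfun - disc_resolvent R (op_inverse T) \<zeta>) =
      op_inverse (scalar_op u - T)"
    by (intro blinfun_eqI) (simp add: scaleC_scaleC u)
  moreover have "u \<notin> annulus R"
    using assms(3,4) by (simp add: u_def annulus_def norm_divide)
  ultimately show ?thesis
    using resolvent_outside[OF assms(2), of u] by (simp add: u_def)
qed

section \<open>The double-layer potential integral as a circle mean\<close>

text \<open>
  For a circle about the origin with angular velocity \<open>a\<close>, \<open>\<gamma>' = \<i>a\<gamma>\<close>. The factor \<open>\<i>\<close> cancels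
  against \<open>1/(2\<pi>\<i>)\<close>, and the conjugate term becomes the adjoint of the first one with a
  positive sign. Stating the resolvent as \<open>M/\<gamma>\<close> covers both boundary circles.
\<close>

lemma dlp_kernel_eq:
  assumes T: "T \<in> bounded_ops" and M: "M \<in> bounded_ops" and "\<gamma> s \<noteq> 0"
    and inv: "is_op_inverse (scalar_op (\<gamma> s) - T) (scalar_op (1 / \<gamma> s) o\<^sub>L M)"
    and deriv: "(\<gamma> has_vector_derivative (\<i> * complex_of_real a * \<gamma> s)) (at s)"
  shows "dlp_kernel \<gamma> s T = (a / (2 * pi)) *\<^sub>R (M + op_adjoint M)"
proof -
  define g where "g = \<gamma> s"
  have "g \<noteq> 0" using assms(3) by (simp add: g_def)
  have 1: "op_inverse (scalar_op g - T) = scalar_op (1 / g) o\<^sub>L M"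
    unfolding g_def by (rule op_inverse_eqI[OF inv])
  have "is_op_inverse (op_adjoint (scalar_op g - T)) (op_adjoint (scalar_op (1 / g) o\<^sub>L M))"
    unfolding g_def by (intro is_op_inverse_adjoint inv bounded_ops_intros T)
  then have 2: "op_inverse (scalar_op (cnj g) - op_adjoint T) = op_adjoint M o\<^sub>L scalar_op (cnj (1 / g))"
    by (intro op_inverse_eqI) (simp add: op_adjoint_diff op_adjoint_compose op_adjoint_scalar
        scalar_op_in T M)
  have d: "vector_derivative \<gamma> (at s) = \<i> * complex_of_real a * g"
    unfolding g_def by (rule vector_derivative_at[OF deriv])
  note adjM = bounded_opsD[OF op_adjoint_in[OF M]]
  show ?thesis
    unfolding dlp_kernel_def d Let_def g_def[symmetric] 1 2
  proof (rule blinfun_eqI)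
    fix x
    let ?m = "blinfun_apply M x" and ?n = "blinfun_apply (op_adjoint M) x"
    have c1: "1 / (2 * complex_of_real pi * \<i>) * (\<i> * complex_of_real a * g * (1 / g)) = complex_of_real (a / (2 * pi))"
      using \<open>g \<noteq> 0\<close> by simp
    have c2: "1 / (2 * complex_of_real pi * \<i>) * (cnj (\<i> * complex_of_real a * g) * cnj (1 / g)) = complex_of_real (- (a / (2 * pi)))"
      using \<open>g \<noteq> 0\<close> by (simp add: field_simps)
    have "blinfun_apply (scalar_op (1 / (2 * complex_of_real pi * \<i>)) o\<^sub>L
          ((scalar_op (\<i> * complex_of_real a * g) o\<^sub>L (scalar_op (1 / g) o\<^sub>L M)) -
           (scalar_op (cnj (\<i> * complex_of_real a * g)) o\<^sub>L (op_adjoint M o\<^sub>L scalar_op (cnj (1 / g)))))) x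
      = (1 / (2 * complex_of_real pi * \<i>) * (\<i> * complex_of_real a * g * (1 / g))) *\<^sub>C ?m -
        (1 / (2 * complex_of_real pi * \<i>) * (cnj (\<i> * complex_of_real a * g) * cnj (1 / g))) *\<^sub>C ?n"
      by (simp only: blinfun_apply_blinfun_compose blinfun.diff_left scalar_op_apply adjM
          scaleC_scaleC scaleC_diff_right)
    also have "\<dots> = (a / (2 * pi)) *\<^sub>R ?m - (- (a / (2 * pi))) *\<^sub>R ?n"
      by (simp only: c1 c2 scaleC_of_real)
    finally show "blinfun_apply (scalar_op (1 / (2 * complex_of_real pi * \<i>)) o\<^sub>L
          ((scalar_op (\<i> * complex_of_real a * g) o\<^sub>L (scalar_op (1 / g) o\<^sub>L M)) -
           (scalar_op (cnj (\<i> * complex_of_real a * g)) o\<^sub>L (op_adjoint M o\<^sub>L scalar_op (cnj (1 / g)))))) x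
      = blinfun_apply ((a / (2 * pi)) *\<^sub>R (M + op_adjoint M)) x"
      by (simp add: blinfun.scaleR_left blinfun.add_left scaleR_add_right)
  qed
qed

text \<open>
  Integration takes place in the real Banach space of bounded real linear maps; complex linearity
  survives since it is expressed by the vanishing of bounded linear functions of the operator.
\<close>

lemma circle_mean_in_bounded_ops:
  fixes G :: "complex \<Rightarrow> ('a::complex_hilbert \<Rightarrow>\<^sub>L 'a)"
  assumes "continuous_on (sphere 0 1) G" "\<And>\<zeta>. cmod \<zeta> = 1 \<Longrightarrow> G \<zeta> \<in> bounded_ops"
  shows "circle_mean G \<in> bounded_ops"
  unfolding bounded_ops_def
proof (intro CollectI allI)
  fix a x
  define h where "h A = blinfun_apply A (a *\<^sub>C x) - a *\<^sub>C blinfun_apply A x" for A :: "'a \<Rightarrow>\<^sub>L 'a"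
  have "bounded_linear h"
    unfolding h_def
    by (intro bounded_linear_sub blinfun.bounded_linear_left
        bounded_linear_compose[OF bounded_linear_scaleC])
  then have "h (circle_mean G) = circle_mean (\<lambda>\<zeta>. h (G \<zeta>))"
    using assms(1) by (simp add: circle_mean_linear)
  also have "\<dots> = circle_mean (\<lambda>\<zeta>. 0)"
    by (rule circle_mean_cong) (simp add: h_def bounded_opsD[OF assms(2)])
  finally show "blinfun_apply (circle_mean G) (a *\<^sub>C x) = a *\<^sub>C blinfun_apply (circle_mean G) x"
    by (simp add: h_def)
qed

lemma integral_cis_rescale:
  assumes "m > 0"
  shows "integral {0..2 * pi / m} (\<lambda>s. (m / (2 * pi)) *\<^sub>R H (cis (m * s))) = circle_mean H"
proof -
  have "(\<lambda>x. x / m) ` {0..2 * pi} = {0..2 * pi / m}"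
    using assms by (simp add: image_divide_atLeastAtMost)
  then have "integral {0..2 * pi / m} (\<lambda>s. H (cis (m * s))) = (1 / m) *\<^sub>R integral {0..2 * pi} (\<lambda>t. H (cis t))"
    using integral_stretch_real[where m=m and a=0 and b="2 * pi" and f="\<lambda>t. H (cis t)"] assms by simp
  then show ?thesis using assms by (simp add: circle_mean_def)
qed

lemma has_vector_derivative_cis_scaled:
  "((\<lambda>s. c * cis (m * s)) has_vector_derivative \<i> * complex_of_real m * (c * cis (m * s))) (at s)"
proof -
  have "((\<lambda>w. c * exp (\<i> * complex_of_real m * w)) has_field_derivative
      \<i> * complex_of_real m * (c * exp (\<i> * complex_of_real m * complex_of_real s)))
      (at (complex_of_real s))"
    by (auto intro!: derivative_eq_intros)
  from has_vector_derivative_real_field[OF this] show ?thesis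
    by (simp add: cis_conv_exp mult_ac)
qed

definition outer_density :: "real \<Rightarrow> ('a::complex_hilbert \<Rightarrow>\<^sub>L 'a) \<Rightarrow> complex \<Rightarrow> ('a \<Rightarrow>\<^sub>L 'a)" where
  "outer_density R T \<zeta> = disc_resolvent R T (cnj \<zeta>) + op_adjoint (disc_resolvent R T (cnj \<zeta>))"

definition inner_density :: "real \<Rightarrow> ('a::complex_hilbert \<Rightarrow>\<^sub>L 'a) \<Rightarrow> complex \<Rightarrow> ('a \<Rightarrow>\<^sub>L 'a)" where
  "inner_density R T \<zeta> = disc_resolvent R (op_inverse T) \<zeta> +
     op_adjoint (disc_resolvent R (op_inverse T) \<zeta>) - scalar_op 2"

lemma dlp_kernel_outer:
  assumes "T \<in> bounded_ops" "op_spectrum T \<subseteq> annulus R" "0 < R"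
  shows "dlp_kernel (outer_circle R) s T =
    ((1 / R) / (2 * pi)) *\<^sub>R outer_density R T (cis ((1 / R) * s))"
  unfolding outer_density_def
proof (rule dlp_kernel_eq[OF assms(1)])
  have oc: "outer_circle R s = complex_of_real R * cis ((1 / R) * s)"
    by (simp add: outer_circle_def)
  show "outer_circle R s \<noteq> 0" using assms(3) by (simp add: oc)
  show "is_op_inverse (scalar_op (outer_circle R s) - T)
      (scalar_op (1 / outer_circle R s) o\<^sub>L disc_resolvent R T (cnj (cis ((1 / R) * s))))"
    unfolding oc by (rule resolvent_outer_circle[OF assms]) simp
  show "(outer_circle R has_vector_derivative \<i> * complex_of_real (1 / R) * outer_circle R s) (at s)"
    using has_vector_derivative_cis_scaled[of "complex_of_real R" "1 / R" s]
    by (simp add: outer_circle_def[abs_def])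
  show "disc_resolvent R T (cnj (cis ((1 / R) * s))) \<in> bounded_ops"
    by (rule disc_resolvent_in[OF disc_regular_outer[OF assms]]) simp
qed

text \<open>
  The inner circle is run through clockwise with angular velocity \<open>- R\<close>, and there
  \<open>\<sigma>(\<sigma> - T)\<^sup>-\<^sup>1 = 1 - V\<close>. The two minus signs combine to \<open>V + V\<^sup>* - 2\<close>.
\<close>

lemma dlp_kernel_inner:
  assumes "T \<in> bounded_ops" "op_spectrum T \<subseteq> annulus R" "0 < R"
  shows "dlp_kernel (inner_circle R) s T =
    (R / (2 * pi)) *\<^sub>R inner_density R T (cnj (cis (R * s)))"
proof -
  let ?N = "disc_resolvent R (op_inverse T) (cnj (cis (R * s)))"
  have ic: "inner_circle R s = cnj (cis (R * s)) / complex_of_real R"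
    by (simp add: inner_circle_def cis_cnj)
  have N: "?N \<in> bounded_ops"
    by (rule disc_resolvent_in[OF disc_regular_inner[OF assms]]) simp
  have "dlp_kernel (inner_circle R) s T =
      (- R / (2 * pi)) *\<^sub>R ((id_blinfun - ?N) + op_adjoint (id_blinfun - ?N))"
  proof (rule dlp_kernel_eq[OF assms(1)])
    show "id_blinfun - ?N \<in> bounded_ops" by (intro bounded_ops_intros N)
    show "inner_circle R s \<noteq> 0" using assms(3) by (simp add: ic)
    show "is_op_inverse (scalar_op (inner_circle R s) - T)
        (scalar_op (1 / inner_circle R s) o\<^sub>L (id_blinfun - ?N))"
      unfolding ic by (rule resolvent_inner_circle[OF assms]) simp
    show "(inner_circle R has_vector_derivative \<i> * complex_of_real (- R) * inner_circle R s) (at s)"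
      using has_vector_derivative_cis_scaled[of "complex_of_real (1 / R)" "- R" s]
      by (simp add: inner_circle_def[abs_def])
  qed
  also have "\<dots> = (R / (2 * pi)) *\<^sub>R inner_density R T (cnj (cis (R * s)))"
  proof -
    have "(id_blinfun - ?N) + op_adjoint (id_blinfun - ?N) = - inner_density R T (cnj (cis (R * s)))"
      unfolding inner_density_def op_adjoint_diff[OF id_in_bounded_ops N] op_adjoint_id
      using scaleC_of_real[of 2, where ?'a = 'a]
      by (intro blinfun_eqI) (simp add: blinfun.diff_left blinfun.add_left blinfun.minus_left scaleR_2)
    then show ?thesis by simp
  qed
  finally show ?thesis .
qed

lemma dlp_integral_eq:
  assumes "T \<in> bounded_ops" "op_spectrum T \<subseteq> annulus R" "0 < R"
  shows "dlp_integral R T f =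
      circle_mean (\<lambda>\<zeta>. outer_density R T \<zeta> o\<^sub>L scalar_op (f (complex_of_real R * \<zeta>)))
    + circle_mean (\<lambda>\<zeta>. inner_density R T \<zeta> o\<^sub>L scalar_op (f (complex_of_real (1 / R) * \<zeta>)))"
proof -
  define G where "G \<zeta> = outer_density R T \<zeta> o\<^sub>L scalar_op (f (complex_of_real R * \<zeta>))" for \<zeta>
  define H where "H \<zeta> = inner_density R T \<zeta> o\<^sub>L scalar_op (f (complex_of_real (1 / R) * \<zeta>))" for \<zeta>
  have oc: "outer_circle R s = complex_of_real R * cis ((1 / R) * s)" for s
    by (simp add: outer_circle_def)
  have ic: "inner_circle R s = complex_of_real (1 / R) * cnj (cis (R * s))" for s
    by (simp add: inner_circle_def cis_cnj)
  have "dlp_integral R T f =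
      integral {0..2 * pi / (1 / R)} (\<lambda>s. ((1 / R) / (2 * pi)) *\<^sub>R G (cis ((1 / R) * s)))
    + integral {0..2 * pi / R} (\<lambda>s. (R / (2 * pi)) *\<^sub>R H (cnj (cis (R * s))))"
    unfolding dlp_integral_def dlp_kernel_outer[OF assms] dlp_kernel_inner[OF assms] G_def H_def oc ic
    by (simp only: bounded_bilinear.scaleR_left[OF bounded_bilinear_blinfun_compose]) simp
  also have "\<dots> = circle_mean G + circle_mean (\<lambda>\<zeta>. H (cnj \<zeta>))"
    using integral_cis_rescale[of "1 / R" G] integral_cis_rescale[OF assms(3), of "\<lambda>\<zeta>. H (cnj \<zeta>)"] assms(3)
    by simp
  also have "circle_mean (\<lambda>\<zeta>. H (cnj \<zeta>)) = circle_mean H" by (rule circle_mean_cnj)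
  finally show ?thesis unfolding G_def H_def .
qed

section \<open>Truncated Poisson kernels and Laurent polynomials\<close>

text \<open>
  The full series is \<open>(1 + w)/(1 - w)\<close>, which maps the disc to the right half plane; the tail is
  estimated trivially. Truncating keeps everything below polynomial, so that only finite linear
  combinations have to be passed through the functional calculus.
\<close>

lemma truncated_Poisson_lower_bound:
  fixes w :: complex
  assumes "cmod w \<le> r" "r < 1"
  shows "- (2 * r ^ Suc N / (1 - r)) \<le> Re (1 + (\<Sum>n=1..N. 2 * w ^ n))"
proof -
  have w: "cmod w < 1" "0 \<le> r" using assms norm_ge_zero[of w] by linarith+
  then have ne: "1 - w \<noteq> 0" by auto
  have "(1 - w) * (1 + (\<Sum>n=1..N. 2 * w ^ n)) = 1 + w - 2 * w ^ Suc N"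
  proof (induction N)
    case (Suc N)
    have "(1 - w) * (1 + (\<Sum>n=1..Suc N. 2 * w ^ n)) =
        (1 - w) * (1 + (\<Sum>n=1..N. 2 * w ^ n)) + (1 - w) * (2 * w ^ Suc N)"
      by (simp add: algebra_simps)
    also have "\<dots> = 1 + w - 2 * w ^ Suc (Suc N)"
      unfolding Suc.IH by (simp add: algebra_simps)
    finally show ?case .
  qed (simp add: algebra_simps)
  then have "1 + (\<Sum>n=1..N. 2 * w ^ n) = (1 + w) / (1 - w) - 2 * w ^ Suc N / (1 - w)"
    using ne by (simp add: divide_simps) (simp add: algebra_simps)
  moreover have "0 \<le> Re ((1 + w) / (1 - w))"
  proof -
    have "Re ((1 + w) / (1 - w)) = Re ((1 + w) * cnj (1 - w)) / (cmod (1 - w))\<^sup>2"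
      by (subst complex_div_cnj) (simp only: Re_divide_of_real flip: of_real_power)
    also have "Re ((1 + w) * cnj (1 - w)) = 1 - (cmod w)\<^sup>2"
      unfolding cmod_power2 by (simp add: power2_eq_square algebra_simps)
    finally show ?thesis using w by (simp add: power_le_one)
  qed
  moreover have "Re (2 * w ^ Suc N / (1 - w)) \<le> 2 * r ^ Suc N / (1 - r)"
  proof -
    have "1 - r \<le> cmod (1 - w)" using norm_triangle_ineq2[of 1 w] assms by simp
    have "Re (2 * w ^ Suc N / (1 - w)) \<le> cmod (2 * w ^ Suc N / (1 - w))" by (rule complex_Re_le_cmod)
    also have "\<dots> = 2 * cmod w ^ Suc N / cmod (1 - w)" by (simp only: norm_divide norm_mult norm_power) simp
    also have "\<dots> \<le> 2 * r ^ Suc N / (1 - r)"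
      using assms w \<open>1 - r \<le> cmod (1 - w)\<close>
      by (intro frac_le mult_left_mono power_mono) auto
    finally show ?thesis .
  qed
  ultimately show ?thesis by simp
qed

text \<open>
  The truncated Poisson kernel with pole \<open>a\<close> picks out a Taylor partial sum at \<open>a\<close>: the
  holomorphic half of the kernel pairs to zero with \<open>u\<close>, except for its constant term.
\<close>

lemma circle_mean_truncated_Poisson:
  assumes u: "continuous_on (cball 0 1) u" "u holomorphic_on ball 0 1"
  shows "circle_mean (\<lambda>\<zeta>. Re (1 + (\<Sum>n=1..N. 2 * (a ^ n * cnj \<zeta> ^ n))) * Re (u \<zeta>)) =
    Re (u 0 + (\<Sum>n=1..N. (deriv ^^ n) u 0 / fact n * a ^ n))"
proof -
  have cu: "continuous_on (sphere 0 1) u"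
    by (rule continuous_on_subset[OF u(1)]) auto
  have c1: "continuous_on (sphere 0 1) (\<lambda>\<zeta>. a ^ n * (u \<zeta> * cnj \<zeta> ^ n))" for n
    by (intro continuous_intros cu)
  have c2: "continuous_on (sphere 0 1) (\<lambda>\<zeta>. cnj a ^ n * (u \<zeta> * \<zeta> ^ n))" for n
    by (intro continuous_intros cu)
  have c3: "continuous_on (sphere 0 1) (\<lambda>\<zeta>. u \<zeta> * cnj \<zeta> ^ n)" "continuous_on (sphere 0 1) (\<lambda>\<zeta>. u \<zeta> * \<zeta> ^ n)" for n
    by (intro continuous_intros cu)+
  define g where "g \<zeta> = u \<zeta> + (\<Sum>n=1..N. a ^ n * (u \<zeta> * cnj \<zeta> ^ n) + cnj a ^ n * (u \<zeta> * \<zeta> ^ n))" for \<zeta>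
  have cg: "continuous_on (sphere 0 1) g"
    unfolding g_def by (intro continuous_on_add continuous_on_sum cu c1 c2)
  have "Re (1 + (\<Sum>n=1..N. 2 * (a ^ n * cnj \<zeta> ^ n))) * Re (u \<zeta>) = Re (g \<zeta>)" for \<zeta>
  proof -
    define P where "P = (\<Sum>n=1..N. a ^ n * cnj \<zeta> ^ n)"
    have "g \<zeta> = u \<zeta> * (1 + P + cnj P)"
      by (simp add: g_def P_def sum.distrib sum_distrib_left algebra_simps)
    moreover have "(\<Sum>n=1..N. 2 * (a ^ n * cnj \<zeta> ^ n)) = 2 * P" by (simp add: P_def sum_distrib_left)
    ultimately show ?thesis by (simp add: algebra_simps)
  qed
  then have "circle_mean (\<lambda>\<zeta>. Re (1 + (\<Sum>n=1..N. 2 * (a ^ n * cnj \<zeta> ^ n))) * Re (u \<zeta>)) = Re (circle_mean g)"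
    using circle_mean_linear[OF bounded_linear_Re cg] by simp
  also have "circle_mean g = circle_mean u +
      (\<Sum>n=1..N. circle_mean (\<lambda>\<zeta>. a ^ n * (u \<zeta> * cnj \<zeta> ^ n) + cnj a ^ n * (u \<zeta> * \<zeta> ^ n)))"
    unfolding g_def
    by (subst circle_mean_add, rule cu, intro continuous_on_sum continuous_on_add c1 c2,
        subst circle_mean_sum, simp, intro continuous_on_add c1 c2, rule refl)
  also have "\<dots> = u 0 + (\<Sum>n=1..N. a ^ n * ((deriv ^^ n) u 0 / fact n))"
  proof -
    have "circle_mean (\<lambda>\<zeta>. a ^ n * (u \<zeta> * cnj \<zeta> ^ n) + cnj a ^ n * (u \<zeta> * \<zeta> ^ n)) =
        a ^ n * ((deriv ^^ n) u 0 / fact n)" if "n \<in> {1..N}" for n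
      using that circle_mean_Taylor[OF u] circle_mean_mult_power[OF u, of n]
      by (simp add: circle_mean_add[OF c1 c2] circle_mean_mult_left[OF c3(1)] circle_mean_mult_left[OF c3(2)])
    then show ?thesis by (simp add: circle_mean_centre[OF u])
  qed
  finally show ?thesis by (simp add: mult.commute)
qed

lemma sum_atMost_head: "(\<Sum>n\<le>N. g n) = g 0 + (\<Sum>n=1..N. g n)" for g :: "nat \<Rightarrow> complex"
  by (simp add: sum.atMost_shift sum.atLeast1_atMost_eq)

lemma Taylor_partial_sums_tendsto:
  assumes "u holomorphic_on ball 0 1" "z \<in> ball 0 1"
  shows "(\<lambda>N. u 0 + (\<Sum>n=1..N. (deriv ^^ n) u 0 / fact n * z ^ n)) \<longlonglongrightarrow> u z"
proof -
  have "(\<lambda>n. (deriv ^^ n) u 0 / fact n * (z - 0) ^ n) sums u z"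
    by (rule holomorphic_power_series[OF assms])
  then have "(\<lambda>N. \<Sum>n\<le>N. (deriv ^^ n) u 0 / fact n * z ^ n) \<longlonglongrightarrow> u z"
    by (simp add: sums_def_le)
  moreover have "(\<Sum>n\<le>N. (deriv ^^ n) u 0 / fact n * z ^ n) =
      u 0 + (\<Sum>n=1..N. (deriv ^^ n) u 0 / fact n * z ^ n)" for N
    by (simp add: sum_atMost_head)
  ultimately show ?thesis by simp
qed

text \<open>
  The Dirichlet problem on the annulus for trigonometric polynomials, one frequency at a time.
  For \<open>a z\<^sup>m + b z\<^sup>-\<^sup>m\<close> the real parts on the two circles are those of \<open>\<alpha>\<zeta>\<^sup>m\<close> and \<open>\<beta>\<zeta>\<^sup>m\<close>
  precisely when \<open>(a, cnj b)\<close> solves a linear system with determinant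
  \<open>R\<^bsup>2m\<^esup> - R\<^bsup>-2m\<^esup>\<close>, which is nonzero for \<open>m > 0\<close>. The constant term has to be the same on both
  circles, for otherwise the harmonic function would contain a logarithm and have no single-valued
  conjugate.
\<close>

lemma Laurent_polynomial_boundary_values:
  fixes \<alpha> \<beta> :: "nat \<Rightarrow> complex"
  assumes "R > 1"
  shows "\<exists>f\<in>annulus_algebra R. \<forall>\<zeta>. cmod \<zeta> = 1 \<longrightarrow>
     Re (f (complex_of_real R * \<zeta>)) = Re (1 + (\<Sum>n=1..N. \<alpha> n * \<zeta> ^ n)) \<and>
     Re (f (complex_of_real (1 / R) * \<zeta>)) = Re (1 + (\<Sum>n=1..N. \<beta> n * \<zeta> ^ n))"
proof (induction N)
  case 0
  show ?case
    by (rule bexI[of _ "\<lambda>_. 1"]) (auto simp: annulus_algebra_def intro!: continuous_intros)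
next
  case (Suc N)
  then obtain f where f: "f \<in> annulus_algebra R"
    and fR: "\<And>\<zeta>. cmod \<zeta> = 1 \<Longrightarrow> Re (f (complex_of_real R * \<zeta>)) = Re (1 + (\<Sum>n=1..N. \<alpha> n * \<zeta> ^ n))"
    and fr: "\<And>\<zeta>. cmod \<zeta> = 1 \<Longrightarrow> Re (f (complex_of_real (1 / R) * \<zeta>)) = Re (1 + (\<Sum>n=1..N. \<beta> n * \<zeta> ^ n))"
    by blast
  define m where "m = Suc N"
  define p where "p = complex_of_real (R ^ m)"
  define D where "D = p * p - inverse p * inverse p"
  have "p \<noteq> 0" using assms by (simp add: p_def)
  have "D \<noteq> 0"
  proof
    assume "D = 0"
    have "R ^ m > 1" by (rule one_less_power[OF assms]) (simp add: m_def)
    have "D = complex_of_real (R ^ m * R ^ m - inverse (R ^ m) * inverse (R ^ m))"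
      by (simp add: D_def p_def)
    with \<open>D = 0\<close> have "complex_of_real (R ^ m * R ^ m - inverse (R ^ m) * inverse (R ^ m)) = 0"
      by simp
    then have "R ^ m * R ^ m - inverse (R ^ m) * inverse (R ^ m) = 0"
      by (rule of_real_eq_0_iff[THEN iffD1])
    then have "R ^ m * R ^ m = inverse (R ^ m) * inverse (R ^ m)" by simp
    moreover have "1 < R ^ m * R ^ m" using \<open>R ^ m > 1\<close> less_1_mult by blast
    moreover have "inverse (R ^ m) * inverse (R ^ m) < 1 * 1"
      using \<open>R ^ m > 1\<close> by (intro mult_strict_mono) (auto simp: inverse_less_1_iff)
    ultimately show False by simp
  qed
  define a where "a = (\<alpha> m * p - \<beta> m * inverse p) / D"
  define b where "b = cnj ((\<beta> m * p - \<alpha> m * inverse p) / D)"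
  define g where "g z = f z + (a * z ^ m + b * inverse z ^ m)" for z
  have cp: "cnj p = p" by (simp add: p_def)
  have cb: "cnj b = (\<beta> m * p - \<alpha> m * inverse p) / D" by (simp add: b_def)
  have eqs: "a * p + cnj b * inverse p = \<alpha> m" "a * inverse p + cnj b * p = \<beta> m"
  proof -
    have aD: "a * D = \<alpha> m * p - \<beta> m * inverse p" and bD: "cnj b * D = \<beta> m * p - \<alpha> m * inverse p"
      using \<open>D \<noteq> 0\<close> by (simp_all add: a_def cb)
    have "(a * p + cnj b * inverse p) * D = (a * D) * p + (cnj b * D) * inverse p"
      "(a * inverse p + cnj b * p) * D = (a * D) * inverse p + (cnj b * D) * p"
      by (simp_all add: algebra_simps)
    then have "(a * p + cnj b * inverse p) * D = \<alpha> m * D" "(a * inverse p + cnj b * p) * D = \<beta> m * D"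
      unfolding aD bD by (simp_all add: D_def algebra_simps)
    then show "a * p + cnj b * inverse p = \<alpha> m" "a * inverse p + cnj b * p = \<beta> m"
      using \<open>D \<noteq> 0\<close> by simp_all
  qed
  have nz: "z \<noteq> 0" if "z \<in> closure (annulus R)" for z
  proof
    assume "z = 0"
    with that assms have "1 / R \<le> 0" by (simp add: closure_annulus)
    with assms show False by simp
  qed
  have "g \<in> annulus_algebra R"
    using f nz closure_subset[of "annulus R"]
    unfolding annulus_algebra_def g_def
    by (auto intro!: continuous_intros holomorphic_intros)
  moreover have "Re (g (complex_of_real R * \<zeta>)) = Re (1 + (\<Sum>n=1..m. \<alpha> n * \<zeta> ^ n)) \<and>
     Re (g (complex_of_real (1 / R) * \<zeta>)) = Re (1 + (\<Sum>n=1..m. \<beta> n * \<zeta> ^ n))" if "cmod \<zeta> = 1" for \<zeta>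
  proof -
    have cnjr: "Re (y * cnj \<zeta> ^ m) = Re (cnj y * \<zeta> ^ m)" for y
      by (metis complex_cnj_cnj complex_cnj_mult complex_cnj_power complex_cnj(1) cnj.simps(1))
    have inv: "inverse \<zeta> = cnj \<zeta>" using that by (simp add: cnj_eq_inverse)
    have 1: "a * (complex_of_real R * \<zeta>) ^ m + b * inverse (complex_of_real R * \<zeta>) ^ m =
        (a * p) * \<zeta> ^ m + (b * inverse p) * cnj \<zeta> ^ m"
      by (simp add: power_mult_distrib p_def inv power_inverse)
    have 2: "a * (complex_of_real (1 / R) * \<zeta>) ^ m + b * inverse (complex_of_real (1 / R) * \<zeta>) ^ m =
        (a * inverse p) * \<zeta> ^ m + (b * p) * cnj \<zeta> ^ m"
      by (simp add: power_mult_distrib p_def inv power_inverse divide_inverse)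
    have "Re ((a * p) * \<zeta> ^ m + (b * inverse p) * cnj \<zeta> ^ m) = Re (\<alpha> m * \<zeta> ^ m)"
      unfolding eqs(1)[symmetric] by (simp only: plus_complex.simps cnjr distrib_right) (simp add: cp)
    moreover have "Re ((a * inverse p) * \<zeta> ^ m + (b * p) * cnj \<zeta> ^ m) = Re (\<beta> m * \<zeta> ^ m)"
      unfolding eqs(2)[symmetric] by (simp only: plus_complex.simps cnjr distrib_right) (simp add: cp)
    ultimately show ?thesis
      unfolding g_def 1 2 using fR[OF that] fr[OF that] by (simp add: m_def)
  qed
  ultimately show ?case unfolding m_def by blast
qed

section \<open>The annulus algebra and the maximum modulus principle\<close>

lemma annulus_algebra_intros:
  "(\<lambda>_. a) \<in> annulus_algebra R"
  "f \<in> annulus_algebra R \<Longrightarrow> g \<in> annulus_algebra R \<Longrightarrow> (\<lambda>z. f z + g z) \<in> annulus_algebra R"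
  "f \<in> annulus_algebra R \<Longrightarrow> (\<lambda>z. a * f z) \<in> annulus_algebra R"
  "f \<in> annulus_algebra R \<Longrightarrow> (\<lambda>z. f z ^ n) \<in> annulus_algebra R"
  by (auto simp: annulus_algebra_def intro!: continuous_intros holomorphic_intros)

lemma annulus_algebra_sum:
  "finite I \<Longrightarrow> (\<And>i. i \<in> I \<Longrightarrow> g i \<in> annulus_algebra R) \<Longrightarrow> (\<lambda>z. \<Sum>i\<in>I. g i z) \<in> annulus_algebra R"
  by (auto simp: annulus_algebra_def intro!: continuous_intros holomorphic_intros)

lemma maximum_modulus_annulus:
  assumes "R > 1" "f \<in> annulus_algebra R"
    and "\<And>z. cmod z = R \<or> cmod z = 1 / R \<Longrightarrow> cmod (f z) \<le> B"
    and "z \<in> closure (annulus R)"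
  shows "cmod (f z) \<le> B"
proof (cases "z \<in> annulus R")
  case True
  show ?thesis
  proof (rule maximum_modulus_frontier[of f "annulus R"])
    show "f holomorphic_on interior (annulus R)" "continuous_on (closure (annulus R)) f"
      using assms(2) by (auto simp: annulus_algebra_def interior_open[OF open_annulus])
    show "bounded (annulus R)"
      by (rule boundedI[of _ R]) (auto simp: annulus_def)
  qed (use frontier_annulus_cmod[OF assms(1)] assms(3) True in auto)
next
  case False
  then have "z \<in> frontier (annulus R)"
    using assms(4) by (simp add: frontier_def interior_open[OF open_annulus])
  then show ?thesis by (intro assms(3) frontier_annulus_cmod[OF assms(1)])
qed

section \<open>The functional calculus\<close>

locale annulus_operator =
  fixes R c :: real and T :: "'a::complex_hilbert \<Rightarrow>\<^sub>L 'a"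
  assumes R_gt_1: "R > 1" and c_gt: "c > - 2"
    and T_in: "T \<in> bounded_ops" and spectrum: "op_spectrum T \<subseteq> annulus R"
begin

abbreviation U :: "complex \<Rightarrow> 'a \<Rightarrow>\<^sub>L 'a" where "U \<equiv> disc_resolvent R T"
abbreviation V :: "complex \<Rightarrow> 'a \<Rightarrow>\<^sub>L 'a" where "V \<equiv> disc_resolvent R (op_inverse T)"

lemma R_pos: "0 < R" using R_gt_1 by simp

lemma inverse_R_le: "1 / R \<le> R" "1 / R \<le> 1 / R" "R \<le> R"
proof -
  have "1 / R \<le> 1" using R_gt_1 by simp
  then show "1 / R \<le> R" by (rule order_trans[OF _ less_imp_le[OF R_gt_1]])
qed simp_all

lemma regular: "disc_regular R T" "disc_regular R (op_inverse T)"
  by (rule disc_regular_outer disc_regular_inner; intro T_in spectrum R_pos)+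

lemmas resolvent_in = disc_resolvent_in[OF regular(1)] disc_resolvent_in[OF regular(2)]

lemma density_in:
  assumes "cmod \<zeta> = 1"
  shows "outer_density R T \<zeta> \<in> bounded_ops" "inner_density R T \<zeta> \<in> bounded_ops"
  unfolding outer_density_def inner_density_def
  using assms by (intro bounded_ops_intros op_adjoint_in resolvent_in; simp)+

lemma continuous_on_density:
  "continuous_on (sphere 0 1) (outer_density R T)" "continuous_on (sphere 0 1) (inner_density R T)"
proof -
  have 1: "continuous_on (sphere 0 1) (\<lambda>\<zeta>. U (cnj \<zeta>))"
    by (rule continuous_on_compose2[OF continuous_on_disc_resolvent[OF regular(1)]])
       (auto intro!: continuous_intros)
  have 2: "continuous_on (sphere 0 1) V"
    by (rule continuous_on_subset[OF continuous_on_disc_resolvent[OF regular(2)]]) auto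
  show "continuous_on (sphere 0 1) (outer_density R T)"
    unfolding outer_density_def[abs_def]
    by (intro continuous_on_add continuous_on_op_adjoint 1) (auto intro: resolvent_in)
  show "continuous_on (sphere 0 1) (inner_density R T)"
    unfolding inner_density_def[abs_def]
    by (intro continuous_on_add continuous_on_diff continuous_on_const continuous_on_op_adjoint 2)
       (auto intro: resolvent_in)
qed

lemma cinner_density:
  assumes "cmod \<zeta> = 1"
  shows "cinner (blinfun_apply (outer_density R T \<zeta>) x) y =
      cinner (blinfun_apply (U (cnj \<zeta>)) x) y + cnj (cinner (blinfun_apply (U (cnj \<zeta>)) y) x)"
    and "cinner (blinfun_apply (inner_density R T \<zeta>) x) y =
      cinner (blinfun_apply (V \<zeta>) x) y + cnj (cinner (blinfun_apply (V \<zeta>) y) x) - 2 * cinner x y"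
  using assms unfolding outer_density_def inner_density_def
  by (simp_all add: blinfun.add_left blinfun.diff_left cinner_add_left cinner_diff_left
      cinner_scaleC_left cinner_adjoint_left[OF resolvent_in(1)] cinner_adjoint_left[OF resolvent_in(2)])

lemma continuous_on_circle_values:
  assumes "f \<in> annulus_algebra R"
  shows "continuous_on (sphere 0 1) (\<lambda>\<zeta>. f (complex_of_real R * \<zeta>))"
    "continuous_on (sphere 0 1) (\<lambda>\<zeta>. f (complex_of_real (1 / R) * \<zeta>))"
  using assms inverse_R_le continuous_on_annulus_circle[OF R_gt_1, of f]
  by (auto simp: annulus_algebra_def simp del: of_real_divide)

lemma continuous_on_integrands:
  assumes "f \<in> annulus_algebra R"
  shows "continuous_on (sphere 0 1) (\<lambda>\<zeta>. outer_density R T \<zeta> o\<^sub>L scalar_op (f (complex_of_real R * \<zeta>)))"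
    "continuous_on (sphere 0 1) (\<lambda>\<zeta>. inner_density R T \<zeta> o\<^sub>L scalar_op (f (complex_of_real (1 / R) * \<zeta>)))"
  by (intro bounded_bilinear.continuous_on[OF bounded_bilinear_blinfun_compose] continuous_on_density
      bounded_linear.continuous_on[OF bounded_linear_scalar_op] continuous_on_circle_values assms)+

lemma S_map_in: "f \<in> annulus_algebra R \<Longrightarrow> S_map R c T f \<in> bounded_ops"
  unfolding S_map_def dlp_integral_eq[OF T_in spectrum R_pos]
  by (intro bounded_ops_intros circle_mean_in_bounded_ops continuous_on_integrands density_in)

lemma continuous_on_density_form:
  "continuous_on (sphere 0 1) (\<lambda>\<zeta>. cinner (blinfun_apply (outer_density R T \<zeta>) x) y)"
  "continuous_on (sphere 0 1) (\<lambda>\<zeta>. cinner (blinfun_apply (inner_density R T \<zeta>) x) y)"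
  by (intro continuous_on_cinner_apply continuous_on_density)+

lemma cinner_S_map:
  assumes "f \<in> annulus_algebra R"
  shows "cinner (blinfun_apply (S_map R c T f) x) y =
    (circle_mean (\<lambda>\<zeta>. f (complex_of_real R * \<zeta>) * cinner (blinfun_apply (outer_density R T \<zeta>) x) y)
     + circle_mean (\<lambda>\<zeta>. f (complex_of_real (1 / R) * \<zeta>) * cinner (blinfun_apply (inner_density R T \<zeta>) x) y)
     + complex_of_real c * laurent_coeffs R f 0 * cinner x y) / complex_of_real (2 + c)"
proof -
  define h where "h A = cinner (blinfun_apply A x) y" for A :: "'a \<Rightarrow>\<^sub>L 'a"
  have h: "bounded_linear h"
    unfolding h_def
    by (rule bounded_linear_compose[OF bounded_linear_cinner_left blinfun.bounded_linear_left])
  have hc: "h (A o\<^sub>L scalar_op a) = a * cinner (blinfun_apply A x) y" if "A \<in> bounded_ops" for A a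
    by (simp add: h_def bounded_opsD[OF that] cinner_scaleC_left)
  have "h (circle_mean (\<lambda>\<zeta>. outer_density R T \<zeta> o\<^sub>L scalar_op (f (complex_of_real R * \<zeta>)))) =
      circle_mean (\<lambda>\<zeta>. f (complex_of_real R * \<zeta>) * cinner (blinfun_apply (outer_density R T \<zeta>) x) y)"
    unfolding circle_mean_linear[OF h continuous_on_integrands(1)[OF assms], symmetric]
    by (rule circle_mean_cong) (simp only: hc density_in)
  moreover have "h (circle_mean (\<lambda>\<zeta>. inner_density R T \<zeta> o\<^sub>L scalar_op (f (complex_of_real (1 / R) * \<zeta>)))) =
      circle_mean (\<lambda>\<zeta>. f (complex_of_real (1 / R) * \<zeta>) * cinner (blinfun_apply (inner_density R T \<zeta>) x) y)"
    unfolding circle_mean_linear[OF h continuous_on_integrands(2)[OF assms], symmetric]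
    by (rule circle_mean_cong) (simp only: hc density_in)
  moreover have "h (S_map R c T f) = (1 / (2 + c)) *\<^sub>R
      (h (circle_mean (\<lambda>\<zeta>. outer_density R T \<zeta> o\<^sub>L scalar_op (f (complex_of_real R * \<zeta>))))
     + h (circle_mean (\<lambda>\<zeta>. inner_density R T \<zeta> o\<^sub>L scalar_op (f (complex_of_real (1 / R) * \<zeta>))))
     + complex_of_real c * laurent_coeffs R f 0 * cinner x y)"
    unfolding S_map_def dlp_integral_eq[OF T_in spectrum R_pos]
    by (simp only: h_def blinfun.scaleR_left blinfun.add_left cinner_scaleR_left cinner_add_left
        scalar_op_apply cinner_scaleC_left)
  ultimately show ?thesis
    by (simp only: h_def scaleR_conv_of_real) (simp add: field_simps)
qed

lemma laurent_0:
  assumes "f \<in> annulus_algebra R"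
  shows "laurent_coeffs R f 0 = circle_mean (\<lambda>\<zeta>. f (complex_of_real R * \<zeta>))"
    "laurent_coeffs R f 0 = circle_mean (\<lambda>\<zeta>. f (complex_of_real (1 / R) * \<zeta>))"
  by (rule laurent_coeff_0[OF R_gt_1 assms inverse_R_le(1) inverse_R_le(3)],
      rule laurent_coeff_0[OF R_gt_1 assms inverse_R_le(2) inverse_R_le(1)])

lemma S_map_add:
  assumes f: "f \<in> annulus_algebra R" and g: "g \<in> annulus_algebra R"
  shows "S_map R c T (\<lambda>z. f z + g z) = S_map R c T f + S_map R c T g"
proof (rule blinfun_cinner_eqI)
  fix x y
  have "laurent_coeffs R (\<lambda>z. f z + g z) 0 = laurent_coeffs R f 0 + laurent_coeffs R g 0"
    unfolding laurent_0(1)[OF f] laurent_0(1)[OF g] laurent_0(1)[OF annulus_algebra_intros(2)[OF f g]]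
    by (intro circle_mean_add continuous_on_circle_values f g)
  moreover have "circle_mean (\<lambda>\<zeta>. (f (complex_of_real R * \<zeta>) + g (complex_of_real R * \<zeta>)) * cinner (blinfun_apply (outer_density R T \<zeta>) x) y)
     = circle_mean (\<lambda>\<zeta>. f (complex_of_real R * \<zeta>) * cinner (blinfun_apply (outer_density R T \<zeta>) x) y)
     + circle_mean (\<lambda>\<zeta>. g (complex_of_real R * \<zeta>) * cinner (blinfun_apply (outer_density R T \<zeta>) x) y)"
    unfolding distrib_right
    by (intro circle_mean_add continuous_on_mult continuous_on_circle_values continuous_on_density_form f g)
  moreover have "circle_mean (\<lambda>\<zeta>. (f (complex_of_real (1 / R) * \<zeta>) + g (complex_of_real (1 / R) * \<zeta>)) * cinner (blinfun_apply (inner_density R T \<zeta>) x) y)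
     = circle_mean (\<lambda>\<zeta>. f (complex_of_real (1 / R) * \<zeta>) * cinner (blinfun_apply (inner_density R T \<zeta>) x) y)
     + circle_mean (\<lambda>\<zeta>. g (complex_of_real (1 / R) * \<zeta>) * cinner (blinfun_apply (inner_density R T \<zeta>) x) y)"
    unfolding distrib_right
    by (intro circle_mean_add continuous_on_mult continuous_on_circle_values continuous_on_density_form f g)
  ultimately show "cinner (blinfun_apply (S_map R c T (\<lambda>z. f z + g z)) x) y =
      cinner (blinfun_apply (S_map R c T f + S_map R c T g) x) y"
    unfolding blinfun.add_left cinner_add_left cinner_S_map[OF f] cinner_S_map[OF g]
      cinner_S_map[OF annulus_algebra_intros(2)[OF f g]]
    by (simp only: add_divide_distrib[symmetric]) (simp add: algebra_simps)
qed

lemma S_map_scale: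
  assumes f: "f \<in> annulus_algebra R"
  shows "S_map R c T (\<lambda>z. a * f z) = scalar_op a o\<^sub>L S_map R c T f"
proof (rule blinfun_cinner_eqI)
  fix x y
  have "laurent_coeffs R (\<lambda>z. a * f z) 0 = a * laurent_coeffs R f 0"
    unfolding laurent_0(1)[OF f] laurent_0(1)[OF annulus_algebra_intros(3)[OF f]]
    by (intro circle_mean_mult_left continuous_on_circle_values f)
  moreover have "circle_mean (\<lambda>\<zeta>. a * f (complex_of_real R * \<zeta>) * cinner (blinfun_apply (outer_density R T \<zeta>) x) y)
     = a * circle_mean (\<lambda>\<zeta>. f (complex_of_real R * \<zeta>) * cinner (blinfun_apply (outer_density R T \<zeta>) x) y)"
    unfolding mult.assoc
    by (intro circle_mean_mult_left continuous_on_mult continuous_on_circle_values continuous_on_density_form f)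
  moreover have "circle_mean (\<lambda>\<zeta>. a * f (complex_of_real (1 / R) * \<zeta>) * cinner (blinfun_apply (inner_density R T \<zeta>) x) y)
     = a * circle_mean (\<lambda>\<zeta>. f (complex_of_real (1 / R) * \<zeta>) * cinner (blinfun_apply (inner_density R T \<zeta>) x) y)"
    unfolding mult.assoc
    by (intro circle_mean_mult_left continuous_on_mult continuous_on_circle_values continuous_on_density_form f)
  ultimately show "cinner (blinfun_apply (S_map R c T (\<lambda>z. a * f z)) x) y =
      cinner (blinfun_apply (scalar_op a o\<^sub>L S_map R c T f) x) y"
    unfolding blinfun_apply_blinfun_compose scalar_op_apply cinner_scaleC_left cinner_S_map[OF f]
      cinner_S_map[OF annulus_algebra_intros(3)[OF f]]
    by (simp add: algebra_simps)
qed

lemma S_map_sum: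
  assumes "finite I" "\<And>i. i \<in> I \<Longrightarrow> g i \<in> annulus_algebra R"
  shows "S_map R c T (\<lambda>z. \<Sum>i\<in>I. g i z) = (\<Sum>i\<in>I. S_map R c T (g i))"
  using assms
proof (induction I)
  case empty
  have "scalar_op 0 o\<^sub>L A = 0" for A :: "'a \<Rightarrow>\<^sub>L 'a" by (rule blinfun_eqI) simp
  then show ?case
    using S_map_scale[OF annulus_algebra_intros(1)[of 0 R], of 0] by simp
next
  case (insert i I)
  then show ?case by (simp add: S_map_add annulus_algebra_sum)
qed

lemma circle_mean_resolvent_form:
  "circle_mean (\<lambda>\<zeta>. cinner (blinfun_apply (U \<zeta>) x) y) = cinner x y"
  "circle_mean (\<lambda>\<zeta>. cinner (blinfun_apply (V \<zeta>) x) y) = cinner x y"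
  by (subst circle_mean_centre, intro continuous_on_disc_resolvent_form regular,
      intro holomorphic_on_disc_resolvent_form regular, simp add: disc_resolvent_0)+

lemma continuous_on_resolvent_form:
  "continuous_on (sphere 0 1) (\<lambda>\<zeta>. cinner (blinfun_apply (U \<zeta>) x) y)"
  "continuous_on (sphere 0 1) (\<lambda>\<zeta>. cinner (blinfun_apply (V \<zeta>) x) y)"
  "continuous_on (sphere 0 1) (\<lambda>\<zeta>. cinner (blinfun_apply (U (cnj \<zeta>)) x) y)"
proof -
  note 1 = continuous_on_disc_resolvent_form[OF regular(1), of x y]
  note 2 = continuous_on_disc_resolvent_form[OF regular(2), of x y]
  show "continuous_on (sphere 0 1) (\<lambda>\<zeta>. cinner (blinfun_apply (U \<zeta>) x) y)"
    by (rule continuous_on_subset[OF 1]) auto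
  show "continuous_on (sphere 0 1) (\<lambda>\<zeta>. cinner (blinfun_apply (V \<zeta>) x) y)"
    by (rule continuous_on_subset[OF 2]) auto
  show "continuous_on (sphere 0 1) (\<lambda>\<zeta>. cinner (blinfun_apply (U (cnj \<zeta>)) x) y)"
    by (rule continuous_on_compose2[OF 1]) (auto intro!: continuous_intros)
qed

text \<open>
  By the mean value property the outer density has mean \<open>2\<close> and the inner one has mean \<open>0\<close>.
  Together with \<open>c\<close> this gives the total mass \<open>2 + c\<close> that the definition divides by.
\<close>

lemma S_map_one: "S_map R c T (\<lambda>_. 1) = id_blinfun"
proof (rule blinfun_cinner_eqI)
  fix x y
  note cc = continuous_on_cnj[OF continuous_on_resolvent_form(3)]
    continuous_on_cnj[OF continuous_on_resolvent_form(2)]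
  have cU: "circle_mean (\<lambda>\<zeta>. cinner (blinfun_apply (U (cnj \<zeta>)) x) y) = cinner x y" for x y
    using circle_mean_cnj[of "\<lambda>\<zeta>. cinner (blinfun_apply (U \<zeta>) x) y"]
    by (simp add: circle_mean_resolvent_form)
  have cnjm: "circle_mean (\<lambda>\<zeta>. cnj (g \<zeta>)) = cnj (circle_mean g)" if "continuous_on (sphere 0 1) g" for g
    by (rule circle_mean_linear[OF bounded_linear_cnj that])
  have "circle_mean (\<lambda>\<zeta>. cinner (blinfun_apply (outer_density R T \<zeta>) x) y) =
      circle_mean (\<lambda>\<zeta>. cinner (blinfun_apply (U (cnj \<zeta>)) x) y + cnj (cinner (blinfun_apply (U (cnj \<zeta>)) y) x))"
    by (rule circle_mean_cong) (rule cinner_density)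
  also have "\<dots> = cinner x y + cnj (cinner y x)"
    by (simp only: circle_mean_add continuous_on_resolvent_form cc cnjm cU)
  finally have 1: "circle_mean (\<lambda>\<zeta>. cinner (blinfun_apply (outer_density R T \<zeta>) x) y) = 2 * cinner x y"
    by (simp flip: cinner_commute)
  have "circle_mean (\<lambda>\<zeta>. cinner (blinfun_apply (inner_density R T \<zeta>) x) y) =
      circle_mean (\<lambda>\<zeta>. cinner (blinfun_apply (V \<zeta>) x) y + cnj (cinner (blinfun_apply (V \<zeta>) y) x) - 2 * cinner x y)"
    by (rule circle_mean_cong) (rule cinner_density)
  also have "\<dots> = cinner x y + cnj (cinner y x) - 2 * cinner x y"
    by (simp only: circle_mean_add circle_mean_diff continuous_on_resolvent_form cc cnjm
        circle_mean_resolvent_form continuous_on_add continuous_on_const circle_mean_const)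
  finally have 2: "circle_mean (\<lambda>\<zeta>. cinner (blinfun_apply (inner_density R T \<zeta>) x) y) = 0"
    by (simp flip: cinner_commute)
  have 3: "laurent_coeffs R (\<lambda>_. 1) 0 = 1"
    using laurent_0(1)[OF annulus_algebra_intros(1)] by simp
  have "complex_of_real (2 + c) \<noteq> 0" using c_gt by (simp del: of_real_add)
  then show "cinner (blinfun_apply (S_map R c T (\<lambda>_. 1)) x) y = cinner (blinfun_apply id_blinfun x) y"
    unfolding cinner_S_map[OF annulus_algebra_intros(1)] mult_1 1 2 3
    by (simp add: field_simps)
qed

definition outer_weight :: "'a \<Rightarrow> complex \<Rightarrow> real" where
  "outer_weight x \<zeta> = 2 * Re (cinner (blinfun_apply (U (cnj \<zeta>)) x) x)"

definition inner_weight :: "'a \<Rightarrow> complex \<Rightarrow> real" where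
  "inner_weight x \<zeta> = 2 * Re (cinner (blinfun_apply (V \<zeta>) x) x) - 2 * (norm x)\<^sup>2"

lemma continuous_on_weights:
  "continuous_on (sphere 0 1) (outer_weight x)" "continuous_on (sphere 0 1) (inner_weight x)"
  unfolding outer_weight_def inner_weight_def
  by (intro continuous_intros continuous_on_resolvent_form)+

text \<open>
  The quadratic form of \<open>S f\<close> has real densities, hence its real part depends on \<open>f\<close> only through
  \<open>Re f\<close> on the boundary.
\<close>

lemma Re_S_map:
  assumes f: "f \<in> annulus_algebra R"
  shows "(2 + c) * Re (cinner (blinfun_apply (S_map R c T f) x) x) =
      circle_mean (\<lambda>\<zeta>. Re (f (complex_of_real R * \<zeta>)) * outer_weight x \<zeta>)
    + circle_mean (\<lambda>\<zeta>. Re (f (complex_of_real (1 / R) * \<zeta>)) * inner_weight x \<zeta>)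
    + c * Re (laurent_coeffs R f 0) * (norm x)\<^sup>2"
proof -
  have "circle_mean (\<lambda>\<zeta>. Re (f (complex_of_real R * \<zeta>)) * outer_weight x \<zeta>) =
      circle_mean (\<lambda>\<zeta>. Re (f (complex_of_real R * \<zeta>) * cinner (blinfun_apply (outer_density R T \<zeta>) x) x))"
    by (rule circle_mean_cong) (simp add: cinner_density outer_weight_def complex_add_cnj)
  also have "\<dots> = Re (circle_mean (\<lambda>\<zeta>. f (complex_of_real R * \<zeta>) * cinner (blinfun_apply (outer_density R T \<zeta>) x) x))"
    by (intro circle_mean_linear bounded_linear_Re continuous_on_mult continuous_on_circle_values
        continuous_on_density_form f)
  finally have 1: "circle_mean (\<lambda>\<zeta>. Re (f (complex_of_real R * \<zeta>)) * outer_weight x \<zeta>) = \<dots>" .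
  have "circle_mean (\<lambda>\<zeta>. Re (f (complex_of_real (1 / R) * \<zeta>)) * inner_weight x \<zeta>) =
      circle_mean (\<lambda>\<zeta>. Re (f (complex_of_real (1 / R) * \<zeta>) * cinner (blinfun_apply (inner_density R T \<zeta>) x) x))"
  proof (rule circle_mean_cong)
    fix \<zeta> :: complex assume "cmod \<zeta> = 1"
    then have "cinner (blinfun_apply (inner_density R T \<zeta>) x) x = complex_of_real (inner_weight x \<zeta>)"
      by (simp add: cinner_density inner_weight_def complex_eq_iff cinner_self)
    then show "Re (f (complex_of_real (1 / R) * \<zeta>)) * inner_weight x \<zeta> =
        Re (f (complex_of_real (1 / R) * \<zeta>) * cinner (blinfun_apply (inner_density R T \<zeta>) x) x)"
      by (simp del: of_real_divide)
  qed
  also have "\<dots> = Re (circle_mean (\<lambda>\<zeta>. f (complex_of_real (1 / R) * \<zeta>) * cinner (blinfun_apply (inner_density R T \<zeta>) x) x))"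
    by (intro circle_mean_linear bounded_linear_Re continuous_on_mult continuous_on_circle_values
        continuous_on_density_form f)
  finally have 2: "circle_mean (\<lambda>\<zeta>. Re (f (complex_of_real (1 / R) * \<zeta>)) * inner_weight x \<zeta>) = \<dots>" .
  have 3: "c * Re (laurent_coeffs R f 0) * (norm x)\<^sup>2 = Re (complex_of_real c * laurent_coeffs R f 0 * cinner x x)"
    unfolding cinner_self by simp
  show ?thesis
    unfolding 1 2 3 cinner_S_map[OF f] using c_gt
    by (simp only: Re_divide_of_real plus_complex.simps) simp
qed

lemma Re_laurent_0:
  assumes f: "f \<in> annulus_algebra R"
  shows "Re (laurent_coeffs R f 0) = circle_mean (\<lambda>\<zeta>. Re (f (complex_of_real R * \<zeta>)))"
    "Re (laurent_coeffs R f 0) = circle_mean (\<lambda>\<zeta>. Re (f (complex_of_real (1 / R) * \<zeta>)))"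
  unfolding circle_mean_linear[OF bounded_linear_Re continuous_on_circle_values(1)[OF f]]
    circle_mean_linear[OF bounded_linear_Re continuous_on_circle_values(2)[OF f]]
  by (simp_all only: laurent_0(1)[OF f] flip: laurent_0(2)[OF f])

lemma DLA_iff:
  "T \<in> DLA R c \<longleftrightarrow> (\<forall>z\<in>ball 0 1. \<forall>w\<in>ball 0 1. \<forall>x.
     0 \<le> 2 * Re (cinner (blinfun_apply (U z) x) x) + 2 * Re (cinner (blinfun_apply (V w) x) x)
       + (c - 2) * (norm x)\<^sup>2)"
proof -
  have "positive_op (2 *\<^sub>R op_Re (U z + V w) - scalar_op 2 + scalar_op (complex_of_real c)) \<longleftrightarrow>
      (\<forall>x. 0 \<le> 2 * Re (cinner (blinfun_apply (U z) x) x) + 2 * Re (cinner (blinfun_apply (V w) x) x)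
       + (c - 2) * (norm x)\<^sup>2)" if "z \<in> ball 0 1" "w \<in> ball 0 1" for z w
  proof -
    have UV: "U z + V w \<in> bounded_ops"
      using that by (intro bounded_ops_intros resolvent_in) (auto simp: less_imp_le)
    have "2 *\<^sub>R op_Re (U z + V w) - scalar_op 2 + scalar_op (complex_of_real c) \<in> bounded_ops"
      by (intro bounded_ops_intros op_Re_in UV)
    moreover have "cinner (blinfun_apply (2 *\<^sub>R op_Re (U z + V w) - scalar_op 2 + scalar_op (complex_of_real c)) x) x =
        complex_of_real (2 * Re (cinner (blinfun_apply (U z) x) x) + 2 * Re (cinner (blinfun_apply (V w) x) x)
       + (c - 2) * (norm x)\<^sup>2)" for x
      by (simp add: blinfun.add_left blinfun.diff_left blinfun.scaleR_left cinner_add_left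
          cinner_diff_left cinner_scaleR_left cinner_scaleC_left Re_cinner_op_Re[OF UV]
          cinner_self complex_eq_iff algebra_simps)
    ultimately show ?thesis unfolding positive_op_def by (simp del: of_real_add of_real_mult)
  qed
  moreover have "op_spectrum T \<subseteq> closure (annulus R)"
    using spectrum closure_subset by blast
  ultimately show ?thesis
    unfolding DLA_def disc_resolvent_def[symmetric] using T_in by simp
qed

section \<open>From the double-layer class to contractivity\<close>

text \<open>
  The resolvents are continuous up to the unit circle because the spectrum lies in the open
  annulus.
\<close>

lemma DLA_closed_disc:
  assumes "T \<in> DLA R c" "cmod z \<le> 1" "cmod w \<le> 1"
  shows "0 \<le> 2 * Re (cinner (blinfun_apply (U z) x) x) + 2 * Re (cinner (blinfun_apply (V w) x) x)
       + (c - 2) * (norm x)\<^sup>2"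
proof -
  define F where "F = (\<lambda>(z, w). 2 * Re (cinner (blinfun_apply (U z) x) x)
       + 2 * Re (cinner (blinfun_apply (V w) x) x) + (c - 2) * (norm x)\<^sup>2)"
  have "continuous_on (cball 0 1 \<times> cball 0 1) F"
    unfolding F_def case_prod_unfold
    by (intro continuous_intros
        continuous_on_compose2[OF continuous_on_disc_resolvent_form[OF regular(1)]]
        continuous_on_compose2[OF continuous_on_disc_resolvent_form[OF regular(2)]]) auto
  moreover have "closure (ball (0::complex) 1 \<times> ball (0::complex) 1) = cball 0 1 \<times> cball 0 1"
    by (simp add: closure_Times)
  moreover have "0 \<le> F p" if "p \<in> ball 0 1 \<times> ball 0 1" for p
    using that assms(1) unfolding DLA_iff by (auto simp: F_def)
  ultimately have "0 \<le> F (z, w)"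
    using continuous_ge_on_closure[of "ball 0 1 \<times> ball 0 1" F "(z, w)" 0] assms(2,3) by simp
  then show ?thesis by (simp add: F_def)
qed

text \<open>
  The minimum \<open>\<alpha>\<close> of the outer weight is shifted to the inner circle. The total integral does
  not change, because \<open>Re f\<close> has the same mean on both circles, and afterwards both weights are
  nonnegative.
\<close>

lemma S_map_positive_if_DLA:
  assumes "T \<in> DLA R c" "f \<in> annulus_algebra R"
    and nonneg: "\<And>z. z \<in> closure (annulus R) \<Longrightarrow> 0 \<le> Re (f z)"
  shows "0 \<le> Re (cinner (blinfun_apply (S_map R c T f) x) x)"
proof -
  note f = assms(2)
  have "\<exists>\<zeta>0\<in>sphere 0 1. \<forall>\<zeta>\<in>sphere 0 1. outer_weight x \<zeta>0 \<le> outer_weight x \<zeta>"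
    by (rule continuous_attains_inf[OF compact_sphere _ continuous_on_weights(1)]) simp
  then obtain \<zeta>0 where \<zeta>0: "cmod \<zeta>0 = 1" "\<And>\<zeta>. cmod \<zeta> = 1 \<Longrightarrow> outer_weight x \<zeta>0 \<le> outer_weight x \<zeta>"
    by auto
  define \<alpha> where "\<alpha> = outer_weight x \<zeta>0"
  define F where "F \<zeta> = Re (f (complex_of_real R * \<zeta>))" for \<zeta>
  define G where "G \<zeta> = Re (f (complex_of_real (1 / R) * \<zeta>))" for \<zeta>
  have cF: "continuous_on (sphere 0 1) F" and cG: "continuous_on (sphere 0 1) G"
    unfolding F_def G_def by (intro continuous_on_Re continuous_on_circle_values f)+
  have "0 < 1 / R" using R_pos by simp
  have F0: "0 \<le> F \<zeta>" and G0: "0 \<le> G \<zeta>" if "cmod \<zeta> = 1" for \<zeta>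
    unfolding F_def G_def
    by (rule nonneg; use that R_pos inverse_R_le in \<open>simp add: closure_annulus[OF R_gt_1] norm_mult norm_divide\<close>)+
  have w2: "0 \<le> inner_weight x \<zeta> + (c * (norm x)\<^sup>2 + \<alpha>)" if "cmod \<zeta> = 1" for \<zeta>
    using DLA_closed_disc[OF assms(1), of "cnj \<zeta>0" \<zeta> x] that \<zeta>0(1)
    by (simp add: inner_weight_def \<alpha>_def outer_weight_def algebra_simps)
  have "0 \<le> circle_mean (\<lambda>\<zeta>. F \<zeta> * (outer_weight x \<zeta> - \<alpha>))"
    by (rule circle_mean_nonneg)
       (auto intro!: continuous_intros cF continuous_on_weights mult_nonneg_nonneg F0 \<zeta>0(2) simp: \<alpha>_def)
  also have "\<dots> = circle_mean (\<lambda>\<zeta>. F \<zeta> * outer_weight x \<zeta>) - circle_mean F * \<alpha>"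
    unfolding right_diff_distrib
    using circle_mean_linear[OF bounded_linear_mult_left[of \<alpha>] cF]
    by (subst circle_mean_diff) (auto intro!: continuous_intros cF continuous_on_weights)
  finally have 1: "circle_mean F * \<alpha> \<le> circle_mean (\<lambda>\<zeta>. F \<zeta> * outer_weight x \<zeta>)" by simp
  have "0 \<le> circle_mean (\<lambda>\<zeta>. G \<zeta> * (inner_weight x \<zeta> + (c * (norm x)\<^sup>2 + \<alpha>)))"
    by (rule circle_mean_nonneg)
       (auto intro!: continuous_intros cG continuous_on_weights mult_nonneg_nonneg G0 w2)
  also have "\<dots> = circle_mean (\<lambda>\<zeta>. G \<zeta> * inner_weight x \<zeta>) + circle_mean G * (c * (norm x)\<^sup>2 + \<alpha>)"
    unfolding distrib_left[of _ "inner_weight x _"]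
    using circle_mean_linear[OF bounded_linear_mult_left[of "c * (norm x)\<^sup>2 + \<alpha>"] cG]
    by (subst circle_mean_add) (auto intro!: continuous_intros cG continuous_on_weights)
  finally have 2: "- (circle_mean G * (c * (norm x)\<^sup>2 + \<alpha>)) \<le> circle_mean (\<lambda>\<zeta>. G \<zeta> * inner_weight x \<zeta>)"
    by simp
  have FG: "circle_mean F = Re (laurent_coeffs R f 0)" "circle_mean G = Re (laurent_coeffs R f 0)"
    unfolding F_def G_def using Re_laurent_0[OF f] by (simp_all del: of_real_divide)
  have "0 \<le> (2 + c) * Re (cinner (blinfun_apply (S_map R c T f) x) x)"
    unfolding Re_S_map[OF f] F_def[symmetric] G_def[symmetric]
    using 1 2 unfolding FG by (simp add: algebra_simps)
  then show ?thesis using c_gt by (simp add: zero_le_mult_iff)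
qed

text \<open>
  Positivity alone controls numerical ranges and thus gives the bound \<open>2\<close>. Using the powers of
  \<open>f\<close> improves it to \<open>1\<close>. For \<open>\<bar>\<omega>\<bar> = 1\<close> the function
  \<open>h \<omega> = (1 + e) + 2 \<Sum>n=1..N. (r\<omega>f)\<^sup>n\<close> has nonnegative real part, so
  \<open>Re \<langle>S(h \<omega>)(x - \<omega>y), x - \<omega>y\<rangle> \<ge> 0\<close>. In the mean over \<open>\<omega>\<close> the two diagonal terms contribute
  \<open>(1 + e)(\<parallel>x\<parallel>\<^sup>2 + \<parallel>y\<parallel>\<^sup>2)\<close>, the mixed term with \<open>cnj \<omega>\<close> contributes \<open>- 2r\<langle>S(f)x, y\<rangle>\<close>, and
  the one with \<open>\<omega>\<close> vanishes. Then let \<open>N \<rightarrow> \<infinity>\<close> and \<open>r \<rightarrow> 1\<close>.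
\<close>

lemma S_map_contractive_if_positive:
  assumes pos: "\<And>g x. g \<in> annulus_algebra R \<Longrightarrow> (\<And>z. z \<in> closure (annulus R) \<Longrightarrow> 0 \<le> Re (g z))
      \<Longrightarrow> 0 \<le> Re (cinner (blinfun_apply (S_map R c T g) x) x)"
    and f: "f \<in> annulus_algebra R" and f1: "\<And>z. z \<in> closure (annulus R) \<Longrightarrow> cmod (f z) \<le> 1"
  shows "norm (S_map R c T f) \<le> 1"
proof (rule norm_blinfun_le_1I)
  fix x y :: 'a
  define b where "b n u v = cinner (blinfun_apply (S_map R c T (\<lambda>z. f z ^ n)) u) v" for n u v
  define s where "s = (norm x)\<^sup>2 + (norm y)\<^sup>2"
  have key: "2 * r * Re (b 1 x y) \<le> (1 + 2 * r ^ Suc N / (1 - r)) * s"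
    if r: "0 < r" "r < 1" and N: "1 \<le> N" for r :: real and N
  proof -
    define e where "e = 2 * r ^ Suc N / (1 - r)"
    define d where "d n = (if n = 0 then complex_of_real (1 + e) else 2 * complex_of_real r ^ n)" for n
    define h where "h \<omega> z = (\<Sum>n\<le>N. d n * \<omega> ^ n * f z ^ n)" for \<omega> z
    define P where "P n = d n * (b n x x + b n y y)" for n
    define Q where "Q n = d n * b n x y" for n
    define Q' where "Q' n = d n * b n y x" for n
    define g where "g \<omega> = (\<Sum>n\<le>N. P n * \<omega> powi (int n) - Q n * \<omega> powi (int n - 1)
        - Q' n * \<omega> powi (int n + 1))" for \<omega>
    have h_in: "h \<omega> \<in> annulus_algebra R" for \<omega>
      unfolding h_def by (intro annulus_algebra_sum annulus_algebra_intros f) simp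
    have Sh: "cinner (blinfun_apply (S_map R c T (h \<omega>)) u) v = (\<Sum>n\<le>N. d n * \<omega> ^ n * b n u v)" for \<omega> u v
    proof -
      have "S_map R c T (h \<omega>) = (\<Sum>n\<le>N. scalar_op (d n * \<omega> ^ n) o\<^sub>L S_map R c T (\<lambda>z. f z ^ n))"
        unfolding h_def
        by (simp add: S_map_sum S_map_scale annulus_algebra_intros f)
      then show ?thesis
        by (simp add: b_def blinfun.sum_left cinner_sum_left cinner_scaleC_left)
    qed
    have h_pos: "0 \<le> Re (h \<omega> z)" if "cmod \<omega> = 1" "z \<in> closure (annulus R)" for \<omega> z
    proof -
      have "cmod (complex_of_real r * \<omega> * f z) \<le> r"
        using that f1[OF that(2)] r by (simp add: norm_mult mult_left_le)
      from truncated_Poisson_lower_bound[OF this r(2), of N]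
      have "- e \<le> Re (1 + (\<Sum>n=1..N. 2 * (complex_of_real r * \<omega> * f z) ^ n))"
        by (simp only: e_def)
      moreover have "h \<omega> z = complex_of_real (1 + e) + (\<Sum>n=1..N. 2 * (complex_of_real r * \<omega> * f z) ^ n)"
      proof -
        have "h \<omega> z = d 0 * \<omega> ^ 0 * f z ^ 0 + (\<Sum>n=1..N. d n * \<omega> ^ n * f z ^ n)"
          unfolding h_def by (rule sum_atMost_head)
        also have "(\<Sum>n=1..N. d n * \<omega> ^ n * f z ^ n) = (\<Sum>n=1..N. 2 * (complex_of_real r * \<omega> * f z) ^ n)"
          by (rule sum.cong) (auto simp: d_def power_mult_distrib)
        finally show ?thesis by (simp add: d_def)
      qed
      ultimately show ?thesis by simp
    qed
    have "Re (g \<omega>) = Re (cinner (blinfun_apply (S_map R c T (h \<omega>)) (x - \<omega> *\<^sub>C y)) (x - \<omega> *\<^sub>C y))"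
      if "cmod \<omega> = 1" for \<omega>
    proof -
      have "\<omega> \<noteq> 0" using that by auto
      have "b n (x - \<omega> *\<^sub>C y) (x - \<omega> *\<^sub>C y) = b n x x + \<omega> * cnj \<omega> * b n y y - cnj \<omega> * b n x y - \<omega> * b n y x" for n
        unfolding b_def
        by (simp add: blinfun.diff_right bounded_opsD[OF S_map_in[OF annulus_algebra_intros(4)[OF f]]]
            cinner_diff_left cinner_diff_right cinner_scaleC_left cinner_scaleC_right algebra_simps)
      moreover have "\<omega> * cnj \<omega> = 1" "cnj \<omega> = inverse \<omega>"
        using that \<open>\<omega> \<noteq> 0\<close> by (simp_all add: cnj_eq_inverse)
      ultimately have b': "b n (x - \<omega> *\<^sub>C y) (x - \<omega> *\<^sub>C y) = b n x x + b n y y - inverse \<omega> * b n x y - \<omega> * b n y x" for n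
        by simp
      have "d n * \<omega> ^ n * b n (x - \<omega> *\<^sub>C y) (x - \<omega> *\<^sub>C y) =
          P n * \<omega> powi (int n) - Q n * \<omega> powi (int n - 1) - Q' n * \<omega> powi (int n + 1)" for n
        unfolding b' P_def Q_def Q'_def
        using \<open>\<omega> \<noteq> 0\<close> by (simp add: power_int_add power_int_diff algebra_simps divide_inverse)
      then show ?thesis by (simp add: Sh g_def)
    qed
    then have g_pos: "0 \<le> Re (g \<omega>)" if "cmod \<omega> = 1" for \<omega>
      using that pos[OF h_in h_pos] by simp
    have cp: "continuous_on (sphere 0 1) (\<lambda>\<omega>::complex. \<omega> powi k)" for k
      by (intro continuous_intros) auto
    have ct: "continuous_on (sphere 0 1) (\<lambda>\<omega>. a * \<omega> powi k)" for a :: complex and k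
      by (intro continuous_intros cp)
    have cg: "continuous_on (sphere 0 1) g"
      unfolding g_def by (intro continuous_on_sum continuous_on_diff ct)
    have "circle_mean g = (\<Sum>n\<le>N. circle_mean (\<lambda>\<omega>. P n * \<omega> powi (int n) - Q n * \<omega> powi (int n - 1)
        - Q' n * \<omega> powi (int n + 1)))"
      unfolding g_def by (rule circle_mean_sum) (intro finite_atMost continuous_on_diff ct)+
    also have "\<dots> = (\<Sum>n\<le>N. P n * (if n = 0 then 1 else 0) - Q n * (if n = 1 then 1 else 0))"
    proof (rule sum.cong[OF refl])
      fix n
      have "circle_mean (\<lambda>\<omega>. P n * \<omega> powi (int n) - Q n * \<omega> powi (int n - 1) - Q' n * \<omega> powi (int n + 1)) =
          P n * circle_mean (\<lambda>\<omega>. \<omega> powi (int n)) - Q n * circle_mean (\<lambda>\<omega>. \<omega> powi (int n - 1))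
          - Q' n * circle_mean (\<lambda>\<omega>. \<omega> powi (int n + 1))"
        by (simp only: circle_mean_diff circle_mean_mult_left continuous_on_diff ct cp)
      then show "circle_mean (\<lambda>\<omega>. P n * \<omega> powi (int n) - Q n * \<omega> powi (int n - 1) - Q' n * \<omega> powi (int n + 1)) =
          P n * (if n = 0 then 1 else 0) - Q n * (if n = 1 then 1 else 0)"
        unfolding circle_mean_powi by auto
    qed
    also have "\<dots> = P 0 - Q 1"
      using N by (simp add: sum_subtractf if_distrib[of "\<lambda>x. _ * x"] cong: if_cong)
    also have "\<dots> = complex_of_real ((1 + e) * s) - 2 * complex_of_real r * b 1 x y"
      by (simp add: P_def Q_def d_def b_def S_map_one cinner_self s_def)
    finally have "circle_mean g = \<dots>" .
    moreover have "0 \<le> Re (circle_mean g)"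
      unfolding circle_mean_linear[OF bounded_linear_Re cg, symmetric]
      by (intro circle_mean_nonneg continuous_on_Re cg g_pos)
    ultimately show ?thesis by (simp add: e_def)
  qed
  have "r * (2 * Re (b 1 x y)) \<le> s" if r: "0 < r" "r < 1" for r
  proof (rule LIMSEQ_le_const)
    have "(\<lambda>N. (1 + 2 * (r * r ^ N) / (1 - r)) * s) \<longlonglongrightarrow> (1 + 2 * (r * 0) / (1 - r)) * s"
      by (intro tendsto_intros LIMSEQ_realpow_zero) (use r in auto)
    then show "(\<lambda>N. (1 + 2 * r ^ Suc N / (1 - r)) * s) \<longlonglongrightarrow> s" by simp
    show "\<exists>N. \<forall>n\<ge>N. r * (2 * Re (b 1 x y)) \<le> (1 + 2 * r ^ Suc n / (1 - r)) * s"
      using key[OF r] by (intro exI[of _ 1]) (simp add: mult_ac)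
  qed
  then have "2 * Re (b 1 x y) \<le> s" by (rule field_le_mult_one_interval)
  then show "2 * inner (blinfun_apply (S_map R c T f) x) y \<le> (norm x)\<^sup>2 + (norm y)\<^sup>2"
    by (simp add: b_def s_def Re_cinner)
qed

lemma norm_S_map_le_if_DLA:
  assumes "T \<in> DLA R c" and f: "f \<in> annulus_algebra R"
  shows "norm (S_map R c T f) \<le> annulus_norm R f"
proof (rule field_le_epsilon)
  fix e :: real assume "e > 0"
  define K where "K = annulus_norm R f + e"
  have "1 \<in> closure (annulus R)" using R_gt_1 by (simp add: closure_annulus)
  then have "0 \<le> annulus_norm R f"
    using cmod_le_annulus_norm[OF f] norm_ge_zero order_trans by blast
  then have "K > 0" using \<open>e > 0\<close> by (simp add: K_def)
  define g where "g z = complex_of_real (1 / K) * f z" for z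
  have g: "g \<in> annulus_algebra R" unfolding g_def by (intro annulus_algebra_intros f)
  have Sg: "norm (S_map R c T g) \<le> 1"
  proof (rule S_map_contractive_if_positive[OF _ g])
    show "0 \<le> Re (cinner (blinfun_apply (S_map R c T h) x) x)"
      if "h \<in> annulus_algebra R" "\<And>z. z \<in> closure (annulus R) \<Longrightarrow> 0 \<le> Re (h z)" for h x
      using assms(1) that by (rule S_map_positive_if_DLA)
  next
    fix z assume "z \<in> closure (annulus R)"
    then have "cmod (f z) \<le> K" using cmod_le_annulus_norm[OF f] \<open>e > 0\<close> by (simp add: K_def add_increasing2)
    then show "cmod (g z) \<le> 1" using \<open>K > 0\<close> by (simp add: g_def norm_mult norm_divide)
  qed
  have "f = (\<lambda>z. complex_of_real K * g z)" using \<open>K > 0\<close> by (simp add: g_def)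
  then have "S_map R c T f = scalar_op (complex_of_real K) o\<^sub>L S_map R c T g"
    using S_map_scale[OF g] by simp
  then have "norm (S_map R c T f) \<le> norm (scalar_op (complex_of_real K) :: 'a \<Rightarrow>\<^sub>L 'a) * norm (S_map R c T g)"
    by (simp add: norm_blinfun_compose)
  also have "\<dots> \<le> K * 1"
    using norm_scalar_op_le[of "complex_of_real K", where ?'a = 'a] \<open>K > 0\<close>
    by (intro mult_mono Sg) auto
  finally show "norm (S_map R c T f) \<le> annulus_norm R f + e" by (simp add: K_def)
qed

section \<open>From contractivity to the double-layer class\<close>

text \<open>
  If \<open>Re f \<ge> 0\<close> on the boundary circles, then \<open>\<bar>1 - tf\<bar> \<le> 1 + O(t\<^sup>2)\<close> there, and on the whole
  annulus by the maximum modulus principle. Contractivity and \<open>S 1 = 1\<close> bound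
  \<open>\<parallel>x\<parallel>\<^sup>2 - t Re \<langle>S(f)x, x\<rangle>\<close> by \<open>(1 + O(t\<^sup>2))\<parallel>x\<parallel>\<^sup>2\<close>; compare the terms of order \<open>t\<close>.
\<close>

lemma S_map_positive_if_contractive:
  assumes contr: "\<And>g. g \<in> annulus_algebra R \<Longrightarrow> norm (S_map R c T g) \<le> annulus_norm R g"
    and f: "f \<in> annulus_algebra R"
    and nonneg: "\<And>z. cmod z = R \<or> cmod z = 1 / R \<Longrightarrow> 0 \<le> Re (f z)"
  shows "0 \<le> Re (cinner (blinfun_apply (S_map R c T f) x) x)"
proof -
  define \<rho> where "\<rho> = Re (cinner (blinfun_apply (S_map R c T f) x) x)"
  define K where "K = annulus_norm R f"
  have bound: "- \<rho> \<le> t * (K\<^sup>2 / 2 * (norm x)\<^sup>2)" if "t > 0" for t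
  proof -
    define g where "g z = 1 + complex_of_real (- t) * f z" for z
    have g: "g \<in> annulus_algebra R" unfolding g_def by (intro annulus_algebra_intros f)
    have Sg: "S_map R c T g = id_blinfun + (scalar_op (complex_of_real (- t)) o\<^sub>L S_map R c T f)"
      unfolding g_def
      by (simp only: S_map_add[OF annulus_algebra_intros(1) annulus_algebra_intros(3)[OF f]]
          S_map_one S_map_scale[OF f])
    have "cmod (g z) \<le> 1 + (t * K)\<^sup>2 / 2" if z: "cmod z = R \<or> cmod z = 1 / R" for z
    proof (rule power2_le_imp_le)
      have "z \<in> closure (annulus R)"
        using z inverse_R_le by (auto simp: closure_annulus[OF R_gt_1])
      then have "cmod (f z) \<le> K" unfolding K_def by (rule cmod_le_annulus_norm[OF f])
      then have "(cmod (f z))\<^sup>2 \<le> K\<^sup>2" by (rule power_mono) simp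
      have "(cmod (g z))\<^sup>2 = 1 - 2 * t * Re (f z) + t\<^sup>2 * (cmod (f z))\<^sup>2"
        unfolding cmod_power2 by (simp add: g_def power2_eq_square algebra_simps)
      also have "\<dots> \<le> 1 + t\<^sup>2 * K\<^sup>2"
      proof -
        have "t\<^sup>2 * (cmod (f z))\<^sup>2 \<le> t\<^sup>2 * K\<^sup>2" by (rule mult_left_mono) (fact, simp)
        moreover have "0 \<le> t * Re (f z)" using nonneg[OF z] \<open>t > 0\<close> by simp
        ultimately show ?thesis by linarith
      qed
      also have "\<dots> \<le> (1 + (t * K)\<^sup>2 / 2)\<^sup>2"
      proof -
        have "(1 + (t * K)\<^sup>2 / 2)\<^sup>2 = 1 + t\<^sup>2 * K\<^sup>2 + ((t * K)\<^sup>2 / 2)\<^sup>2"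
          by (simp add: power2_eq_square algebra_simps)
        then show ?thesis by simp
      qed
      finally show "(cmod (g z))\<^sup>2 \<le> (1 + (t * K)\<^sup>2 / 2)\<^sup>2" .
    qed simp
    from annulus_norm_le[OF R_gt_1 maximum_modulus_annulus[OF R_gt_1 g this]]
    have "annulus_norm R g \<le> 1 + (t * K)\<^sup>2 / 2" .
    with contr[OF g] have nSg: "norm (S_map R c T g) \<le> 1 + (t * K)\<^sup>2 / 2" by (rule order_trans)
    have "(norm x)\<^sup>2 - t * \<rho> = Re (cinner (blinfun_apply (S_map R c T g) x) x)"
      unfolding Sg \<rho>_def
      by (simp add: blinfun.add_left cinner_add_left cinner_self cinner_scaleC_left cinner_minus_left)
    also have "\<dots> \<le> cmod (cinner (blinfun_apply (S_map R c T g) x) x)" by (rule complex_Re_le_cmod)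
    also have "\<dots> \<le> norm (blinfun_apply (S_map R c T g) x) * norm x" by (rule cinner_Cauchy_Schwarz)
    also have "\<dots> \<le> norm (S_map R c T g) * norm x * norm x"
      by (intro mult_right_mono norm_blinfun) simp
    also have "\<dots> \<le> (1 + (t * K)\<^sup>2 / 2) * norm x * norm x"
      by (intro mult_right_mono nSg) simp_all
    finally have "t * (- \<rho>) \<le> t * (t * (K\<^sup>2 / 2 * (norm x)\<^sup>2))"
      by (simp add: power2_eq_square algebra_simps)
    then show ?thesis using \<open>t > 0\<close> by (simp only: mult_le_cancel_left_pos)
  qed
  have "- \<rho> \<le> 0"
  proof (rule tendsto_lowerbound)
    show "((\<lambda>t. t * (K\<^sup>2 / 2 * (norm x)\<^sup>2)) \<longlongrightarrow> 0) (at_right 0)"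
      by (auto intro!: tendsto_eq_intros)
    show "\<forall>\<^sub>F t in at_right 0. - \<rho> \<le> t * (K\<^sup>2 / 2 * (norm x)\<^sup>2)"
      using bound eventually_at_right_less[of 0] by (auto elim: eventually_mono)
  qed simp
  then show ?thesis by (simp add: \<rho>_def)
qed

text \<open>
  Positivity is applied to a Laurent polynomial \<open>f\<close> whose real part is a truncated Poisson kernel
  with pole \<open>a\<close> on the outer and \<open>b\<close> on the inner circle, plus the small constant \<open>e N\<close> that
  makes the real part nonnegative. The outer density involves \<open>U (cnj \<zeta>)\<close> and the inner one
  \<open>V \<zeta>\<close>; therefore the outer kernel is prescribed through the powers of \<open>a\<close> and the inner one
  through those of \<open>cnj b\<close>.
\<close>

lemma DLA_if_contractive:
  assumes contr: "\<And>g. g \<in> annulus_algebra R \<Longrightarrow> norm (S_map R c T g) \<le> annulus_norm R g"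
  shows "T \<in> DLA R c"
  unfolding DLA_iff
proof (intro ballI allI)
  fix a b :: complex and x :: 'a
  assume a: "a \<in> ball 0 1" and b: "b \<in> ball 0 1"
  define u where "u z = cinner (blinfun_apply (U z) x) x" for z
  \<comment> \<open>The summand \<open>- 2\<close> of the inner density is absorbed into \<open>v\<close>.\<close>
  define v where "v z = cinner (blinfun_apply (V z) x) x - complex_of_real ((norm x)\<^sup>2)" for z
  have u: "continuous_on (cball 0 1) u" "u holomorphic_on ball 0 1"
    unfolding u_def by (intro continuous_on_disc_resolvent_form holomorphic_on_disc_resolvent_form regular)+
  have v: "continuous_on (cball 0 1) v" "v holomorphic_on ball 0 1"
    unfolding v_def
    by (intro continuous_intros holomorphic_intros continuous_on_disc_resolvent_form
        holomorphic_on_disc_resolvent_form regular)+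
  define r where "r = max (cmod a) (cmod b)"
  have r: "cmod a \<le> r" "cmod b \<le> r" "0 \<le> r" "r < 1"
    using a b by (auto simp: r_def le_max_iff_disj)
  define e where "e N = 2 * r ^ Suc N / (1 - r)" for N
  define uN where "uN N = u 0 + (\<Sum>n=1..N. (deriv ^^ n) u 0 / fact n * a ^ n)" for N
  define vN where "vN N = v 0 + (\<Sum>n=1..N. (deriv ^^ n) v 0 / fact n * b ^ n)" for N
  have key: "0 \<le> 2 * Re (uN N) + 2 * Re (vN N) + c * (norm x)\<^sup>2 + (2 + c) * (e N * (norm x)\<^sup>2)" for N
  proof -
    obtain f where f: "f \<in> annulus_algebra R"
      and fR: "\<And>\<zeta>. cmod \<zeta> = 1 \<Longrightarrow> Re (f (complex_of_real R * \<zeta>)) = Re (1 + (\<Sum>n=1..N. 2 * a ^ n * \<zeta> ^ n))"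
      and fr: "\<And>\<zeta>. cmod \<zeta> = 1 \<Longrightarrow> Re (f (complex_of_real (1 / R) * \<zeta>)) = Re (1 + (\<Sum>n=1..N. 2 * cnj b ^ n * \<zeta> ^ n))"
      using Laurent_polynomial_boundary_values[OF R_gt_1, where N=N
          and \<alpha>="\<lambda>n. 2 * a ^ n" and \<beta>="\<lambda>n. 2 * cnj b ^ n"] by blast
    have fr': "Re (f (complex_of_real (1 / R) * \<zeta>)) = Re (1 + (\<Sum>n=1..N. 2 * (b ^ n * cnj \<zeta> ^ n)))"
      if "cmod \<zeta> = 1" for \<zeta>
    proof -
      have "1 + (\<Sum>n=1..N. 2 * (b ^ n * cnj \<zeta> ^ n)) = cnj (1 + (\<Sum>n=1..N. 2 * cnj b ^ n * \<zeta> ^ n))"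
        by (simp add: mult.assoc)
      then show ?thesis unfolding fr[OF that] by (simp only: complex_cnj(1) cnj.simps(1))
    qed
    have lower: "- e N \<le> Re (f z)" if "cmod z = R \<or> cmod z = 1 / R" for z
      using that
    proof
      assume z: "cmod z = R"
      define \<zeta> where "\<zeta> = z / complex_of_real R"
      have \<zeta>: "cmod \<zeta> = 1" "complex_of_real R * \<zeta> = z"
        using z R_pos by (simp_all add: \<zeta>_def norm_divide)
      have "cmod (a * \<zeta>) \<le> r" using r \<zeta> by (simp add: norm_mult)
      from truncated_Poisson_lower_bound[OF this r(4), of N]
      show ?thesis using fR[OF \<zeta>(1)] \<zeta>(2) by (simp add: e_def power_mult_distrib mult.assoc)
    next
      assume z: "cmod z = 1 / R"
      define \<zeta> where "\<zeta> = complex_of_real R * z"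
      have \<zeta>: "cmod \<zeta> = 1" "complex_of_real (1 / R) * \<zeta> = z"
        using z R_pos by (simp_all add: \<zeta>_def norm_mult)
      have "cmod (cnj b * \<zeta>) \<le> r" using r \<zeta> by (simp add: norm_mult)
      from truncated_Poisson_lower_bound[OF this r(4), of N]
      show ?thesis using fr[OF \<zeta>(1)] \<zeta>(2) by (simp add: e_def power_mult_distrib mult.assoc)
    qed
    define g where "g z = f z + complex_of_real (e N) * 1" for z
    have "g \<in> annulus_algebra R" unfolding g_def by (intro annulus_algebra_intros f)
    have "0 \<le> Re (cinner (blinfun_apply (S_map R c T g) x) x)"
    proof (rule S_map_positive_if_contractive)
      show "0 \<le> Re (g z)" if "cmod z = R \<or> cmod z = 1 / R" for z
        using lower[OF that] by (simp add: g_def)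
    qed (rule contr, assumption, fact)
    also have "S_map R c T g = S_map R c T f + (scalar_op (complex_of_real (e N)) o\<^sub>L id_blinfun)"
      unfolding g_def
      by (simp only: S_map_add[OF f annulus_algebra_intros(3)[OF annulus_algebra_intros(1)]]
          S_map_scale[OF annulus_algebra_intros(1)] S_map_one)
    also have "Re (cinner (blinfun_apply \<dots> x) x) =
        Re (cinner (blinfun_apply (S_map R c T f) x) x) + e N * (norm x)\<^sup>2"
      by (simp add: blinfun.add_left cinner_add_left cinner_scaleC_left cinner_self)
    finally have "0 \<le> (2 + c) * (Re (cinner (blinfun_apply (S_map R c T f) x) x) + e N * (norm x)\<^sup>2)"
      using c_gt by simp
    also have "\<dots> = (2 + c) * Re (cinner (blinfun_apply (S_map R c T f) x) x) + (2 + c) * (e N * (norm x)\<^sup>2)"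
      by (simp add: distrib_left)
    also have "(2 + c) * Re (cinner (blinfun_apply (S_map R c T f) x) x) =
        2 * Re (uN N) + 2 * Re (vN N) + c * (norm x)\<^sup>2"
    proof -
      have sc: "circle_mean (\<lambda>\<zeta>. h \<zeta> * (2 * k \<zeta>)) = 2 * circle_mean (\<lambda>\<zeta>. h \<zeta> * k \<zeta>)"
        if "continuous_on (sphere 0 1) h" "continuous_on (sphere 0 1) k" for h k :: "complex \<Rightarrow> real"
        using circle_mean_linear[OF bounded_linear_mult_right[of 2] continuous_on_mult[OF that]]
        by (simp add: mult_ac)
      have su: "continuous_on (sphere 0 1) u" "continuous_on (sphere 0 1) v"
        using continuous_on_subset[OF u(1)] continuous_on_subset[OF v(1)] by auto
      have "circle_mean (\<lambda>\<zeta>. Re (f (complex_of_real R * \<zeta>)) * outer_weight x \<zeta>) =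
          circle_mean (\<lambda>\<zeta>. Re (1 + (\<Sum>n=1..N. 2 * (a ^ n * cnj (cnj \<zeta>) ^ n))) * (2 * Re (u (cnj \<zeta>))))"
        by (rule circle_mean_cong) (simp add: fR outer_weight_def u_def mult.assoc)
      also have "\<dots> = circle_mean (\<lambda>\<zeta>. Re (1 + (\<Sum>n=1..N. 2 * (a ^ n * cnj \<zeta> ^ n))) * (2 * Re (u \<zeta>)))"
        by (rule circle_mean_cnj)
      also have "\<dots> = 2 * Re (uN N)"
        unfolding uN_def circle_mean_truncated_Poisson[OF u, symmetric]
        by (rule sc) (intro continuous_intros su)+
      finally have 1: "circle_mean (\<lambda>\<zeta>. Re (f (complex_of_real R * \<zeta>)) * outer_weight x \<zeta>) = 2 * Re (uN N)" .
      have "circle_mean (\<lambda>\<zeta>. Re (f (complex_of_real (1 / R) * \<zeta>)) * inner_weight x \<zeta>) =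
          circle_mean (\<lambda>\<zeta>. Re (1 + (\<Sum>n=1..N. 2 * (b ^ n * cnj \<zeta> ^ n))) * (2 * Re (v \<zeta>)))"
      proof (rule circle_mean_cong)
        fix \<zeta> :: complex assume "cmod \<zeta> = 1"
        moreover have "inner_weight x \<zeta> = 2 * Re (v \<zeta>)" by (simp add: inner_weight_def v_def)
        ultimately show "Re (f (complex_of_real (1 / R) * \<zeta>)) * inner_weight x \<zeta> =
            Re (1 + (\<Sum>n=1..N. 2 * (b ^ n * cnj \<zeta> ^ n))) * (2 * Re (v \<zeta>))"
          by (simp only: fr')
      qed
      also have "\<dots> = 2 * Re (vN N)"
        unfolding vN_def circle_mean_truncated_Poisson[OF v, symmetric]
        by (rule sc) (intro continuous_intros su)+
      finally have 2: "circle_mean (\<lambda>\<zeta>. Re (f (complex_of_real (1 / R) * \<zeta>)) * inner_weight x \<zeta>) = 2 * Re (vN N)" .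
      have "Re (laurent_coeffs R f 0) = circle_mean (\<lambda>\<zeta>. Re (1 + (\<Sum>n=1..N. 2 * (b ^ n * cnj \<zeta> ^ n))) * Re 1)"
        unfolding Re_laurent_0(2)[OF f] by (rule circle_mean_cong) (simp only: fr' one_complex.simps mult_1_right)
      also have "\<dots> = Re (1 + (\<Sum>n=1..N. (deriv ^^ n) (\<lambda>_. 1) 0 / fact n * b ^ n))"
        by (rule circle_mean_truncated_Poisson) (auto intro!: continuous_intros holomorphic_intros)
      also have "\<dots> = 1" by (simp add: higher_deriv_const)
      finally have 3: "Re (laurent_coeffs R f 0) = 1" .
      show ?thesis unfolding Re_S_map[OF f] 1 2 3 by simp
    qed
    finally show ?thesis .
  qed
  have "(\<lambda>N. 2 * Re (uN N) + 2 * Re (vN N) + c * (norm x)\<^sup>2 + (2 + c) * (e N * (norm x)\<^sup>2))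
      \<longlonglongrightarrow> 2 * Re (u a) + 2 * Re (v b) + c * (norm x)\<^sup>2 + (2 + c) * (0 * (norm x)\<^sup>2)"
  proof (intro tendsto_intros)
    show "uN \<longlonglongrightarrow> u a" "vN \<longlonglongrightarrow> v b"
      unfolding uN_def[abs_def] vN_def[abs_def]
      by (rule Taylor_partial_sums_tendsto[OF u(2) a], rule Taylor_partial_sums_tendsto[OF v(2) b])
    have "(\<lambda>N. 2 * (r * r ^ N) / (1 - r)) \<longlonglongrightarrow> 2 * (r * 0) / (1 - r)"
      by (intro tendsto_intros LIMSEQ_realpow_zero) (use r in auto)
    then show "e \<longlonglongrightarrow> 0" by (simp add: e_def[abs_def])
  qed
  then have "0 \<le> 2 * Re (u a) + 2 * Re (v b) + c * (norm x)\<^sup>2 + (2 + c) * (0 * (norm x)\<^sup>2)"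
    by (rule LIMSEQ_le_const) (use key in blast)
  then show "0 \<le> 2 * Re (cinner (blinfun_apply (U a) x) x) + 2 * Re (cinner (blinfun_apply (V b) x) x)
       + (c - 2) * (norm x)\<^sup>2"
    by (simp add: u_def v_def algebra_simps)
qed

end

theorem theorem3p12:
  fixes R c :: real
    and T :: "'a::complex_hilbert \<Rightarrow>\<^sub>L 'a"
  assumes "R > 1" and "c > -2"
    and "T \<in> bounded_ops"
    and "op_spectrum T \<subseteq> annulus R"
  shows "T \<in> DLA R c \<longleftrightarrow>
    (\<forall>f\<in>annulus_algebra R. norm (S_map R c T f) \<le> annulus_norm R f)"
proof -
  interpret annulus_operator R c T
    using assms by unfold_locales
  show ?thesis
    using norm_S_map_le_if_DLA DLA_if_contractive by blast
qed

end
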